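(* For positive integers $k$, we have \begin{align*} \frac{1}{\phi^* (R)} \sum_{\substack{\chi \bmod R \\ \chi \text{ primitive}}} \Big\lvert P_X \Big( \frac{1}{2} , \chi \Big) \Big\rvert ^{2k} \sim a(k) \Bigg[ \prod_{\substack{ \deg P \leq X \\ P \mid R }} \Bigg( \sum_{m=0}^{\infty} \frac{ d_k \big( P^m \big)^2 }{\lvert P \rvert^m } \Bigg)^{-1} \Bigg] \Big( e^{\gamma} X \Big)^{k^2} \end{align*} as $X , \deg R \longrightarrow \infty$ with $X \leq \log_q \deg R$. Here, $\gamma$ is the Euler-Mascheroni constant, and \begin{align*} a (k) = \prod_{ P \in \mathcal{P} } \Bigg( \bigg( 1 - \frac{1}{\lvert P \rvert} \bigg)^{k^2} \sum_{m=0}^{\infty} \frac{ d_k \big( P^m \big)^2 }{\lvert P \rvert^m } \Bigg) . \end{align*}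
   Context: Let $q$ be a prime power, $\mathcal{A}=\mathbb{F}_q[T]$, $\mathcal{M}$ the set of monic polynomials and $\mathcal{P}$ the set of monic irreducibles ("primes", always denoted $P$). For $A\neq 0$, $\lvert A\rvert = q^{\deg A}$. $\Lambda$ is the von Mangoldt function on $\mathcal{M}$, $d_k$ the $k$-fold divisor function. $R\in\mathcal{M}$, $\phi^*(R)$ is the number of primitive Dirichlet characters modulo $R$, and the sum is over primitive Dirichlet characters $\chi$ modulo $R$. $X\geq 1$ is an integer and $P_X(s,\chi) = \exp\Big( \sum_{A\in\mathcal{M},\ \deg A\le X} \frac{\chi(A)\Lambda(A)}{\lvert A\rvert^s \log\lvert A\rvert}\Big)$. *)

theory Defs
  imports "HOL-Analysis.Analysis" "HOL-Computational_Algebra.Computational_Algebra"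
begin

text \<open>Throughout, the finite field F_q is a finite type 'a of class field; q = CARD('a).\<close>

definition pabs :: "'a::{field,finite} poly \<Rightarrow> real" where
  "pabs A = real CARD('a) ^ degree A"

definition monic_poly :: "'a::field poly \<Rightarrow> bool" where
  "monic_poly A \<longleftrightarrow> lead_coeff A = 1"

definition prime_poly :: "'a::field poly \<Rightarrow> bool" where
  "prime_poly P \<longleftrightarrow> monic_poly P \<and> irreducible P"

definition vMangoldt :: "'a::{field,finite} poly \<Rightarrow> real" where
  "vMangoldt A =
     (if \<exists>P m. prime_poly P \<and> m \<ge> 1 \<and> A = P ^ m
      then ln (pabs (THE P. prime_poly P \<and> (\<exists>m\<ge>1. A = P ^ m)))
      else 0)"

definition dk :: "nat \<Rightarrow> 'a::field poly \<Rightarrow> nat" where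
  "dk k A = card {xs. length xs = k \<and> (\<forall>x\<in>set xs. monic_poly x) \<and> prod_list xs = A}"

definition dirichlet_char :: "'a::field poly \<Rightarrow> ('a poly \<Rightarrow> complex) \<Rightarrow> bool" where
  "dirichlet_char R chi \<longleftrightarrow>
     (\<forall>A B. chi (A * B) = chi A * chi B) \<and>
     (\<forall>A B. A mod R = B mod R \<longrightarrow> chi A = chi B) \<and>
     (\<forall>A. chi A = 0 \<longleftrightarrow> \<not> coprime A R)"

text \<open>Primitive: not induced by a character of any proper monic divisor R' of R.\<close>
definition primitive_char :: "'a::field poly \<Rightarrow> ('a poly \<Rightarrow> complex) \<Rightarrow> bool" where
  "primitive_char R chi \<longleftrightarrow> dirichlet_char R chi \<and>
     (\<forall>R'. monic_poly R' \<and> R' dvd R \<and> R' \<noteq> R \<longrightarrow>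
        (\<exists>A. coprime A R \<and> A mod R' = 1 mod R' \<and> chi A \<noteq> 1))"

definition prim_chars :: "'a::field poly \<Rightarrow> ('a poly \<Rightarrow> complex) set" where
  "prim_chars R = {chi. primitive_char R chi}"

definition phi_star :: "'a::field poly \<Rightarrow> nat" where
  "phi_star R = card (prim_chars R)"

definition PX :: "nat \<Rightarrow> complex \<Rightarrow> ('a::{field,finite} poly \<Rightarrow> complex) \<Rightarrow> complex" where
  "PX X s chi = exp (\<Sum>A\<in>{A. monic_poly A \<and> degree A \<le> X}.
       chi A * of_real (vMangoldt A) / ((of_real (pabs A) powr s) * of_real (ln (pabs A))))"

definition locfac :: "nat \<Rightarrow> 'a::{field,finite} poly \<Rightarrow> real" where
  "locfac k P = (\<Sum>m. real (dk k (P ^ m)) ^ 2 / pabs P ^ m)"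

definition a_const :: "'a::{field,finite} itself \<Rightarrow> nat \<Rightarrow> real" where
  "a_const TYPE('a) k = lim (\<lambda>N. \<Prod>P\<in>{P::'a poly. prime_poly P \<and> degree P \<le> N}.
       (1 - 1 / pabs P) ^ (k ^ 2) * locfac k P)"

end

theory Submission
  imports Defs "HOL-Real_Asymp.Real_Asymp"
begin

text \<open>
  Since \<open>P_X(1/2, \<chi>)\<close> is the exponential of a finite sum over prime powers, its \<open>k\<close>-th power is
  an absolutely convergent series \<open>\<Sum>A. w A * \<chi> A / |A| ^ (1/2)\<close> over the \<open>X\<close>-smooth polynomials with
  nonnegative multiplicative \<open>w\<close>. Inclusion-exclusion over the primes dividing \<open>R\<close> shows that the
  average of \<open>\<chi> A * cnj (\<chi> B)\<close> over the primitive characters, for \<open>A \<noteq> B\<close>, is at most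
  \<open>8 ^ \<omega>(R) * |A| * |B| / |R|\<close>; it is also at most 1, so the fourth root of this bound is available and
  makes the whole off-diagonal part converge. It is \<open>O(q ^ (- deg R / 8) * exp (2 k X q ^ (3 X / 4)))\<close>,
  which tends to 0 because \<open>deg R \<ge> q ^ X\<close>. The diagonal is an Euler product over the primes of degree
  at most \<open>X\<close> not dividing \<open>R\<close>, whose factors agree with those of the theorem in all exponents \<open>m\<close> with
  \<open>m * deg P \<le> X\<close>; Mertens' third theorem for \<open>F_q[T]\<close> then produces \<open>(e ^ \<gamma> X) ^ (k ^ 2)\<close>.
\<close>

section \<open>Polynomials over a finite field\<close>

text \<open>Neither bound for the off-diagonal average works alone. The bound 1 saves nothing in
  \<open>|R|\<close>. The full bound puts \<open>|A| ^ (1/2)\<close> into the sum over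
  \<open>A\<close>, whose logarithm then grows roughly like \<open>q ^ (3 X / 2)\<close>, too much
  for \<open>|R|\<close>, which may be as small as \<open>q ^ (q ^ X)\<close>. With the power theta
  of the bound that logarithm is about \<open>q ^ ((1/2 + theta) X)\<close>, which is of smaller
  order than \<open>q ^ X\<close> as soon as theta < 1/2; the same condition keeps
  \<open>|P| ^ (theta - 1/2)\<close> below 1, where binomial coefficients dominate the local series.
  Theta = 1/4 meets both demands, and the series is never cut off at a degree. The 8 is 2 * 4:
  inclusion-exclusion costs 2 per prime divisor of \<open>R\<close>, and \<open>phi_star R\<close>
  is at least \<open>|R|\<close> divided by 4 per prime divisor. The latter presupposes a primitive
  character, and there may be none: for q = 2, a prime of degree 1 dividing \<open>R\<close> exactly
  once rules them out.\<close>

lemma poly_bezout: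
  fixes A B :: "'a::field poly"
  shows "\<exists>D U V. D dvd A \<and> D dvd B \<and> D = U * A + V * B"
\<comment> \<open>Zero and the nonzero constants all have degree 0; shifting the measure by one
  makes the passage from a constant \<open>B\<close> to the remainder 0 a decrease.\<close>
proof (induction "if B = 0 then 0 else Suc (degree B)" arbitrary: A B rule: less_induct)
  case less
  show ?case
  proof (cases "B = 0")
    case True
    have "A dvd A \<and> A dvd B \<and> A = 1 * A + 0 * B" using True by simp
    then show ?thesis by blast
  next
    case False
    have "A mod B = 0 \<or> degree (A mod B) < degree B"
      using False by (rule degree_mod_less)
    then have "(if A mod B = 0 then 0 else Suc (degree (A mod B)))
        < (if B = 0 then 0 else Suc (degree B))"
      using False by auto
    from less[OF this] obtain D U V
      where D: "D dvd B" "D dvd A mod B" "D = U * B + V * (A mod B)" by blast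
    have "D dvd A" using D(1,2) by (metis dvd_mod_iff)
    moreover have "D = V * A + (U - V * (A div B)) * B"
      unfolding D(3) by (simp add: minus_div_mult_eq_mod [symmetric] algebra_simps)
    ultimately show ?thesis using D(1) by blast
  qed
qed

lemma coprime_poly_iff_bezout:
  fixes A B :: "'a::field poly"
  shows "coprime A B \<longleftrightarrow> (\<exists>U V. U * A + V * B = 1)"
proof
  assume "coprime A B"
  moreover obtain D U V where D: "D dvd A" "D dvd B" "D = U * A + V * B"
    using poly_bezout by blast
  ultimately have "D dvd 1" by (simp add: coprime_common_divisor)
  then obtain E where "1 = D * E" by (elim dvdE)
  then have "(E * U) * A + (E * V) * B = 1"
    by (simp add: D(3) algebra_simps)
  then show "\<exists>U V. U * A + V * B = 1" by blast
next
  assume "\<exists>U V. U * A + V * B = 1"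
  then obtain U V where *: "U * A + V * B = 1" by blast
  show "coprime A B"
  proof (rule coprimeI)
    fix c assume "c dvd A" "c dvd B"
    then have "c dvd U * A + V * B" by simp
    then show "c dvd 1" by (simp add: *)
  qed
qed

lemma coprime_poly_dvd_mult:
  fixes A B C :: "'a::field poly"
  assumes "coprime A B" "A dvd B * C"
  shows "A dvd C"
proof -
  obtain U V where "U * A + V * B = 1" using assms(1) coprime_poly_iff_bezout by blast
  then have "C = (U * A + V * B) * C" by simp
  also have "\<dots> = A * (U * C) + V * (B * C)" by (simp add: algebra_simps)
  also have "A dvd \<dots>" using assms(2) by simp
  finally show ?thesis .
qed

lemma coprime_poly_mult_right:
  fixes A B C :: "'a::field poly"
  assumes "coprime A B" "coprime A C"
  shows "coprime A (B * C)"
proof -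
  obtain U V where 1: "U * A + V * B = 1" using assms(1) coprime_poly_iff_bezout by blast
  obtain S T where 2: "S * A + T * C = 1" using assms(2) coprime_poly_iff_bezout by blast
  have "(U * A + V * B) * (S * A + T * C) = 1" by (simp add: 1 2)
  then have "(U * S * A + U * T * C + V * B * S) * A + (V * T) * (B * C) = 1"
    by (simp add: algebra_simps)
  then show ?thesis using coprime_poly_iff_bezout by blast
qed

lemma coprime_poly_mult_left:
  fixes A B C :: "'a::field poly"
  shows "coprime A C \<Longrightarrow> coprime B C \<Longrightarrow> coprime (A * B) C"
  by (metis coprime_poly_mult_right coprime_commute)

lemma coprime_poly_mod_cong:
  fixes A B R :: "'a::field poly"
  assumes "A mod R = B mod R" "coprime A R"
  shows "coprime B R"
proof -
  obtain U V where 1: "U * A + V * R = 1" using assms(2) coprime_poly_iff_bezout by blast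
  have "R dvd A - B" using assms(1) by (simp add: mod_eq_dvd_iff)
  then obtain T where "A - B = R * T" by (elim dvdE)
  then have "A = B + R * T" by (simp add: algebra_simps)
  then have "U * B + (U * T + V) * R = 1" using 1 by (simp add: algebra_simps)
  then show ?thesis using coprime_poly_iff_bezout by blast
qed

lemma irreducible_poly_coprime:
  fixes A P :: "'a::field poly"
  assumes "irreducible P" "\<not> P dvd A"
  shows "coprime P A"
proof (rule coprimeI)
  fix c assume c: "c dvd P" "c dvd A"
  have "P dvd c \<or> c dvd 1" using irreducibleD'[OF assms(1) c(1)] .
  then show "c dvd 1" using c(2) assms(2) dvd_trans by blast
qed

section \<open>Prime and monic polynomials\<close>

lemma prime_poly_not_unit: "prime_poly P \<Longrightarrow> \<not> P dvd 1"
  by (auto simp: prime_poly_def irreducible_def)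

lemma prime_poly_nonzero: "prime_poly P \<Longrightarrow> P \<noteq> 0"
  by (auto simp: prime_poly_def irreducible_def)

lemma prime_poly_degree_pos: "prime_poly (P::'a::field poly) \<Longrightarrow> degree P > 0"
  using prime_poly_not_unit[of P] prime_poly_nonzero[of P] is_unit_iff_degree[of P] by auto

lemma prime_poly_coprime_iff:
  fixes A P :: "'a::field poly"
  assumes "prime_poly P"
  shows "coprime P A \<longleftrightarrow> \<not> P dvd A"
proof
  assume "coprime P A"
  then show "\<not> P dvd A"
    using prime_poly_not_unit[OF assms] coprime_common_divisor[of P A P] by auto
qed (use assms irreducible_poly_coprime in \<open>auto simp: prime_poly_def\<close>)

lemma prime_poly_dvd_mult:
  fixes A B P :: "'a::field poly"
  assumes "prime_poly P"
  shows "P dvd A * B \<longleftrightarrow> P dvd A \<or> P dvd B"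
  using coprime_poly_dvd_mult[of P A B] prime_poly_coprime_iff[OF assms, of A] by auto

lemma prime_poly_dvd_power:
  fixes A P :: "'a::field poly"
  assumes "prime_poly P" "P dvd A ^ n"
  shows "P dvd A"
  using assms(2) by (induction n) (auto simp: prime_poly_dvd_mult[OF assms(1)] prime_poly_not_unit[OF assms(1)])

lemma prime_poly_dvd_prod:
  fixes P :: "'a::field poly"
  assumes "prime_poly P" "finite S" "P dvd prod f S"
  shows "\<exists>x\<in>S. P dvd f x"
  using assms(2,3) by (induction S) (auto simp: prime_poly_dvd_mult[OF assms(1)] prime_poly_not_unit[OF assms(1)])

lemma monic_poly_nonzero: "monic_poly A \<Longrightarrow> A \<noteq> 0"
  by (auto simp: monic_poly_def)

lemma monic_poly_1 [simp]: "monic_poly 1"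
  by (simp add: monic_poly_def)

lemma monic_poly_mult: "monic_poly A \<Longrightarrow> monic_poly B \<Longrightarrow> monic_poly (A * B)"
  by (simp add: monic_poly_def lead_coeff_mult)

lemma monic_poly_power: "monic_poly A \<Longrightarrow> monic_poly (A ^ n)"
  by (simp add: monic_poly_def lead_coeff_power)

lemma monic_poly_factor: "monic_poly A \<Longrightarrow> monic_poly (A * B) \<Longrightarrow> monic_poly B"
  by (simp add: monic_poly_def lead_coeff_mult)

lemma monic_dvd_antisym:
  fixes A B :: "'a::field poly"
  assumes "monic_poly A" "monic_poly B" "A dvd B" "B dvd A"
  shows "A = B"
proof -
  obtain C where C: "B = A * C" using assms(3) by (elim dvdE)
  have "monic_poly C" using C assms(1,2) monic_poly_factor by blast
  have "degree B \<le> degree A"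
    using assms(1,4) by (intro dvd_imp_degree_le) (auto dest: monic_poly_nonzero)
  then have "degree C = 0"
    using C assms by (simp add: degree_mult_eq monic_poly_nonzero \<open>monic_poly C\<close>)
  then obtain c where "C = [:c:]" by (elim degree_eq_zeroE)
  then have "C = 1" using \<open>monic_poly C\<close> by (simp add: monic_poly_def one_pCons)
  then show ?thesis by (simp add: C)
qed

lemma prime_poly_dvd_prime_poly:
  fixes P Q :: "'a::field poly"
  assumes "prime_poly P" "prime_poly Q" "P dvd Q"
  shows "P = Q"
proof -
  have "Q dvd P"
    using irreducibleD'[of Q P] assms prime_poly_not_unit by (auto simp: prime_poly_def)
  then show ?thesis using assms monic_dvd_antisym by (auto simp: prime_poly_def)
qed

lemma monic_degree_0: "monic_poly A \<Longrightarrow> degree A = 0 \<Longrightarrow> A = 1"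
  by (metis degree_eq_zeroE lead_coeff_pCons(2) monic_poly_def one_pCons)

lemma exists_prime_poly_dvd:
  fixes A :: "'a::field poly"
  assumes "degree A > 0"
  shows "\<exists>P. prime_poly P \<and> P dvd A"
  using assms
proof (induction "degree A" arbitrary: A rule: less_induct)
  case less
  show ?case
  proof (cases "irreducible A")
    case True
    let ?P = "smult (inverse (lead_coeff A)) A"
    have nz: "lead_coeff A \<noteq> 0" using less(2) by auto
    have "monic_poly ?P" using nz by (simp add: monic_poly_def)
    moreover have "?P dvd A" using nz by (simp add: smult_dvd_iff)
    moreover have "irreducible ?P"
    proof (rule irreducibleI')
      show "?P \<noteq> 0" using nz by auto
      show "\<not> ?P dvd 1" using True nz by (auto simp: smult_dvd_iff irreducible_def)
      fix b assume "b dvd ?P"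
      then have "b dvd A" using nz by (simp add: dvd_smult_iff)
      then have "A dvd b \<or> b dvd 1" using True irreducibleD' by blast
      then show "?P dvd b \<or> b dvd 1" using nz by (simp add: smult_dvd_iff)
    qed
    ultimately show ?thesis by (auto simp: prime_poly_def)
  next
    case False
    have "A \<noteq> 0" using less(2) by auto
    moreover from this have "\<not> A dvd 1" using less(2) is_unit_iff_degree[of A] by auto
    ultimately
    obtain b where b: "b dvd A" "\<not> A dvd b" "\<not> b dvd 1"
      using False irreducibleI' by blast
    obtain c where c: "A = b * c" using b(1) by (elim dvdE)
    have "A \<noteq> 0" using less(2) by auto
    have nz: "b \<noteq> 0" "c \<noteq> 0" using \<open>A \<noteq> 0\<close> c by auto
    have "\<not> c dvd 1"
    proof
      assume "c dvd 1"
      then have "b * c dvd b * 1" by (rule mult_dvd_mono[OF dvd_refl])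
      then show False using b(2) c by simp
    qed
    then have "degree c > 0" using is_unit_iff_degree[of c] nz by auto
    then have "degree b < degree A" using c nz by (simp add: degree_mult_eq)
    moreover have "degree b > 0" using b(3) nz is_unit_iff_degree[of b] by auto
    ultimately obtain P where "prime_poly P" "P dvd b" using less(1) by blast
    then show ?thesis using b(1) dvd_trans by blast
  qed
qed

text \<open>Described by coefficients so that 0 always belongs: \<open>n = 0\<close> gives
  \<open>{0}\<close>, and the cardinality \<open>q ^ n\<close> holds without exception. For
  \<open>n = degree R\<close> with \<open>R\<close> nonzero these are the residues modulo
  \<open>R\<close>.\<close>

definition small_polys :: "nat \<Rightarrow> 'a::zero poly set" where
  "small_polys n = {A. \<forall>i\<ge>n. coeff A i = 0}"

lemma small_polys_iff: "A \<in> small_polys n \<longleftrightarrow> A = 0 \<or> degree A < n"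
proof (cases "A = 0")
  case False
  then have "coeff A (degree A) \<noteq> 0" by simp
  then have "A \<in> small_polys n \<Longrightarrow> degree A < n"
    unfolding small_polys_def by (metis (mono_tags) linorder_not_less mem_Collect_eq)
  then show ?thesis using False by (auto simp: small_polys_def intro!: coeff_eq_0)
qed (simp add: small_polys_def)

lemma small_polys_Suc:
  "small_polys (Suc n) = (\<lambda>(a, A). pCons a A) ` (UNIV \<times> (small_polys n :: 'a::zero poly set))"
proof (intro equalityI subsetI)
  fix A :: "'a poly" assume A: "A \<in> small_polys (Suc n)"
  obtain a B where B: "A = pCons a B" by (cases A)
  have "coeff B i = 0" if "i \<ge> n" for i
    using A that coeff_pCons_Suc[of a B i] by (auto simp: B small_polys_def)
  then have "B \<in> small_polys n" by (simp add: small_polys_def)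
  then show "A \<in> (\<lambda>(a, A). pCons a A) ` (UNIV \<times> small_polys n)" using B by auto
qed (auto simp: small_polys_def coeff_pCons split: nat.splits)

lemma finite_small_polys: "finite (small_polys n :: 'a::{field,finite} poly set)"
  and card_small_polys: "card (small_polys n :: 'a::{field,finite} poly set) = CARD('a) ^ n"
proof (induction n)
  case 0
  have "small_polys 0 = {0 :: 'a poly}" by (auto simp: small_polys_def poly_eq_iff)
  then show "finite (small_polys 0 :: 'a poly set)" "card (small_polys 0 :: 'a poly set) = CARD('a) ^ 0"
    by auto
next
  case (Suc n)
  have inj: "inj_on (\<lambda>(a, A). pCons a A) (UNIV \<times> (small_polys n :: 'a poly set))"
    by (auto simp: inj_on_def)
  show "finite (small_polys (Suc n) :: 'a poly set)"
    using Suc by (simp add: small_polys_Suc)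
  show "card (small_polys (Suc n) :: 'a poly set) = CARD('a) ^ Suc n"
    unfolding small_polys_Suc card_image[OF inj] using Suc by (simp add: card_cartesian_product)
qed

definition monics :: "nat \<Rightarrow> 'a::field poly set" where
  "monics n = {A. monic_poly A \<and> degree A = n}"

lemma monics_eq_image: "monics n = (\<lambda>A. monom 1 n + A) ` (small_polys n :: 'a::field poly set)"
proof (intro equalityI subsetI)
  fix A :: "'a poly" assume A: "A \<in> monics n"
  have "A - monom 1 n \<in> small_polys n"
    using A by (auto simp: small_polys_def monics_def monic_poly_def coeff_eq_0)
  moreover have "A = monom 1 n + (A - monom 1 n)" by simp
  ultimately show "A \<in> (\<lambda>A. monom 1 n + A) ` small_polys n" by blast
next
  fix A :: "'a poly" assume "A \<in> (\<lambda>A. monom 1 n + A) ` small_polys n"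
  then obtain B where B: "B \<in> small_polys n" "A = monom 1 n + B" by auto
  have c: "coeff A n = 1" "\<And>i. i > n \<Longrightarrow> coeff A i = 0"
    using B by (auto simp: small_polys_def)
  then have "degree A = n"
    by (intro antisym degree_le le_degree) auto
  then show "A \<in> monics n" using c by (simp add: monics_def monic_poly_def)
qed

lemma finite_monics: "finite (monics n :: 'a::{field,finite} poly set)"
  by (simp add: monics_eq_image finite_small_polys)

lemma card_monics: "card (monics n :: 'a::{field,finite} poly set) = CARD('a) ^ n"
  unfolding monics_eq_image by (subst card_image) (auto simp: inj_on_def card_small_polys)

lemma finite_degree_le: "finite {A :: 'a::{field,finite} poly. degree A \<le> n}"
proof -
  have "{A :: 'a poly. degree A \<le> n} \<subseteq> small_polys (Suc n)" by (auto simp: small_polys_iff)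
  then show ?thesis using finite_small_polys finite_subset by blast
qed

definition primes_upto :: "nat \<Rightarrow> 'a::field poly set" where
  "primes_upto n = {P. prime_poly P \<and> degree P \<le> n}"

lemma finite_primes_upto: "finite (primes_upto n :: 'a::{field,finite} poly set)"
  by (rule finite_subset[OF _ finite_degree_le[of n]]) (auto simp: primes_upto_def)

lemma card_field_ge_2: "CARD('a::{field,finite}) \<ge> 2"
proof -
  have "card {0, 1 :: 'a} \<le> CARD('a)" by (intro card_mono) auto
  then show ?thesis by simp
qed

lemma pabs_ge_2: "prime_poly (P :: 'a::{field,finite} poly) \<Longrightarrow> pabs P \<ge> 2"
proof -
  assume P: "prime_poly P"
  have "2 \<le> real CARD('a) ^ 1" using card_field_ge_2[where 'a='a] by simp
  also have "real CARD('a) ^ 1 \<le> real CARD('a) ^ degree P"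
    using prime_poly_degree_pos[OF P] card_field_ge_2[where 'a='a] by (intro power_increasing) auto
  finally show ?thesis by (simp add: pabs_def)
qed

lemma pabs_pos: "pabs (A :: 'a::{field,finite} poly) > 0"
  by (simp add: pabs_def)

lemma pabs_power: "A \<noteq> 0 \<Longrightarrow> pabs (A ^ n) = pabs A ^ n"
  by (simp add: pabs_def degree_power_eq power_mult [symmetric] mult.commute)

lemma pabs_mult: "A \<noteq> 0 \<Longrightarrow> B \<noteq> 0 \<Longrightarrow> pabs (A * B) = pabs A * pabs B"
  by (simp add: pabs_def degree_mult_eq power_add)

section \<open>Prime powers and the prime polynomial theorem\<close>

lemma prime_poly_power_eq:
  fixes P Q :: "'a::field poly"
  assumes "prime_poly P" "prime_poly Q" "m \<ge> 1" "P ^ m = Q ^ n"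
  shows "P = Q" "m = n"
proof -
  have "P dvd P ^ m" using assms(3) by (simp add: dvd_power)
  then show "P = Q"
    using assms prime_poly_dvd_power prime_poly_dvd_prime_poly by metis
  then have "degree (P ^ m) = degree (P ^ n)" using assms(4) by simp
  then show "m = n"
    using prime_poly_degree_pos[OF assms(1)] by (simp add: degree_power_eq prime_poly_nonzero[OF assms(1)])
qed

lemma vMangoldt_prime_power:
  fixes P :: "'a::{field,finite} poly"
  assumes "prime_poly P" "m \<ge> 1"
  shows "vMangoldt (P ^ m) = ln (pabs P)"
proof -
  have "(THE Q. prime_poly Q \<and> (\<exists>n\<ge>1. P ^ m = Q ^ n)) = P"
    using assms prime_poly_power_eq(1) by (intro the_equality) blast+
  moreover have "\<exists>Q n. prime_poly Q \<and> n \<ge> 1 \<and> P ^ m = Q ^ n" using assms by blast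
  ultimately show ?thesis by (simp add: vMangoldt_def)
qed

text \<open>On \<open>P ^ m\<close> the von Mangoldt function divided by the logarithm of the
  absolute value is \<open>1 / m\<close>; off the prime powers it vanishes. The function
  \<open>h\<close> will carry the character value.\<close>

lemma sum_vMangoldt:
  fixes h :: "'a::{field,finite} poly \<Rightarrow> 'b::real_normed_field"
  shows "(\<Sum>A\<in>{A. monic_poly A \<and> degree A \<le> X}. h A * of_real (vMangoldt A / ln (pabs A)))
    = (\<Sum>P\<in>primes_upto X. \<Sum>m\<in>{1..X div degree P}. h (P ^ m) / of_nat m)"
proof -
  let ?I = "SIGMA P:primes_upto X. {1..X div degree P}"
  let ?M = "{A. monic_poly A \<and> degree A \<le> X} :: 'a poly set"
  have inj: "inj_on (\<lambda>(P, m). P ^ m) ?I"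
    unfolding inj_on_def primes_upto_def using prime_poly_power_eq by (auto; blast)
  have fin: "finite ?M" by (rule finite_subset[OF _ finite_degree_le[of X]]) auto
  have sub: "(\<lambda>(P, m). P ^ m) ` ?I \<subseteq> ?M"
  proof clarify
    fix P :: "'a poly" and m assume "P \<in> primes_upto X" "m \<in> {1..X div degree P}"
    then show "monic_poly (P ^ m) \<and> degree (P ^ m) \<le> X"
      by (auto simp: primes_upto_def monic_poly_power prime_poly_def degree_power_eq
          less_eq_div_iff_mult_less_eq prime_poly_degree_pos irreducible_def)
  qed
  have zero: "h A * of_real (vMangoldt A / ln (pabs A)) = 0" if "A \<in> ?M - (\<lambda>(P, m). P ^ m) ` ?I" for A
  proof (cases "\<exists>P m. prime_poly P \<and> m \<ge> 1 \<and> A = P ^ m")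
    case True
    then obtain P m where P: "prime_poly P" "m \<ge> 1" "A = P ^ m" by blast
    have "m * degree P \<le> X" using that P by (simp add: degree_power_eq prime_poly_nonzero)
    then have "m \<le> X div degree P" "degree P \<le> X"
      using P prime_poly_degree_pos[OF P(1)]
      by (auto simp: less_eq_div_iff_mult_less_eq intro: order.trans[of _ "m * degree P"])
    then have "A \<in> (\<lambda>(P, m). P ^ m) ` ?I" using P by (force simp: primes_upto_def)
    then show ?thesis using that by blast
  next
    case False
    then have "vMangoldt A = 0" unfolding vMangoldt_def by (rule if_not_P)
    then show ?thesis by simp
  qed
  have "(\<Sum>A\<in>?M. h A * of_real (vMangoldt A / ln (pabs A)))
      = (\<Sum>A\<in>(\<lambda>(P, m). P ^ m) ` ?I. h A * of_real (vMangoldt A / ln (pabs A)))"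
    by (rule sum.mono_neutral_right[OF fin sub]) (use zero in blast)
  also have "\<dots> = (\<Sum>(P,m)\<in>?I. h (P ^ m) * of_real (vMangoldt (P ^ m) / ln (pabs (P ^ m))))"
    by (subst sum.reindex[OF inj]) (simp add: o_def case_prod_unfold)
  also have "\<dots> = (\<Sum>(P,m)\<in>?I. h (P ^ m) / of_nat m)"
  proof (rule sum.cong[OF refl], clarify)
    fix P :: "'a poly" and m assume P: "P \<in> primes_upto X" "m \<in> {1..X div degree P}"
    have "prime_poly P" "m \<ge> 1" using P by (auto simp: primes_upto_def)
    moreover have "ln (pabs P) > 0" using pabs_ge_2[OF \<open>prime_poly P\<close>] by (intro ln_gt_zero) simp
    moreover have "ln (pabs (P ^ m)) = real m * ln (pabs P)"
      using pabs_pos[of P] by (simp add: pabs_power prime_poly_nonzero \<open>prime_poly P\<close> ln_realpow)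
    ultimately have "vMangoldt (P ^ m) / ln (pabs (P ^ m)) = 1 / real m"
      by (simp add: vMangoldt_prime_power)
    then show "h (P ^ m) * of_real (vMangoldt (P ^ m) / ln (pabs (P ^ m))) = h (P ^ m) / of_nat m"
      by (simp only:) simp
  qed
  also have "\<dots> = (\<Sum>P\<in>primes_upto X. \<Sum>m\<in>{1..X div degree P}. h (P ^ m) / of_nat m)"
    by (rule sum.Sigma [symmetric]) (auto simp: finite_primes_upto)
  finally show ?thesis .
qed

text \<open>Regrouping by the total degree \<open>n = m * degree P\<close>. When the summand depends
  only on \<open>n\<close> and \<open>degree P\<close>, the inner sum falls to the prime polynomial
  theorem.\<close>

lemma sum_prime_powers_by_degree:
  fixes f :: "'a::{field,finite} poly \<Rightarrow> nat \<Rightarrow> 'b::comm_monoid_add"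
  shows "(\<Sum>P\<in>primes_upto X. \<Sum>m\<in>{1..X div degree P}. f P m)
    = (\<Sum>n\<in>{1..X}. \<Sum>P\<in>{P\<in>primes_upto n. degree P dvd n}. f P (n div degree P))"
proof -
  have "(\<Sum>P\<in>primes_upto X. \<Sum>m\<in>{1..X div degree P}. f P m)
      = (\<Sum>(P,m)\<in>(SIGMA P:primes_upto X. {1..X div degree P}). f P m)"
    by (rule sum.Sigma) (auto simp: finite_primes_upto)
  also have "\<dots> = (\<Sum>(n,P)\<in>(SIGMA n:{1..X}. {P\<in>primes_upto n. degree P dvd n}). f P (n div degree P))"
  proof -
    let ?I = "SIGMA P:(primes_upto X :: 'a poly set). {1..X div degree P}"
    let ?J = "SIGMA n:{1..X}. {P\<in>(primes_upto n :: 'a poly set). degree P dvd n}"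
    have fwd: "degree P > 0 \<and> (m * degree P, P) \<in> ?J" if "(P, m) \<in> ?I" for P m
    proof -
      have pos: "degree P > 0" using that by (auto simp: primes_upto_def prime_poly_degree_pos)
      have "m * degree P \<le> X" using that pos by (simp add: less_eq_div_iff_mult_less_eq)
      moreover have "1 \<le> m * degree P" "degree P \<le> m * degree P" using that pos by auto
      ultimately show ?thesis using that pos by (auto simp: primes_upto_def)
    qed
    have bwd: "n div degree P * degree P = n \<and> (P, n div degree P) \<in> ?I" if "(n, P) \<in> ?J" for n P
    proof -
      have pos: "degree P > 0" using that by (auto simp: primes_upto_def prime_poly_degree_pos)
      have "degree P \<le> n" using that by (simp add: primes_upto_def)
      then have "n div degree P \<ge> 1" using pos by (simp add: Suc_le_eq div_greater_zero_iff)
      then show ?thesis using that by (auto simp: primes_upto_def div_le_mono)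
    qed
    show ?thesis
      by (rule sum.reindex_bij_witness[where
          j = "\<lambda>(P,m). (m * degree P, P)" and i = "\<lambda>(n,P). (P, n div degree P)"])
        (use fwd bwd in \<open>simp_all only: split_paired_all prod.case nonzero_mult_div_cancel_right\<close>, auto dest!: fwd bwd)
  qed
  also have "\<dots> = (\<Sum>n\<in>{1..X}. \<Sum>P\<in>{P\<in>primes_upto n. degree P dvd n}. f P (n div degree P))"
    by (rule sum.Sigma [symmetric]) (auto simp: finite_primes_upto)
  finally show ?thesis .
qed

text \<open>The number of \<open>m\<close> with \<open>P ^ m dvd A\<close> is the exponent of
  \<open>P\<close> in \<open>A\<close>; one prime factor is split off at a time. The bound
  \<open>N\<close> is separate from \<open>degree A\<close> so that it stays fixed while the degree
  drops.\<close>

lemma degree_eq_sum_prime_powers: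
  fixes A :: "'a::{field,finite} poly"
  assumes "monic_poly A" "degree A \<le> N"
  shows "degree A = (\<Sum>P\<in>primes_upto N. degree P * card {m\<in>{1..N}. P ^ m dvd A})"
  using assms
proof (induction "degree A" arbitrary: A rule: less_induct)
  case less
  show ?case
  proof (cases "degree A = 0")
    case True
    have "P ^ m dvd A \<Longrightarrow> m \<ge> 1 \<Longrightarrow> P \<in> primes_upto N \<Longrightarrow> False" for P m
      using monic_degree_0[OF less(2) True] prime_poly_not_unit
      by (auto simp: primes_upto_def is_unit_power_iff)
    then have empty: "{m\<in>{1..N}. P ^ m dvd A} = {}" if "P \<in> primes_upto N" for P using that by auto
    have "(\<Sum>P\<in>primes_upto N. degree P * card {m\<in>{1..N}. P ^ m dvd A}) = 0"
      by (rule sum.neutral) (metis (no_types, lifting) empty card.empty mult_0_right)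
    then show ?thesis using True by simp
  next
    case False
    then obtain P where P: "prime_poly P" "P dvd A" using exists_prime_poly_dvd by blast
    obtain B where B: "A = P * B" using P(2) by (elim dvdE)
    have mB: "monic_poly B" using B less(2) P monic_poly_factor by (auto simp: prime_poly_def)
    note nz = prime_poly_nonzero[OF P(1)] monic_poly_nonzero[OF mB]
    have deg: "degree A = degree P + degree B" using nz by (simp add: B degree_mult_eq)
    have dP: "degree P > 0" using prime_poly_degree_pos[OF P(1)] .
    have IH: "degree B = (\<Sum>P\<in>primes_upto N. degree P * card {m\<in>{1..N}. P ^ m dvd B})"
      using less(3) deg dP mB by (intro less(1)) auto
    have PN: "P \<in> primes_upto N" using P deg less(3) by (simp add: primes_upto_def)
    have same: "card {m\<in>{1..N}. P ^ m dvd A} = Suc (card {m\<in>{1..N}. P ^ m dvd B})"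
    proof -
      \<comment> \<open>The exponents counted for \<open>A\<close> are 1 and the exponents counted
        for \<open>B\<close> raised by one; this keeps the raised ones at most
        \<open>N\<close>.\<close>
      have "\<not> P ^ N dvd B"
      proof
        assume "P ^ N dvd B"
        then have "N * degree P \<le> degree B"
          using dvd_imp_degree_le[of "P ^ N" B] nz by (simp add: degree_power_eq)
        moreover have "N \<le> N * degree P" using dP by simp
        ultimately show False using deg dP less(3) by linarith
      qed
      then have "{m\<in>{1..N}. P ^ m dvd A} = Suc ` insert 0 {m\<in>{1..N}. P ^ m dvd B}"
      proof (intro equalityI subsetI)
        fix m assume m: "m \<in> {m\<in>{1..N}. P ^ m dvd A}"
        then obtain k where k: "m = Suc k" by (cases m) auto
        then have "P ^ k dvd B" using m nz by (simp add: B)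
        then show "m \<in> Suc ` insert 0 {m\<in>{1..N}. P ^ m dvd B}" using m k by (cases k) auto
      next
        fix m assume "m \<in> Suc ` insert 0 {m\<in>{1..N}. P ^ m dvd B}"
        then obtain k where k: "m = Suc k" "k = 0 \<or> k \<in> {1..N} \<and> P ^ k dvd B" by auto
        have "k < N" using k(2) \<open>\<not> P ^ N dvd B\<close> less(3) deg dP by (cases "k = N") auto
        then show "m \<in> {m\<in>{1..N}. P ^ m dvd A}" using k by (auto simp: B)
      qed
      also have "card \<dots> = card (insert 0 {m\<in>{1..N}. P ^ m dvd B})" by (rule card_image) (rule inj_Suc[THEN inj_on_subset, OF subset_UNIV])
      also have "\<dots> = Suc (card {m\<in>{1..N}. P ^ m dvd B})" by (rule card_insert_disjoint) auto
      finally show ?thesis .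
    qed
    have other: "{m\<in>{1..N}. Q ^ m dvd A} = {m\<in>{1..N}. Q ^ m dvd B}"
      if "Q \<in> primes_upto N - {P}" for Q
    proof -
      have "prime_poly Q" "Q \<noteq> P" using that by (auto simp: primes_upto_def)
      then have "\<not> P dvd Q" using prime_poly_dvd_prime_poly P by blast
      then have "coprime P (Q ^ m)" for m
        using prime_poly_coprime_iff[OF P(1)] prime_poly_dvd_power[OF P(1)] by blast
      then have "Q ^ m dvd A \<Longrightarrow> Q ^ m dvd B" for m
        unfolding B using coprime_poly_dvd_mult coprime_commute by blast
      then show ?thesis by (auto simp: B)
    qed
    have fin: "finite (primes_upto N :: 'a poly set)" by (rule finite_primes_upto)
    have "(\<Sum>P\<in>primes_upto N. degree P * card {m\<in>{1..N}. P ^ m dvd A})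
      = degree P * card {m\<in>{1..N}. P ^ m dvd A}
        + (\<Sum>Q\<in>primes_upto N - {P}. degree Q * card {m\<in>{1..N}. Q ^ m dvd A})"
      by (rule sum.remove[OF fin PN])
    also have "\<dots> = degree P + (degree P * card {m\<in>{1..N}. P ^ m dvd B}
        + (\<Sum>Q\<in>primes_upto N - {P}. degree Q * card {m\<in>{1..N}. Q ^ m dvd B}))"
    proof -
      have "(\<Sum>Q\<in>primes_upto N - {P}. degree Q * card {m\<in>{1..N}. Q ^ m dvd A})
          = (\<Sum>Q\<in>primes_upto N - {P}. degree Q * card {m\<in>{1..N}. Q ^ m dvd B})"
        by (intro sum.cong refl) (simp only: other)
      then show ?thesis by (simp only: same mult_Suc_right add.assoc)
    qed
    also have "\<dots> = degree P + (\<Sum>P\<in>primes_upto N. degree P * card {m\<in>{1..N}. P ^ m dvd B})"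
      by (simp add: sum.remove[OF fin PN])
    finally show ?thesis using IH deg by simp
  qed
qed

lemma card_monics_dvd:
  fixes D :: "'a::{field,finite} poly"
  assumes "monic_poly D"
  shows "card {A\<in>monics n. D dvd A} = (if degree D \<le> n then CARD('a) ^ (n - degree D) else 0)"
proof (cases "degree D \<le> n")
  case True
  have "{A\<in>monics n. D dvd A} = (\<lambda>B. D * B) ` monics (n - degree D)"
  proof (intro equalityI subsetI)
    fix A assume A: "A \<in> {A\<in>monics n. D dvd A}"
    then obtain B where B: "A = D * B" by (auto elim: dvdE)
    have "monic_poly B" using A B assms monic_poly_factor by (auto simp: monics_def)
    moreover from this have "degree A = degree D + degree B"
      using assms by (simp add: B degree_mult_eq monic_poly_nonzero)
    ultimately show "A \<in> (\<lambda>B. D * B) ` monics (n - degree D)"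
      using A B by (auto simp: monics_def)
  next
    fix A assume "A \<in> (\<lambda>B. D * B) ` monics (n - degree D)"
    then show "A \<in> {A\<in>monics n. D dvd A}"
      using assms True
      by (auto simp: monics_def monic_poly_mult degree_mult_eq monic_poly_nonzero)
  qed
  moreover have "inj_on (\<lambda>B. D * B) (monics (n - degree D))"
    using monic_poly_nonzero[OF assms] by (auto simp: inj_on_def)
  ultimately show ?thesis using True by (simp add: card_image card_monics)
next
  case False
  have "{A\<in>monics n. D dvd A} = {}"
    using False dvd_imp_degree_le by (auto simp: monics_def dest: monic_poly_nonzero)
  then show ?thesis using False by (simp only: card.empty if_False)
qed

text \<open>The prime polynomial theorem, from summing \<open>deg A = (\<Sum>D dvd A. \<Lambda> D)\<close> over all monic \<open>A\<close> of degree \<open>n\<close>.\<close>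

lemma sum_degree_dvd:
  assumes "n \<ge> 1"
  shows "(\<Sum>P\<in>{P\<in>primes_upto n. degree P dvd n}. degree (P :: 'a::{field,finite} poly)) = CARD('a) ^ n"
  using assms
proof (induction n rule: less_induct)
  case (less n)
  let ?q = "CARD('a)"
  define S where "S j = (\<Sum>P\<in>{P\<in>primes_upto j. degree P dvd j}. degree (P :: 'a poly))" for j
  have "n * ?q ^ n = (\<Sum>A\<in>(monics n :: 'a poly set). degree A)"
    using sum.cong[of "monics n" "monics n" degree "\<lambda>_. n"] by (simp add: monics_def card_monics[unfolded monics_def])
  also have "\<dots> = (\<Sum>A\<in>(monics n :: 'a poly set). \<Sum>P\<in>primes_upto n. degree P * card {m\<in>{1..n}. P ^ m dvd A})"
    by (intro sum.cong refl degree_eq_sum_prime_powers) (auto simp: monics_def)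
  also have "\<dots> = (\<Sum>A\<in>(monics n :: 'a poly set). \<Sum>P\<in>primes_upto n. \<Sum>m\<in>{1..n}. degree P * (if P ^ m dvd A then 1 else 0))"
    by (simp add: sum_distrib_left [symmetric] sum.If_cases Int_def)
  also have "\<dots> = (\<Sum>P\<in>(primes_upto n :: 'a poly set). \<Sum>m\<in>{1..n}. \<Sum>A\<in>monics n. degree P * (if P ^ m dvd A then 1 else 0))"
    by (subst sum.swap, rule sum.cong[OF refl], rule sum.swap)
  also have "\<dots> = (\<Sum>P\<in>(primes_upto n :: 'a poly set). \<Sum>m\<in>{1..n}. degree P * card {A\<in>monics n. P ^ m dvd A})"
    by (simp add: sum_distrib_left [symmetric] sum.If_cases Int_def finite_monics)
  also have "\<dots> = (\<Sum>P\<in>(primes_upto n :: 'a poly set). \<Sum>m\<in>{1..n div degree P}. degree P * ?q ^ (n - m * degree P))"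
  proof (rule sum.cong[OF refl])
    fix P :: "'a poly" assume P: "P \<in> primes_upto n"
    then have pP: "prime_poly P" "monic_poly P" by (auto simp: primes_upto_def prime_poly_def)
    have pos: "degree P > 0" using prime_poly_degree_pos[OF pP(1)] .
    have "(\<Sum>m\<in>{1..n}. degree P * card {A\<in>monics n. P ^ m dvd A})
        = (\<Sum>m\<in>{1..n}. if m * degree P \<le> n then degree P * ?q ^ (n - m * degree P) else 0)"
      by (intro sum.cong refl)
        (simp add: card_monics_dvd monic_poly_power pP degree_power_eq prime_poly_nonzero)
    also have "\<dots> = (\<Sum>m\<in>{m\<in>{1..n}. m * degree P \<le> n}. degree P * ?q ^ (n - m * degree P))"
      by (rule sum.inter_filter [symmetric]) simp
    also have "{m\<in>{1..n}. m * degree P \<le> n} = {1..n div degree P}"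
      using pos by (auto simp: less_eq_div_iff_mult_less_eq) (metis le_trans mult.right_neutral mult_le_mono2 Suc_leI One_nat_def)
    finally show "(\<Sum>m\<in>{1..n}. degree P * card {A\<in>monics n. P ^ m dvd A})
        = (\<Sum>m\<in>{1..n div degree P}. degree P * ?q ^ (n - m * degree P))" .
  qed
  also have "\<dots> = (\<Sum>j\<in>{1..n}. \<Sum>P\<in>{P\<in>(primes_upto j :: 'a poly set). degree P dvd j}. degree P * ?q ^ (n - j div degree P * degree P))"
    by (rule sum_prime_powers_by_degree)
  also have "\<dots> = (\<Sum>j\<in>{1..n}. S j * ?q ^ (n - j))"
    by (simp add: S_def sum_distrib_right)
  also have "\<dots> = S n + (\<Sum>j\<in>{1..n} - {n}. S j * ?q ^ (n - j))"
    using less(2) by (subst sum.remove[of _ n]) auto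
  \<comment> \<open>By induction each of the \<open>n - 1\<close> lower degrees \<open>j\<close>
    contributes \<open>q ^ j * q ^ (n - j) = q ^ n\<close>; of the total \<open>n * q ^ n\<close>
    this leaves \<open>q ^ n\<close> for \<open>S n\<close>.\<close>
  also have "(\<Sum>j\<in>{1..n} - {n}. S j * ?q ^ (n - j)) = (\<Sum>j\<in>{1..n} - {n}. ?q ^ n)"
    using less(1) by (intro sum.cong refl) (auto simp: S_def power_add [symmetric])
  also have "\<dots> = (n - 1) * ?q ^ n" using less(2) by (simp add: card_Diff_singleton)
  finally have "S n + (n - 1) * ?q ^ n = n * ?q ^ n" by simp
  moreover have "n * ?q ^ n = ?q ^ n + (n - 1) * ?q ^ n"
    using less(2) by (cases n) auto
  ultimately show ?case unfolding S_def by linarith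
qed

text \<open>With \<open>n = m * degree P\<close> the weight \<open>1 / m\<close> equals
  \<open>degree P / n\<close>, so primes are counted with weight their degree, as in
  \<open>sum_degree_dvd\<close>. It produces the harmonic sum in Mertens' theorem and the size of
  the off-diagonal weight.\<close>

lemma sum_prime_powers_radial:
  fixes h :: "nat \<Rightarrow> real"
  shows "(\<Sum>P\<in>(primes_upto X :: 'a::{field,finite} poly set). \<Sum>m\<in>{1..X div degree P}. h (m * degree P) / real m)
    = (\<Sum>n\<in>{1..X}. h n * real CARD('a) ^ n / real n)"
proof -
  have "(\<Sum>P\<in>(primes_upto X :: 'a poly set). \<Sum>m\<in>{1..X div degree P}. h (m * degree P) / real m)
      = (\<Sum>n\<in>{1..X}. \<Sum>P\<in>{P\<in>(primes_upto n :: 'a poly set). degree P dvd n}.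
          h (n div degree P * degree P) / real (n div degree P))"
    by (rule sum_prime_powers_by_degree)
  also have "\<dots> = (\<Sum>n\<in>{1..X}. \<Sum>P\<in>{P\<in>(primes_upto n :: 'a poly set). degree P dvd n}.
          h n / real n * real (degree P))"
    by (intro sum.cong refl) (auto simp: real_of_nat_div)
  also have "\<dots> = (\<Sum>n\<in>{1..X}. h n / real n * real (CARD('a) ^ n))"
  proof (intro sum.cong refl)
    fix n assume "n \<in> {1..X}"
    then have "(\<Sum>P\<in>{P\<in>primes_upto n. degree P dvd n}. degree (P :: 'a poly)) = CARD('a) ^ n"
      by (intro sum_degree_dvd) auto
    then show "(\<Sum>P\<in>{P\<in>(primes_upto n :: 'a poly set). degree P dvd n}. h n / real n * real (degree P))
      = h n / real n * real (CARD('a) ^ n)"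
      by (simp only: sum_distrib_left [symmetric] of_nat_sum [symmetric])
  qed
  finally show ?thesis by simp
qed

section \<open>Uniqueness of factorisation\<close>

lemma prime_power_dvd_prod_iff:
  fixes g :: "'a::field poly \<Rightarrow> nat"
  assumes "finite S" "\<And>P. P \<in> S \<Longrightarrow> prime_poly P" "P \<in> S"
  shows "P ^ n dvd (\<Prod>Q\<in>S. Q ^ g Q) \<longleftrightarrow> n \<le> g P"
proof
  assume *: "P ^ n dvd (\<Prod>Q\<in>S. Q ^ g Q)"
  show "n \<le> g P"
  proof (rule ccontr)
    assume "\<not> n \<le> g P"
    then obtain k where "n = g P + Suc k" by (metis add_Suc_right less_imp_Suc_add not_le)
    then have "P ^ g P * (P * P ^ k) dvd P ^ g P * (\<Prod>Q\<in>S - {P}. Q ^ g Q)"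
      using * assms by (simp add: prod.remove[of S P] power_add)
    then have "P * P ^ k dvd (\<Prod>Q\<in>S - {P}. Q ^ g Q)"
      using prime_poly_nonzero assms by (subst (asm) dvd_mult_cancel_left) auto
    then have "P dvd (\<Prod>Q\<in>S - {P}. Q ^ g Q)" using dvd_mult_left by blast
    then obtain Q where "Q \<in> S - {P}" "P dvd Q ^ g Q"
      using prime_poly_dvd_prod[of P "S - {P}"] assms by auto
    then show False
      using prime_poly_dvd_prime_poly[of P Q] prime_poly_dvd_power[of P Q] assms by auto
  qed
next
  assume "n \<le> g P"
  then have "P ^ n dvd P ^ g P" by (rule le_imp_power_dvd)
  also have "P ^ g P dvd (\<Prod>Q\<in>S. Q ^ g Q)" using assms by (intro dvd_prodI) auto
  finally show "P ^ n dvd (\<Prod>Q\<in>S. Q ^ g Q)" .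
qed

text \<open>Each exponent can be read off from divisibility. In the off-diagonal sum this turns
  distinct exponent vectors into distinct polynomials, the case in which the character sums
  cancel.\<close>

lemma prod_prime_powers_inj:
  assumes "finite S" "\<And>P. P \<in> S \<Longrightarrow> prime_poly (P :: 'a::field poly)"
  shows "inj_on (\<lambda>g. \<Prod>P\<in>S. P ^ g P) (PiE S (\<lambda>_. UNIV :: nat set))"
proof (rule inj_onI)
  fix g h :: "'a poly \<Rightarrow> nat"
  assume gh: "g \<in> PiE S (\<lambda>_. UNIV)" "h \<in> PiE S (\<lambda>_. UNIV)" "(\<Prod>P\<in>S. P ^ g P) = (\<Prod>P\<in>S. P ^ h P)"
  have "g P = h P" if "P \<in> S" for P
    using prime_power_dvd_prod_iff[OF assms that, of "g P" g]
      prime_power_dvd_prod_iff[OF assms that, of "g P" h]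
      prime_power_dvd_prod_iff[OF assms that, of "h P" g]
      prime_power_dvd_prod_iff[OF assms that, of "h P" h] gh(3) by auto
  then show "g = h" using gh(1,2) by (intro PiE_ext) auto
qed

section \<open>Characters modulo a polynomial\<close>

lemma mod_in_small_polys:
  fixes R :: "'a::field poly"
  shows "R \<noteq> 0 \<Longrightarrow> A mod R \<in> small_polys (degree R)"
  using degree_mod_less[of R A] by (auto simp: small_polys_iff)

lemma small_polys_mod:
  fixes R :: "'a::field poly"
  shows "A \<in> small_polys (degree R) \<Longrightarrow> A mod R = A"
  by (auto simp: small_polys_iff mod_poly_less)

lemma coprime_poly_mult_iff:
  fixes A B R :: "'a::field poly"
  shows "coprime (A * B) R \<longleftrightarrow> coprime A R \<and> coprime B R"
proof
  assume "coprime (A * B) R"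
  then obtain U V where *: "U * (A * B) + V * R = 1" using coprime_poly_iff_bezout by blast
  have "(U * B) * A + V * R = 1" "(U * A) * B + V * R = 1" using * by (simp_all add: algebra_simps)
  then show "coprime A R \<and> coprime B R" using coprime_poly_iff_bezout by blast
qed (use coprime_poly_mult_left in blast)

lemma coprime_poly_mod_iff:
  fixes A R :: "'a::field poly"
  shows "coprime (A mod R) R \<longleftrightarrow> coprime A R"
  using coprime_poly_mod_cong[of "A mod R" R A] coprime_poly_mod_cong[of A R "A mod R"] by auto

lemma coprime_poly_dvd_right:
  fixes A F R :: "'a::field poly"
  assumes "coprime A R" "F dvd R"
  shows "coprime A F"
proof -
  obtain S where "R = F * S" using assms(2) by (elim dvdE)
  then show ?thesis using assms(1) coprime_poly_mult_iff coprime_commute by metis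
qed

lemma poly_mod_dvd_cong:
  fixes A B F R :: "'a::field poly"
  assumes "A mod R = B mod R" "F dvd R"
  shows "A mod F = B mod F"
  using assms dvd_trans unfolding mod_eq_dvd_iff by blast

text \<open>Pigeonhole: two powers of \<open>a\<close> agree modulo \<open>F\<close>, and the lower
  one cancels because it is coprime to \<open>F\<close>.\<close>

lemma coprime_poly_power_cong_1:
  fixes a F :: "'a::{field,finite} poly"
  assumes "coprime a F" "F \<noteq> 0"
  shows "\<exists>n>0. a ^ n mod F = 1 mod F"
proof -
  have "(\<lambda>n. a ^ n mod F) ` UNIV \<subseteq> small_polys (degree F)"
    using mod_in_small_polys[OF assms(2)] by auto
  then have "finite ((\<lambda>n::nat. a ^ n mod F) ` UNIV)"
    using finite_small_polys finite_subset by blast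
  then have "\<not> inj (\<lambda>n::nat. a ^ n mod F)" using finite_imageD infinite_UNIV_nat by blast
  then obtain i j :: nat where "i \<noteq> j" "a ^ i mod F = a ^ j mod F" by (auto simp: inj_on_def)
  then obtain i j :: nat where ij: "i < j" "a ^ j mod F = a ^ i mod F"
    by (metis linorder_neqE_nat)
  have "a ^ j - a ^ i = a ^ i * (a ^ (j - i) - 1)"
    using ij(1) by (simp add: algebra_simps power_add [symmetric])
  then have "F dvd a ^ i * (a ^ (j - i) - 1)" using ij(2) by (simp add: mod_eq_dvd_iff)
  moreover have "coprime F (a ^ i)"
    by (induction i) (use assms(1) in \<open>auto intro: coprime_poly_mult_right simp: coprime_commute\<close>)
  ultimately have "F dvd a ^ (j - i) - 1" using coprime_poly_dvd_mult by blast
  then show ?thesis using ij(1) by (intro exI[of _ "j - i"]) (simp add: mod_eq_dvd_iff)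
qed

section \<open>Enough characters to separate residues\<close>

definition periodic_mod :: "'a::field poly \<Rightarrow> ('a poly \<Rightarrow> complex) \<Rightarrow> bool" where
  "periodic_mod F f \<longleftrightarrow> (\<forall>x y. x mod F = y mod F \<longrightarrow> f x = f y)"

text \<open>A finite Fourier transform along the action \<open>x \<mapsto> a * x\<close>, whose
  \<open>n\<close>-th iterate is trivial modulo \<open>F\<close>. The \<open>n\<close> projections
  of \<open>f\<close> add up to \<open>n * f\<close>, so one of them still separates
  \<open>A\<close> from \<open>B\<close>. Projections commute with multiplication by any other
  \<open>b\<close>, so eigenvalues already secured survive. Here \<open>n\<close> may be any period,
  not just the exact order of \<open>a\<close>.\<close>

lemma eigenfunction_step:
  fixes a F :: "'a::field poly"
  assumes per: "periodic_mod F f" and n: "n > 0" "a ^ n mod F = 1 mod F" and AB: "f A \<noteq> f B"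
  obtains g \<zeta> where "periodic_mod F g" "g A \<noteq> g B" "\<zeta> \<noteq> 0" "\<And>x. g (a * x) = \<zeta> * g x"
    "\<And>b \<mu>. (\<And>x. f (b * x) = \<mu> * f x) \<Longrightarrow> (\<And>x. g (b * x) = \<mu> * g x)"
proof -
  define u where "u = cis (2 * pi / real n)"
  define g where "g j x = (\<Sum>i<n. (u ^ j) ^ i * f (a ^ i * x))" for j x
  have un: "u ^ n = 1" unfolding u_def Complex.DeMoivre using n(1) by simp
  have u0: "u \<noteq> 0" by (simp add: u_def)
  have ui: "u ^ i \<noteq> 1" if "0 < i" "i < n" for i
  proof
    assume "u ^ i = 1"
    then have "cis (2 * pi * real i / real n) = cis (2 * pi * real 0 / real n)"
      by (simp add: u_def Complex.DeMoivre mult_ac)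
    then have "i = 0"
      using Complex.bij_betw_roots_unity[OF n(1)] that n(1) by (auto simp: bij_betw_def inj_on_def)
    then show False using that by simp
  qed
  have geo: "(\<Sum>j<n. (u ^ j) ^ i) = (if i = 0 then of_nat n else 0)" if "i < n" for i
  proof (cases "i = 0")
    case False
    have "(\<Sum>j<n. (u ^ j) ^ i) = (\<Sum>j<n. (u ^ i) ^ j)"
      by (simp add: power_mult [symmetric] mult.commute)
    also have "\<dots> = ((u ^ i) ^ n - 1) / (u ^ i - 1)"
      using ui[of i] False that by (intro geometric_sum) auto
    also have "(u ^ i) ^ n = (u ^ n) ^ i" by (simp add: power_mult [symmetric] mult.commute)
    finally show ?thesis using False by (simp add: un)
  qed simp
  have inversion: "(\<Sum>j<n. g j x) = of_nat n * f x" for x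
  proof -
    have "(\<Sum>j<n. g j x) = (\<Sum>i<n. \<Sum>j<n. (u ^ j) ^ i * f (a ^ i * x))"
      unfolding g_def by (rule sum.swap)
    also have "\<dots> = (\<Sum>i<n. (if i = 0 then of_nat n else 0) * f (a ^ i * x))"
      by (intro sum.cong refl) (simp add: sum_distrib_right [symmetric] geo)
    also have "\<dots> = (\<Sum>i<n. if i = 0 then of_nat n * f x else 0)"
      by (intro sum.cong refl) auto
    also have "\<dots> = of_nat n * f x" using n(1) by simp
    finally show ?thesis .
  qed
  have "\<exists>j<n. g j A \<noteq> g j B"
  proof (rule ccontr)
    assume "\<not> (\<exists>j<n. g j A \<noteq> g j B)"
    then have "(\<Sum>j<n. g j A) = (\<Sum>j<n. g j B)" by (intro sum.cong) auto
    then show False using AB n(1) by (simp add: inversion)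
  qed
  then obtain j where j: "g j A \<noteq> g j B" by blast
  have f_an: "f (a ^ n * x) = f x" for x
  proof -
    have "(a ^ n * x) mod F = x mod F"
      using n(2) by (metis mod_mult_left_eq mult_1)
    then show ?thesis using per unfolding periodic_mod_def by blast
  qed
  \<comment> \<open>Multiplication by \<open>u ^ j\<close> shifts the summation index; the new end
    term at \<open>n\<close> equals the lost term at 0, since \<open>u ^ n = 1\<close> and
    \<open>a ^ n\<close> acts trivially.\<close>
  have eig: "u ^ j * g j (a * x) = g j x" for x
  proof -
    have "u ^ j * g j (a * x) = (\<Sum>i<n. (u ^ j) ^ Suc i * f (a ^ Suc i * x))"
      unfolding g_def sum_distrib_left by (intro sum.cong refl) (simp add: mult_ac)
    also have "\<dots> = (\<Sum>i<n. (u ^ j) ^ i * f (a ^ i * x)) + (u ^ j) ^ n * f (a ^ n * x) - f x"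
      using sum.lessThan_Suc_shift[of "\<lambda>i. (u ^ j) ^ i * f (a ^ i * x)" n]
      by (simp only: sum.lessThan_Suc power_0 mult_1) (simp add: algebra_simps)
    also have "(u ^ j) ^ n = (u ^ n) ^ j" by (simp add: power_mult [symmetric] mult.commute)
    finally show ?thesis by (simp add: un f_an g_def)
  qed
  show thesis
  proof (rule that[of "g j" "inverse (u ^ j)"])
    show "periodic_mod F (g j)"
      unfolding periodic_mod_def g_def
    proof (intro allI impI sum.cong refl)
      fix x y i assume "x mod F = y mod F"
      then have "(a ^ i * x) mod F = (a ^ i * y) mod F" by (metis mod_mult_right_eq)
      then show "(u ^ j) ^ i * f (a ^ i * x) = (u ^ j) ^ i * f (a ^ i * y)"
        using per unfolding periodic_mod_def by metis
    qed
    show "g j A \<noteq> g j B" by (rule j)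
    show "inverse (u ^ j) \<noteq> 0" using u0 by simp
    show "g j (a * x) = inverse (u ^ j) * g j x" for x
      using eig[of x] u0 by (simp add: field_simps)
    show "g j (b * x) = \<mu> * g j x" if "\<And>x. f (b * x) = \<mu> * f x" for b \<mu> x
    proof -
      have "f (a ^ i * (b * x)) = \<mu> * f (a ^ i * x)" for i
        using that[of "a ^ i * x"] by (simp add: mult_ac)
      then show ?thesis unfolding g_def by (simp add: sum_distrib_left mult_ac)
    qed
  qed
qed

text \<open>Translations by units act on the functions modulo \<open>F\<close> as commuting operators of finite
  order, so projecting onto eigenspaces one unit at a time yields a joint eigenfunction.\<close>

lemma eigenfunction_exists:
  fixes F :: "'a::{field,finite} poly"
  assumes "F \<noteq> 0" "A mod F \<noteq> B mod F" "finite T" "\<And>a. a \<in> T \<Longrightarrow> coprime a F"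
  shows "\<exists>g. periodic_mod F g \<and> g A \<noteq> g B \<and> (\<forall>a\<in>T. \<exists>\<zeta>. \<zeta> \<noteq> 0 \<and> (\<forall>x. g (a * x) = \<zeta> * g x))"
  using assms(3,4)
proof (induction T)
  case empty
  have "periodic_mod F (\<lambda>x. if x mod F = A mod F then 1 else 0)"
    by (simp add: periodic_mod_def)
  then show ?case using assms(2)
    by (intro exI[of _ "\<lambda>x. if x mod F = A mod F then 1 else 0"]) auto
next
  case (insert a T)
  then obtain f where f: "periodic_mod F f" "f A \<noteq> f B"
    "\<And>b. b \<in> T \<Longrightarrow> \<exists>\<zeta>. \<zeta> \<noteq> 0 \<and> (\<forall>x. f (b * x) = \<zeta> * f x)" by force
  obtain n where n: "n > 0" "a ^ n mod F = 1 mod F"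
    using coprime_poly_power_cong_1 assms(1) insert.prems by blast
  obtain g \<zeta> where g: "periodic_mod F g" "g A \<noteq> g B" "\<zeta> \<noteq> 0" "\<forall>x. g (a * x) = \<zeta> * g x"
    "\<forall>b \<mu>. (\<forall>x. f (b * x) = \<mu> * f x) \<longrightarrow> (\<forall>x. g (b * x) = \<mu> * g x)"
    by (rule eigenfunction_step[OF f(1) n f(2)]) blast
  have "\<exists>\<zeta>. \<zeta> \<noteq> 0 \<and> (\<forall>x. g (b * x) = \<zeta> * g x)" if "b \<in> insert a T" for b
    using that f(3) g(3-5) by (metis insertE)
  then show ?case using g(1,2) by blast
qed

text \<open>For \<open>F\<close> dividing \<open>R\<close>, the characters induced from modulus
  \<open>F\<close>. They are kept as characters modulo \<open>R\<close>, so that the sets for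
  different \<open>F\<close> can be intersected and subtracted.\<close>

definition chars_mod :: "'a::field poly \<Rightarrow> 'a poly \<Rightarrow> ('a poly \<Rightarrow> complex) set" where
  "chars_mod R F = {chi. dirichlet_char R chi \<and> (\<forall>x. coprime x R \<and> x mod F = 1 mod F \<longrightarrow> chi x = 1)}"

text \<open>A joint eigenfunction \<open>g\<close> of all units yields a character: the eigenvalue
  of \<open>a\<close> is \<open>g a / g 1\<close>, it is multiplicative, and it inherits the period
  \<open>F\<close> of \<open>g\<close>.\<close>

lemma chars_mod_separate:
  fixes R F A :: "'a::{field,finite} poly"
  assumes "R \<noteq> 0" "F dvd R" "coprime A R" "A mod F \<noteq> 1 mod F"
  shows "\<exists>chi\<in>chars_mod R F. chi A \<noteq> 1"
proof -
  have F0: "F \<noteq> 0" using assms(1,2) by auto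
  define T where "T = {a \<in> small_polys (degree F). coprime a F}"
  have "finite T" by (simp add: T_def finite_small_polys)
  then obtain g where g: "periodic_mod F g" "g A \<noteq> g 1"
    "\<forall>a\<in>T. \<exists>\<zeta>. \<zeta> \<noteq> 0 \<and> (\<forall>x. g (a * x) = \<zeta> * g x)"
    using eigenfunction_exists[OF F0 assms(4), of T] unfolding T_def by blast
  have "\<exists>\<zeta>. \<zeta> \<noteq> 0 \<and> (\<forall>x. g (a * x) = \<zeta> * g x)" if "coprime a R" for a
  proof -
    have "coprime (a mod F) F" using coprime_poly_dvd_right[OF that assms(2)] coprime_poly_mod_iff by blast
    then have "a mod F \<in> T" by (simp add: T_def mod_in_small_polys F0)
    moreover have "g (a mod F * x) = g (a * x)" for x
      using g(1) by (metis mod_mult_left_eq periodic_mod_def)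
    ultimately show ?thesis using g(3) by metis
  qed
  then obtain ev where ev: "\<And>a. coprime a R \<Longrightarrow> ev a \<noteq> 0"
    "\<And>a x. coprime a R \<Longrightarrow> g (a * x) = ev a * g x" by metis
  \<comment> \<open>If \<open>g 1\<close> were 0, then \<open>g A = ev A * g 1\<close> would be 0 as
    well, but \<open>g\<close> separates \<open>A\<close> from 1.\<close>
  have g1: "g 1 \<noteq> 0" using ev(2)[OF assms(3), of 1] g(2) by auto
  define chi where "chi x = (if coprime x R then ev x else 0)" for x
  have ev_alt: "ev x = g x / g 1" if "coprime x R" for x
    using ev(2)[OF that, of 1] g1 by simp
  have "dirichlet_char R chi"
    unfolding dirichlet_char_def
  proof (intro conjI allI impI)
    fix x y
    show "chi (x * y) = chi x * chi y"
      using ev(2)[of x y] g1 by (auto simp: chi_def coprime_poly_mult_iff ev_alt)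
  next
    fix x y assume xy: "x mod R = y mod R"
    have "coprime x R \<longleftrightarrow> coprime y R" using coprime_poly_mod_cong xy by metis
    moreover have "g x = g y"
      using g(1) poly_mod_dvd_cong[OF xy assms(2)] unfolding periodic_mod_def by blast
    ultimately show "chi x = chi y" by (auto simp: chi_def ev_alt)
  next
    fix x show "(chi x = 0) = (\<not> coprime x R)" using ev(1) by (auto simp: chi_def)
  qed
  moreover have "chi x = 1" if "coprime x R" "x mod F = 1 mod F" for x
  proof -
    have "g x = g 1" using g(1) that(2) unfolding periodic_mod_def by blast
    then show ?thesis using that(1) g1 by (simp add: chi_def ev_alt)
  qed
  moreover have "chi A \<noteq> 1" using assms(3) g(2) g1 by (simp add: chi_def ev_alt)
  ultimately show ?thesis by (auto simp: chars_mod_def)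
qed

section \<open>Elementary properties of Dirichlet characters\<close>

lemma dirichlet_char_1: "dirichlet_char R chi \<Longrightarrow> chi 1 = 1"
proof -
  assume chi: "dirichlet_char R chi"
  have "chi 1 * chi 1 = chi (1 * 1)" using chi unfolding dirichlet_char_def by metis
  moreover have "chi 1 \<noteq> 0" using chi coprime_1_left[of R] unfolding dirichlet_char_def by blast
  ultimately show ?thesis by simp
qed

lemma dirichlet_char_mult: "dirichlet_char R chi \<Longrightarrow> chi (A * B) = chi A * chi B"
  unfolding dirichlet_char_def by blast

lemma dirichlet_char_mod: "dirichlet_char R chi \<Longrightarrow> A mod R = B mod R \<Longrightarrow> chi A = chi B"
  unfolding dirichlet_char_def by blast

lemma dirichlet_char_eq_0: "dirichlet_char R chi \<Longrightarrow> chi A = 0 \<longleftrightarrow> \<not> coprime A R"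
  unfolding dirichlet_char_def by blast

lemma dirichlet_char_power: "dirichlet_char R chi \<Longrightarrow> chi (A ^ n) = chi A ^ n"
  by (induction n) (auto simp: dirichlet_char_1 dirichlet_char_mult)

lemma dirichlet_char_prod: "dirichlet_char R chi \<Longrightarrow> chi (prod f S) = (\<Prod>x\<in>S. chi (f x))"
  by (induction S rule: infinite_finite_induct) (auto simp: dirichlet_char_1 dirichlet_char_mult)

lemma dirichlet_char_root_of_unity:
  fixes R :: "'a::{field,finite} poly"
  assumes "dirichlet_char R chi" "coprime A R" "n > 0" "A ^ n mod R = 1 mod R"
  shows "chi A ^ n = 1"
  using assms dirichlet_char_power dirichlet_char_mod dirichlet_char_1 by metis

lemma dirichlet_char_norm:
  fixes R :: "'a::{field,finite} poly"
  assumes "R \<noteq> 0" "dirichlet_char R chi" "coprime A R"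
  shows "norm (chi A) = 1"
proof -
  obtain n where n: "n > 0" "A ^ n mod R = 1 mod R"
    using coprime_poly_power_cong_1 assms by blast
  have "norm (chi A) ^ n = 1"
    using dirichlet_char_root_of_unity[OF assms(2,3) n] by (metis norm_one norm_power)
  then show ?thesis using n(1) power_eq_imp_eq_base[of "norm (chi A)" n 1] by simp
qed

lemma dirichlet_char_norm_le:
  fixes R :: "'a::{field,finite} poly"
  shows "R \<noteq> 0 \<Longrightarrow> dirichlet_char R chi \<Longrightarrow> norm (chi A) \<le> 1"
  using dirichlet_char_norm[of R chi A] dirichlet_char_eq_0[of R chi A] by fastforce

text \<open>A character is determined by its values on the finitely many residues, and each value is
  0 or a root of unity whose order divides an exponent depending only on the residue.\<close>

lemma finite_dirichlet_chars:
  fixes R :: "'a::{field,finite} poly"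
  assumes "R \<noteq> 0"
  shows "finite {chi. dirichlet_char R chi}"
proof -
  let ?S = "small_polys (degree R) :: 'a poly set"
  have "\<forall>a. \<exists>n. coprime a R \<longrightarrow> n > 0 \<and> a ^ n mod R = 1 mod R"
    using coprime_poly_power_cong_1[OF _ assms] by blast
  then obtain n where n: "\<And>a. coprime a R \<Longrightarrow> n a > 0 \<and> a ^ n a mod R = 1 mod R" by metis
  define V where "V a = (if coprime a R then {z::complex. z ^ n a = 1} else {0})" for a
  have "finite (V a)" for a using n[of a] by (simp add: V_def finite_roots_unity Suc_leI)
  then have fin: "finite (PiE ?S V)" by (intro finite_PiE finite_small_polys)
  have "inj_on (\<lambda>chi. restrict chi ?S) {chi. dirichlet_char R chi}"
  proof (rule inj_onI, rule ext)
    fix chi psi x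
    assume *: "chi \<in> {chi. dirichlet_char R chi}" "psi \<in> {chi. dirichlet_char R chi}"
      "restrict chi ?S = restrict psi ?S"
    have "chi (x mod R) = psi (x mod R)"
      using fun_cong[OF *(3), of "x mod R"] mod_in_small_polys[OF assms, of x] by simp
    moreover have "chi (x mod R) = chi x" "psi (x mod R) = psi x"
      using * dirichlet_char_mod[of R _ "x mod R" x] by auto
    ultimately show "chi x = psi x" by simp
  qed
  moreover have "(\<lambda>chi. restrict chi ?S) ` {chi. dirichlet_char R chi} \<subseteq> PiE ?S V"
    using n dirichlet_char_root_of_unity dirichlet_char_eq_0 by (fastforce simp: V_def)
  ultimately show ?thesis using fin finite_imageD finite_subset by blast
qed

lemma finite_chars_mod: "R \<noteq> 0 \<Longrightarrow> finite (chars_mod (R :: 'a::{field,finite} poly) F)"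
  by (rule finite_subset[OF _ finite_dirichlet_chars]) (auto simp: chars_mod_def)

lemma dirichlet_char_times:
  "dirichlet_char R chi \<Longrightarrow> dirichlet_char R psi \<Longrightarrow> dirichlet_char R (\<lambda>x. chi x * psi x)"
  unfolding dirichlet_char_def
  by (intro conjI allI impI) (metis mult.assoc mult.left_commute, metis, metis mult_eq_0_iff)

lemma dirichlet_char_cnj: "dirichlet_char R chi \<Longrightarrow> dirichlet_char R (\<lambda>x. cnj (chi x))"
  unfolding dirichlet_char_def
  by (intro conjI allI impI) (metis complex_cnj_mult, metis, metis complex_cnj_zero_iff)

lemma chars_mod_times:
  "chi \<in> chars_mod R F \<Longrightarrow> psi \<in> chars_mod R F \<Longrightarrow> (\<lambda>x. chi x * psi x) \<in> chars_mod R F"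
  by (auto simp: chars_mod_def dirichlet_char_times)

lemma chars_mod_cnj: "chi \<in> chars_mod R F \<Longrightarrow> (\<lambda>x. cnj (chi x)) \<in> chars_mod R F"
  by (auto simp: chars_mod_def dirichlet_char_cnj)

lemma dirichlet_char_mult_cnj:
  fixes R :: "'a::{field,finite} poly"
  assumes "R \<noteq> 0" "dirichlet_char R chi" "coprime A R"
  shows "chi A * cnj (chi A) = 1"
  using dirichlet_char_norm[OF assms] complex_norm_square[of "chi A"] by simp

text \<open>\<open>psi\<close> times its conjugate is the principal character rather than 1; the
  identity holds at non-units because \<open>chi\<close> vanishes there.\<close>

lemma chars_mod_cancel:
  fixes R :: "'a::{field,finite} poly"
  assumes "R \<noteq> 0" "dirichlet_char R chi" "dirichlet_char R psi"
  shows "(\<lambda>x. chi x * psi x * cnj (psi x)) = chi"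
proof
  fix x
  show "chi x * psi x * cnj (psi x) = chi x"
    using dirichlet_char_mult_cnj[OF assms(1,3), of x] dirichlet_char_eq_0[OF assms(2), of x]
    by (cases "coprime x R") (auto simp: mult.assoc)
qed

lemma coprime_poly_inverse:
  fixes A R :: "'a::field poly"
  assumes "coprime A R"
  obtains B where "coprime B R" "(A * B) mod R = 1 mod R"
proof -
  obtain U V where *: "U * A + V * R = 1" using assms coprime_poly_iff_bezout by blast
  have "A * U - 1 = R * (- V)" using * by (simp add: algebra_simps flip: *)
  then have "(A * U) mod R = 1 mod R" unfolding mod_eq_dvd_iff by (metis dvd_triv_left)
  moreover have "coprime U R" using * coprime_poly_iff_bezout[of U R] by (metis mult.commute)
  ultimately show thesis using that by blast
qed

lemma cnj_dirichlet_char: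
  fixes R :: "'a::{field,finite} poly"
  assumes "R \<noteq> 0" "dirichlet_char R chi" "(A * B) mod R = 1 mod R"
  shows "cnj (chi A) = chi B"
proof -
  have "chi A * chi B = 1"
    using assms dirichlet_char_mult dirichlet_char_mod dirichlet_char_1 by metis
  moreover from this have "coprime A R" using dirichlet_char_eq_0[OF assms(2), of A] by auto
  ultimately show ?thesis
    using dirichlet_char_mult_cnj[OF assms(1,2)] by (metis mult_cancel_left mult_zero_left zero_neq_one)
qed

section \<open>Orthogonality and the number of characters\<close>

lemma sum_chars_mod_eq_0:
  fixes R F A :: "'a::{field,finite} poly"
  assumes "R \<noteq> 0" "F dvd R" "coprime A R" "A mod F \<noteq> 1 mod F"
  shows "(\<Sum>chi\<in>chars_mod R F. chi A) = 0"
proof -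
  obtain psi where psi: "psi \<in> chars_mod R F" "psi A \<noteq> 1"
    using chars_mod_separate[OF assms] by blast
  have dc: "\<And>chi. chi \<in> chars_mod R F \<Longrightarrow> dirichlet_char R chi" by (simp add: chars_mod_def)
  have "(\<Sum>chi\<in>chars_mod R F. chi A) = (\<Sum>chi\<in>chars_mod R F. chi A * psi A)"
  proof (rule sum.reindex_bij_witness[where i = "\<lambda>chi x. chi x * psi x" and j = "\<lambda>chi x. chi x * cnj (psi x)"])
    fix chi assume chi: "chi \<in> chars_mod R F"
    show "(\<lambda>x. chi x * psi x * cnj (psi x)) = chi"
      using chars_mod_cancel[OF assms(1) dc[OF chi] dc[OF psi(1)]] .
    have "(\<lambda>x. chi x * cnj (psi x) * psi x) = (\<lambda>x. chi x * psi x * cnj (psi x))"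
      by (simp add: mult_ac)
    then show *: "(\<lambda>x. chi x * cnj (psi x) * psi x) = chi"
      using chars_mod_cancel[OF assms(1) dc[OF chi] dc[OF psi(1)]] by simp
    show "(\<lambda>x. chi x * cnj (psi x)) \<in> chars_mod R F" "(\<lambda>x. chi x * psi x) \<in> chars_mod R F"
      using chi psi(1) chars_mod_times chars_mod_cnj by blast+
    show "chi A * cnj (psi A) * psi A = chi A" using fun_cong[OF *, of A] by simp
  qed
  also have "\<dots> = (\<Sum>chi\<in>chars_mod R F. chi A) * psi A" by (simp add: sum_distrib_right)
  finally show ?thesis using psi(2) by (metis mult_cancel_left2)
qed

lemma sum_chars_mod_cnj:
  fixes R F A B :: "'a::{field,finite} poly"
  assumes "R \<noteq> 0" "F dvd R" "coprime A R" "coprime B R" "A mod F \<noteq> B mod F"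
  shows "(\<Sum>chi\<in>chars_mod R F. chi A * cnj (chi B)) = 0"
proof -
  obtain C where C: "coprime C R" "(B * C) mod R = 1 mod R"
    using coprime_poly_inverse[OF assms(4)] .
  have dc: "\<And>chi. chi \<in> chars_mod R F \<Longrightarrow> dirichlet_char R chi" by (simp add: chars_mod_def)
  have "(\<Sum>chi\<in>chars_mod R F. chi A * cnj (chi B)) = (\<Sum>chi\<in>chars_mod R F. chi (A * C))"
    using cnj_dirichlet_char[OF assms(1) dc C(2)] dirichlet_char_mult[OF dc] by (intro sum.cong) auto
  also have "\<dots> = 0"
  proof (rule sum_chars_mod_eq_0[OF assms(1,2)])
    show "coprime (A * C) R" using assms(3) C(1) by (simp add: coprime_poly_mult_iff)
    show "(A * C) mod F \<noteq> 1 mod F"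
    proof
      assume AC: "(A * C) mod F = 1 mod F"
      have BC: "(B * C) mod F = 1 mod F" using poly_mod_dvd_cong[OF C(2) assms(2)] .
      have "A mod F = (A * (B * C)) mod F" using BC by (metis mod_mult_right_eq mult.right_neutral)
      also have "\<dots> = (B * (A * C)) mod F" by (simp add: mult_ac)
      also have "\<dots> = B mod F" using AC by (metis mod_mult_right_eq mult.right_neutral)
      finally show False using assms(5) by simp
    qed
  qed
  finally show ?thesis .
qed

definition unit_residues :: "'a::field poly \<Rightarrow> 'a poly set" where
  "unit_residues R = {a \<in> small_polys (degree R). coprime a R}"

lemma finite_unit_residues: "finite (unit_residues (R :: 'a::{field,finite} poly))"
  by (simp add: unit_residues_def finite_small_polys)

lemma unit_residues_mult_bij:
  fixes R b :: "'a::field poly"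
  assumes "R \<noteq> 0" "coprime b R"
  shows "bij_betw (\<lambda>a. (b * a) mod R) (unit_residues R) (unit_residues R)"
proof -
  obtain c where c: "coprime c R" "(b * c) mod R = 1 mod R" using coprime_poly_inverse[OF assms(2)] .
  have mem: "(d * a) mod R \<in> unit_residues R" if "coprime d R" "a \<in> unit_residues R" for a d
    using that by (simp add: unit_residues_def mod_in_small_polys assms(1) coprime_poly_mod_iff coprime_poly_mult_iff)
  have canc: "(d * ((e * a) mod R)) mod R = a"
    if "(d * e) mod R = 1 mod R" "a \<in> unit_residues R" for a d e
  proof -
    have "(d * ((e * a) mod R)) mod R = (d * e * a) mod R" by (metis mod_mult_right_eq mult.assoc)
    also have "\<dots> = (1 * a) mod R" using that(1) by (metis mod_mult_left_eq)
    also have "\<dots> = a" using that(2) by (simp add: unit_residues_def small_polys_mod)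
    finally show ?thesis .
  qed
  show ?thesis
    by (rule bij_betw_byWitness[where f' = "\<lambda>a. (c * a) mod R"])
      (use mem canc c assms(2) in \<open>auto simp: mult.commute[of c b]\<close>)
qed

lemma sum_unit_residues_char:
  fixes R :: "'a::{field,finite} poly"
  assumes "R \<noteq> 0" "dirichlet_char R chi" "coprime b R" "chi b \<noteq> 1"
  shows "(\<Sum>a\<in>unit_residues R. chi a) = 0"
proof -
  have "(\<Sum>a\<in>unit_residues R. chi a) = (\<Sum>a\<in>unit_residues R. chi ((b * a) mod R))"
    by (rule sum.reindex_bij_betw [symmetric, OF unit_residues_mult_bij[OF assms(1,3)]])
  also have "\<dots> = chi b * (\<Sum>a\<in>unit_residues R. chi a)"
    unfolding sum_distrib_left
    by (intro sum.cong refl) (metis assms(2) dirichlet_char_mod dirichlet_char_mult mod_mod_trivial)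
  finally show ?thesis using assms(4) by (metis mult_cancel_right2)
qed

text \<open>The sum of \<open>chi a\<close> over all characters and units is evaluated in both
  orders. Summing over units first leaves only the principal character; summing over characters
  first leaves only the units that are 1 modulo \<open>F\<close>.\<close>

lemma card_chars_mod:
  fixes R F :: "'a::{field,finite} poly"
  assumes "R \<noteq> 0" "F dvd R"
  shows "card (chars_mod R F) * card {a \<in> unit_residues R. a mod F = 1 mod F} = card (unit_residues R)"
proof -
  let ?K = "{a \<in> unit_residues R. a mod F = 1 mod F}"
  let ?e = "\<lambda>x. if coprime x R then 1 else 0 :: complex"
  have dc: "\<And>chi. chi \<in> chars_mod R F \<Longrightarrow> dirichlet_char R chi" by (simp add: chars_mod_def)
  have "dirichlet_char R ?e"
    unfolding dirichlet_char_def
  proof (intro conjI allI impI)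
    fix x y assume "x mod R = y mod R"
    then have "coprime x R \<longleftrightarrow> coprime y R" using coprime_poly_mod_cong by metis
    then show "?e x = ?e y" by simp
  qed (simp_all add: coprime_poly_mult_iff)
  then have e: "?e \<in> chars_mod R F" by (simp add: chars_mod_def)
  have "(\<Sum>chi\<in>chars_mod R F. \<Sum>a\<in>unit_residues R. chi a)
      = (\<Sum>chi\<in>chars_mod R F. if chi = ?e then of_nat (card (unit_residues R)) else 0)"
  proof (rule sum.cong[OF refl])
    fix chi assume chi: "chi \<in> chars_mod R F"
    show "(\<Sum>a\<in>unit_residues R. chi a) = (if chi = ?e then of_nat (card (unit_residues R)) else 0)"
    proof (cases "chi = ?e")
      case True
      have "(\<Sum>a\<in>unit_residues R. chi a) = (\<Sum>a\<in>unit_residues R. 1)"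
        by (intro sum.cong refl) (auto simp: True unit_residues_def)
      then show ?thesis using True by simp
    next
      case False
      then obtain b where "chi b \<noteq> ?e b" by blast
      then have "coprime b R" "chi b \<noteq> 1"
        using dirichlet_char_eq_0[OF dc[OF chi], of b] by (auto split: if_splits)
      then show ?thesis using sum_unit_residues_char[OF assms(1) dc[OF chi]] False by simp
    qed
  qed
  also have "\<dots> = of_nat (card (unit_residues R))"
    using e finite_chars_mod[OF assms(1)] by (simp add: sum.delta)
  finally have 1: "(\<Sum>chi\<in>chars_mod R F. \<Sum>a\<in>unit_residues R. chi a) = of_nat (card (unit_residues R))" .
  have "(\<Sum>chi\<in>chars_mod R F. \<Sum>a\<in>unit_residues R. chi a) = (\<Sum>a\<in>unit_residues R. \<Sum>chi\<in>chars_mod R F. chi a)"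
    by (rule sum.swap)
  also have "\<dots> = (\<Sum>a\<in>unit_residues R. if a mod F = 1 mod F then of_nat (card (chars_mod R F)) else 0)"
  proof (rule sum.cong[OF refl])
    fix a assume "a \<in> unit_residues R"
    then have co: "coprime a R" by (simp add: unit_residues_def)
    show "(\<Sum>chi\<in>chars_mod R F. chi a) = (if a mod F = 1 mod F then of_nat (card (chars_mod R F)) else 0)"
    proof (cases "a mod F = 1 mod F")
      case True
      have "(\<Sum>chi\<in>chars_mod R F. chi a) = (\<Sum>chi\<in>chars_mod R F. 1)"
        using True co by (intro sum.cong refl) (auto simp: chars_mod_def)
      then show ?thesis using True by simp
    qed (simp add: sum_chars_mod_eq_0[OF assms co])
  qed
  also have "\<dots> = of_nat (card (chars_mod R F) * card ?K)"
    by (simp add: sum.If_cases finite_unit_residues Int_def mult.commute)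
  finally have "(of_nat (card (chars_mod R F) * card ?K) :: complex) = of_nat (card (unit_residues R))"
    using 1 by simp
  then show ?thesis by (simp only: of_nat_eq_iff)
qed

text \<open>By \<open>card_chars_mod\<close> the number of characters is the index of the kernel of
  reduction modulo \<open>F\<close> on units. Every fibre of that reduction is moved injectively
  into the kernel by an inverse of one of its members, and there are at most
  \<open>q ^ degree F\<close> fibres.\<close>

lemma card_chars_mod_le:
  fixes R F :: "'a::{field,finite} poly"
  assumes "R \<noteq> 0" "F dvd R"
  shows "card (chars_mod R F) \<le> CARD('a) ^ degree F"
proof -
  let ?U = "unit_residues R"
  let ?K = "{a \<in> ?U. a mod F = 1 mod F}"
  have F0: "F \<noteq> 0" using assms by auto
  have fibre: "card {a \<in> ?U. a mod F = c} \<le> card ?K" for c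
  proof (cases "{a \<in> ?U. a mod F = c} = {}")
    case False
    then obtain b where b: "b \<in> ?U" "b mod F = c" by blast
    then obtain b' where b': "coprime b' R" "(b * b') mod R = 1 mod R"
      using coprime_poly_inverse[of b R] by (auto simp: unit_residues_def)
    note bij = unit_residues_mult_bij[OF assms(1) b'(1)]
    show ?thesis
    proof (rule card_inj_on_le)
      show "inj_on (\<lambda>a. (b' * a) mod R) {a \<in> ?U. a mod F = c}"
        using bij by (rule inj_on_subset[OF bij_betw_imp_inj_on]) auto
      show "(\<lambda>a. (b' * a) mod R) ` {a \<in> ?U. a mod F = c} \<subseteq> ?K"
      proof clarify
        fix a assume a: "a \<in> ?U" "c = a mod F"
        have "(b' * a) mod R mod F = (b' * a) mod F" by (rule poly_mod_dvd_cong[OF mod_mod_trivial assms(2)])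
        also have "\<dots> = (b * b') mod F" using a(2) b(2) by (metis mod_mult_right_eq mult.commute)
        also have "\<dots> = 1 mod F" using poly_mod_dvd_cong[OF b'(2) assms(2)] .
        finally show "(b' * a) mod R \<in> ?U \<and> (b' * a) mod R mod F = 1 mod F"
          using bij a(1) by (auto simp: bij_betw_def)
      qed
    qed (simp add: finite_unit_residues)
  next
    case True
    then show ?thesis by (simp only: card.empty le0)
  qed
  have "?U \<subseteq> (\<Union>c\<in>small_polys (degree F). {a \<in> ?U. a mod F = c})"
    using mod_in_small_polys[OF F0] by auto
  then have "card ?U \<le> card (\<Union>c\<in>small_polys (degree F). {a \<in> ?U. a mod F = c})"
    by (intro card_mono) (auto simp: finite_small_polys finite_unit_residues)
  also have "\<dots> \<le> (\<Sum>c\<in>small_polys (degree F). card {a \<in> ?U. a mod F = c})"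
    by (rule card_UN_le) (rule finite_small_polys)
  also have "\<dots> \<le> (\<Sum>c\<in>(small_polys (degree F) :: 'a poly set). card ?K)"
    by (rule sum_mono) (rule fibre)
  also have "\<dots> = CARD('a) ^ degree F * card ?K" by (simp add: card_small_polys)
  finally have "card (chars_mod R F) * card ?K \<le> CARD('a) ^ degree F * card ?K"
    by (simp only: card_chars_mod[OF assms])
  moreover have "1 mod R \<in> ?K"
    using assms poly_mod_dvd_cong[OF mod_mod_trivial assms(2), of 1]
    by (simp add: unit_residues_def mod_in_small_polys coprime_poly_mod_iff)
  then have "card ?K > 0" by (intro card_gt_0_iff[THEN iffD2]) (use finite_unit_residues[of R] in auto)
  ultimately show ?thesis by simp
qed

section \<open>Primitive characters\<close>

definition prime_divisors :: "'a::field poly \<Rightarrow> 'a poly set" where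
  "prime_divisors R = {P. prime_poly P \<and> P dvd R}"

lemma finite_prime_divisors: "R \<noteq> 0 \<Longrightarrow> finite (prime_divisors (R :: 'a::{field,finite} poly))"
  by (rule finite_subset[OF _ finite_degree_le[of "degree R"]])
    (auto simp: prime_divisors_def dvd_imp_degree_le)

lemma coprime_prime_prod:
  fixes P :: "'a::field poly"
  assumes "prime_poly P" "finite T" "\<And>Q. Q \<in> T \<Longrightarrow> prime_poly Q" "P \<notin> T"
  shows "coprime P (\<Prod>T)"
  unfolding prime_poly_coprime_iff[OF assms(1)]
  using prime_poly_dvd_prod[OF assms(1,2), of "\<lambda>x. x"] prime_poly_dvd_prime_poly[OF assms(1)] assms(3,4)
  by metis

lemma prod_prime_divisors_dvd:
  fixes R :: "'a::field poly"
  assumes "finite T" "T \<subseteq> prime_divisors R"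
  shows "\<Prod>T dvd R"
  using assms
proof (induction T)
  case (insert P T)
  then have "coprime (\<Prod>T) P"
    using coprime_prime_prod[of P T] by (auto simp: prime_divisors_def coprime_commute)
  moreover obtain S where S: "R = \<Prod>T * S" using insert by (auto elim: dvdE)
  ultimately have "P dvd S"
    using coprime_poly_dvd_mult[of P "\<Prod>T" S] insert by (auto simp: prime_divisors_def coprime_commute)
  then show ?case using insert S by (simp add: mult.commute mult_dvd_mono)
qed simp

lemma coprime_poly_iff_no_prime:
  fixes A R :: "'a::field poly"
  assumes "R \<noteq> 0"
  shows "coprime A R \<longleftrightarrow> (\<forall>P\<in>prime_divisors R. \<not> P dvd A)"
proof
  assume "coprime A R"
  then show "\<forall>P\<in>prime_divisors R. \<not> P dvd A"
    using prime_poly_not_unit coprime_common_divisor unfolding prime_divisors_def by blast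
next
  assume *: "\<forall>P\<in>prime_divisors R. \<not> P dvd A"
  obtain D U V where D: "D dvd A" "D dvd R" "D = U * A + V * R" using poly_bezout by blast
  have "D \<noteq> 0" using D(2) assms by auto
  have "degree D = 0"
  proof (rule ccontr)
    assume "degree D \<noteq> 0"
    then obtain P where "prime_poly P" "P dvd D" using exists_prime_poly_dvd by blast
    then show False using * D dvd_trans unfolding prime_divisors_def by blast
  qed
  then have "D dvd 1" using \<open>D \<noteq> 0\<close> is_unit_iff_degree by blast
  then obtain E where "1 = D * E" by (elim dvdE)
  then have "(E * U) * A + (E * V) * R = 1" by (simp add: D(3) algebra_simps)
  then show "coprime A R" using coprime_poly_iff_bezout by blast
qed

lemma chars_mod_mono:
  assumes "F dvd F'"
  shows "chars_mod R F \<subseteq> chars_mod R F'"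
  using poly_mod_dvd_cong[OF _ assms] unfolding chars_mod_def by blast

lemma chars_mod_self: "chars_mod R R = {chi. dirichlet_char R chi}"
  unfolding chars_mod_def by (intro Collect_cong) (metis dirichlet_char_mod dirichlet_char_1)

text \<open>Every proper monic divisor of \<open>R\<close> divides some \<open>R div P\<close>, so
  induction from the maximal proper divisors is all that has to be excluded. Primitivity thus
  becomes a sieve with one condition per prime.\<close>

lemma prim_chars_eq:
  fixes R :: "'a::field poly"
  assumes "monic_poly R"
  shows "prim_chars R = chars_mod R R - (\<Union>P\<in>prime_divisors R. chars_mod R (R div P))"
proof (intro equalityI subsetI)
  fix chi assume "chi \<in> prim_chars R"
  then have chi: "dirichlet_char R chi"
    "\<And>R'. monic_poly R' \<Longrightarrow> R' dvd R \<Longrightarrow> R' \<noteq> R \<Longrightarrow> \<exists>A. coprime A R \<and> A mod R' = 1 mod R' \<and> chi A \<noteq> 1"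
    by (auto simp: prim_chars_def primitive_char_def)
  have "chi \<notin> chars_mod R (R div P)" if P: "P \<in> prime_divisors R" for P
  proof -
    have R: "R = P * (R div P)" and pP: "prime_poly P" using P by (auto simp: prime_divisors_def)
    have "monic_poly (R div P)" using monic_poly_factor[of P "R div P"] R assms pP
      by (auto simp: prime_poly_def)
    moreover have "R div P dvd R" using R by (metis dvd_triv_right)
    moreover have "R div P \<noteq> R"
    proof
      assume eq: "R div P = R"
      then have "P * R = 1 * R" using R by simp
      then have "P = 1" using monic_poly_nonzero[OF assms] mult_cancel_right by blast
      then show False using prime_poly_not_unit[OF pP] by simp
    qed
    ultimately show ?thesis using chi(2)[of "R div P"] unfolding chars_mod_def by blast
  qed
  then show "chi \<in> chars_mod R R - (\<Union>P\<in>prime_divisors R. chars_mod R (R div P))"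
    using chi(1) by (auto simp: chars_mod_self)
next
  fix chi assume chi: "chi \<in> chars_mod R R - (\<Union>P\<in>prime_divisors R. chars_mod R (R div P))"
  have dc: "dirichlet_char R chi" using chi by (simp add: chars_mod_self)
  have "\<exists>A. coprime A R \<and> A mod R' = 1 mod R' \<and> chi A \<noteq> 1"
    if R': "monic_poly R'" "R' dvd R" "R' \<noteq> R" for R'
  proof -
    obtain S where S: "R = R' * S" using R'(2) by (elim dvdE)
    have "monic_poly S" using S assms R' monic_poly_factor by blast
    then have "degree S \<noteq> 0" using monic_degree_0 S R'(3) by force
    then obtain P where P: "prime_poly P" "P dvd S" using exists_prime_poly_dvd by blast
    obtain T where T: "S = P * T" using P(2) by (elim dvdE)
    have R: "R = P * (R' * T)" by (simp add: S T mult_ac)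
    then have "R div P = R' * T" using prime_poly_nonzero[OF P(1)] by simp
    then have "R' dvd R div P" by simp
    moreover have "P \<in> prime_divisors R" using P(1) R by (simp add: prime_divisors_def)
    ultimately have "chi \<notin> chars_mod R R'" using chi chars_mod_mono[of R' "R div P" R] by blast
    then show ?thesis using dc unfolding chars_mod_def by blast
  qed
  then show "chi \<in> prim_chars R" using dc by (auto simp: prim_chars_def primitive_char_def)
qed

text \<open>Chinese remaindering: a unit \<open>A\<close> that is 1 modulo \<open>W\<close> is, as
  far as characters can see, a product of a unit that is 1 modulo \<open>W * P\<close> and one that
  is 1 modulo \<open>W * D\<close>. Intersections in the sieve are therefore again of the form
  \<open>chars_mod\<close>.\<close>

lemma chars_mod_Int:
  fixes W D P :: "'a::field poly"
  assumes R: "R = W * D * P" and co: "coprime P D" and P: "prime_poly P"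
  shows "chars_mod R (W * P) \<inter> chars_mod R (W * D) = chars_mod R W"
proof
  show "chars_mod R W \<subseteq> chars_mod R (W * P) \<inter> chars_mod R (W * D)"
    using chars_mod_mono[of W] by simp
next
  show "chars_mod R (W * P) \<inter> chars_mod R (W * D) \<subseteq> chars_mod R W"
  proof
    fix chi assume chi: "chi \<in> chars_mod R (W * P) \<inter> chars_mod R (W * D)"
    then have dc: "dirichlet_char R chi" by (simp add: chars_mod_def)
    have "chi A = 1" if A: "coprime A R" "A mod W = 1 mod W" for A
    proof -
      obtain U V where UV: "U * P + V * D = 1" using co coprime_poly_iff_bezout by blast
      obtain t where "A - 1 = W * t" using A(2) unfolding mod_eq_dvd_iff by (elim dvdE)
      then have t: "A = 1 + W * t" by (simp add: algebra_simps)
      \<comment> \<open>\<open>C\<close> is congruent to 1 modulo \<open>W * D\<close> and, by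
        \<open>U * P + V * D = 1\<close>, to \<open>A\<close> modulo \<open>W * P\<close>.\<close>
      define C where "C = 1 + W * D * (V * t)"
      have AC: "A - C = W * P * (U * t)"
      proof -
        have "A - C = W * t * (1 - V * D)" by (simp add: t C_def algebra_simps)
        also have "1 - V * D = U * P" using UV by (simp add: algebra_simps flip: UV)
        finally show ?thesis by (simp add: mult_ac)
      qed
      have "coprime C (W * D)"
      proof -
        have "1 * C + (- (V * t)) * (W * D) = 1" by (simp add: C_def mult_ac)
        then show ?thesis using coprime_poly_iff_bezout by blast
      qed
      moreover have "coprime C P"
      proof -
        have "coprime A P" using coprime_poly_dvd_right[OF A(1), of P] R by simp
        moreover have "A mod P = C mod P" unfolding mod_eq_dvd_iff AC by simp
        ultimately show ?thesis using coprime_poly_mod_cong by blast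
      qed
      ultimately have C: "coprime C R" using R coprime_poly_mult_right by blast
      have "C mod (W * D) = 1 mod (W * D)" unfolding mod_eq_dvd_iff by (simp add: C_def)
      then have "chi C = 1" using chi C unfolding chars_mod_def by blast
      obtain E where E: "coprime E R" "(C * E) mod R = 1 mod R" using coprime_poly_inverse[OF C] .
      have "chi C * chi E = 1" using E(2) dc dirichlet_char_mult dirichlet_char_mod dirichlet_char_1 by metis
      then have "chi E = 1" using \<open>chi C = 1\<close> by simp
      have "(A * E) mod (W * P) = (C * E) mod (W * P)"
        unfolding mod_eq_dvd_iff left_diff_distrib [symmetric] AC by simp
      also have "\<dots> = 1 mod (W * P)"
        by (rule poly_mod_dvd_cong[OF E(2)]) (simp add: R mult_ac)
      finally have "chi (A * E) = 1"
        using chi A(1) E(1) coprime_poly_mult_iff unfolding chars_mod_def by blast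
      then show ?thesis using \<open>chi E = 1\<close> dirichlet_char_mult[OF dc] by simp
    qed
    then show "chi \<in> chars_mod R W" using dc by (simp add: chars_mod_def)
  qed
qed

text \<open>\<open>T\<close> collects the primes whose conditions have already been intersected.
  Removing the characters induced from \<open>R div P\<close> leaves a difference of two sums with
  \<open>S\<close> smaller by one, one with \<open>T\<close> and one with \<open>P\<close> added to
  \<open>T\<close>, hence the factor 2. For empty \<open>S\<close> orthogonality gives 0 unless the
  modulus divides \<open>A - B\<close>; as \<open>A - B\<close> is nonzero, this bounds the degree
  of the modulus and with it the number of characters.\<close>

lemma norm_sum_chars_sieve:
  fixes R A B :: "'a::{field,finite} poly"
  assumes R: "R \<noteq> 0" and AB: "coprime A R" "coprime B R" "A \<noteq> B"
    and "finite S" "finite T" "S \<inter> T = {}" "S \<union> T \<subseteq> prime_divisors R"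
  shows "norm (\<Sum>chi\<in>chars_mod R (R div \<Prod>T) - (\<Union>P\<in>S. chars_mod R (R div P)). chi A * cnj (chi B))
    \<le> 2 ^ card S * real CARD('a) ^ max (degree A) (degree B)"
  using assms(5-)
proof (induction S arbitrary: T)
  case empty
  let ?F = "R div \<Prod>T"
  have "R = \<Prod>T * ?F" using prod_prime_divisors_dvd[of T R] empty by simp
  then have F: "?F dvd R" by (metis dvd_triv_right)
  show ?case
  proof (cases "A mod ?F = B mod ?F")
    case True
    have "A - B \<noteq> 0" "?F dvd A - B" using AB(3) True by (auto simp: mod_eq_dvd_iff)
    then have "degree ?F \<le> degree (A - B)" by (rule dvd_imp_degree_le[rotated])
    also have "\<dots> \<le> max (degree A) (degree B)" by (rule degree_diff_le_max)
    finally have deg: "degree ?F \<le> max (degree A) (degree B)" .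
    have "norm (\<Sum>chi\<in>chars_mod R ?F. chi A * cnj (chi B)) \<le> (\<Sum>chi\<in>chars_mod R ?F. 1)"
      using dirichlet_char_norm[OF R] AB
      by (intro sum_norm_le) (auto simp: norm_mult chars_mod_def)
    also have "\<dots> = real (card (chars_mod R ?F))" by simp
    also have "\<dots> \<le> real (CARD('a) ^ degree ?F)"
      using card_chars_mod_le[OF R F] by (simp only: of_nat_le_iff)
    also have "\<dots> \<le> real CARD('a) ^ max (degree A) (degree B)"
      using card_field_ge_2[where 'a='a] deg by (simp add: power_increasing)
    finally show ?thesis by simp
  next
    case False
    then show ?thesis by (simp add: sum_chars_mod_cnj[OF R F AB(1,2)])
  qed
next
  case (insert P S)
  let ?X = "\<lambda>T. chars_mod R (R div \<Prod>T) - (\<Union>P\<in>S. chars_mod R (R div P))"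
  let ?s = "\<lambda>Y. \<Sum>chi\<in>Y. chi A * cnj (chi B)"
  let ?b = "2 ^ card S * real CARD('a) ^ max (degree A) (degree B)"
  have pP: "prime_poly P" and PT: "P \<notin> T" using insert by (auto simp: prime_divisors_def)
  have co: "coprime P (\<Prod>T)" using coprime_prime_prod[OF pP insert(4) _ PT] insert by (auto simp: prime_divisors_def)
  define W where "W = R div \<Prod>(insert P T)"
  have "\<Prod>(insert P T) dvd R" using insert by (intro prod_prime_divisors_dvd) auto
  then have "R = W * \<Prod>(insert P T)" by (simp only: W_def dvd_div_mult_self)
  moreover have "\<Prod>(insert P T) = P * \<Prod>T" using insert.prems(1) PT by simp
  ultimately have RW: "R = W * \<Prod>T * P" by (simp only: mult_ac)
  have nz: "P \<noteq> 0" "\<Prod>T \<noteq> 0" using RW R by auto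
  have "R = (W * P) * \<Prod>T" "R = (W * \<Prod>T) * P" using RW by (simp_all add: mult_ac)
  then have "R div \<Prod>T = W * P" "R div P = W * \<Prod>T"
    using nz nonzero_mult_div_cancel_right by metis+
  then have int: "chars_mod R (R div \<Prod>T) \<inter> chars_mod R (R div P) = chars_mod R (R div \<Prod>(insert P T))"
    using chars_mod_Int[OF RW co pP] by (simp add: W_def)
  have fin: "finite (?X T)" using finite_chars_mod[OF R] by blast
  have "chars_mod R (R div \<Prod>T) - (\<Union>P\<in>insert P S. chars_mod R (R div P)) = ?X T - ?X (insert P T)"
    unfolding int [symmetric] by blast
  moreover have "?X (insert P T) \<subseteq> ?X T" unfolding int [symmetric] by blast
  ultimately have eq: "?s (chars_mod R (R div \<Prod>T) - (\<Union>P\<in>insert P S. chars_mod R (R div P)))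
      = ?s (?X T) - ?s (?X (insert P T))"
    using fin by (simp only: sum_diff)
  have "norm (?s (?X T) - ?s (?X (insert P T))) \<le> norm (?s (?X T)) + norm (?s (?X (insert P T)))"
    by (rule norm_triangle_ineq4)
  also have "\<dots> \<le> ?b + ?b"
    using insert by (intro add_mono insert.IH) auto
  also have "\<dots> = 2 ^ card (insert P S) * real CARD('a) ^ max (degree A) (degree B)"
    using insert by simp
  finally show ?case unfolding eq .
qed

lemma norm_sum_prim_chars_le:
  fixes R A B :: "'a::{field,finite} poly"
  assumes "monic_poly R" "A \<noteq> B"
  shows "norm (\<Sum>chi\<in>prim_chars R. chi A * cnj (chi B))
    \<le> 2 ^ card (prime_divisors R) * real CARD('a) ^ max (degree A) (degree B)"
proof (cases "coprime A R \<and> coprime B R")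
  case True
  then show ?thesis
    using norm_sum_chars_sieve[of R A B "prime_divisors R" "{}"] monic_poly_nonzero[OF assms(1)]
      finite_prime_divisors[of R] assms(2)
    by (simp add: prim_chars_eq[OF assms(1)])
next
  case False
  then have "chi A * cnj (chi B) = 0" if "chi \<in> prim_chars R" for chi
    using that dirichlet_char_eq_0[of R chi A] dirichlet_char_eq_0[of R chi B]
    by (auto simp: prim_chars_def primitive_char_def)
  then have "(\<Sum>chi\<in>prim_chars R. chi A * cnj (chi B)) = 0" by (rule sum.neutral[OF ballI])
  then show ?thesis by (simp only: norm_zero) simp
qed

section \<open>Lower bound for the number of primitive characters\<close>

lemma card_le_twice_Diff:
  assumes "finite Y" "inj_on f (Y \<inter> H)" "f ` (Y \<inter> H) \<subseteq> Y - H"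
  shows "card Y \<le> 2 * card (Y - H)"
proof -
  have "card (Y \<inter> H) \<le> card (Y - H)"
    using assms by (intro card_inj_on_le[of f]) auto
  moreover have "card Y = card (Y \<inter> H) + card (Y - H)"
    by (rule card_Int_Diff) (rule assms(1))
  ultimately show ?thesis by simp
qed

text \<open>Multiplication by a character that is trivial modulo \<open>R / \<Prod>S\<close> but not modulo \<open>R / P\<close> moves
  the characters induced from \<open>R / P\<close> to characters that are not, so sieving by one more prime
  costs at most a factor 2. The same idea, with addition of \<open>\<Prod>S\<close>, bounds the number of units.\<close>

lemma card_unit_residues_le_sieve:
  fixes R :: "'a::{field,finite} poly"
  assumes R: "monic_poly R" and prim: "prim_chars R \<noteq> {}"
    and "finite S" "S \<subseteq> prime_divisors R"
  shows "card (unit_residues R) \<le> 2 ^ card S * card (chars_mod R R - (\<Union>P\<in>S. chars_mod R (R div P)))"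
  using assms(3,4)
proof (induction S)
  case empty
  have R0: "R \<noteq> 0" using monic_poly_nonzero[OF R] .
  have "{a \<in> unit_residues R. a mod R = 1 mod R} = {1 mod R}"
    using R0 by (auto simp: unit_residues_def small_polys_mod mod_in_small_polys coprime_poly_mod_iff)
  then show ?case using card_chars_mod[OF R0 dvd_refl] by simp
next
  case (insert P S)
  have R0: "R \<noteq> 0" using monic_poly_nonzero[OF R] .
  let ?Y = "chars_mod R R - (\<Union>P\<in>S. chars_mod R (R div P))"
  let ?H = "chars_mod R (R div P)"
  let ?D = "\<Prod>S"
  have pP: "prime_poly P" "P dvd R" using insert by (auto simp: prime_divisors_def)
  have co: "coprime P ?D" using coprime_prime_prod[OF pP(1) insert(1) _ insert(2)] insert by (auto simp: prime_divisors_def)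
  have DR: "?D dvd R" using insert by (intro prod_prime_divisors_dvd) auto
  obtain chi0 where chi0: "chi0 \<in> prim_chars R" using prim by blast
  then have chi0': "chi0 \<notin> ?H" "dirichlet_char R chi0"
    using insert by (auto simp: prim_chars_eq[OF R] chars_mod_self)
  then obtain A where A: "coprime A R" "A mod (R div P) = 1 mod (R div P)" "chi0 A \<noteq> 1"
    unfolding chars_mod_def by blast
  \<comment> \<open>\<open>chi0\<close> supplies a unit \<open>A\<close> that is 1 modulo
    \<open>R div P\<close> but not modulo \<open>R\<close>. Were \<open>A\<close> also 1 modulo
    \<open>R div ?D\<close>, coprimality of \<open>P\<close> and \<open>?D\<close> would make it 1
    modulo \<open>R\<close>, contradicting \<open>chi0 A \<noteq> 1\<close>.\<close>
  have "A mod (R div ?D) \<noteq> 1 mod (R div ?D)"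
  proof
    assume "A mod (R div ?D) = 1 mod (R div ?D)"
    then have "R div ?D * ?D dvd (A - 1) * ?D" by (simp add: mod_eq_dvd_iff mult_dvd_mono)
    then have 1: "R dvd (A - 1) * ?D" using DR by simp
    have "R div P * P dvd (A - 1) * P" using A(2) by (simp add: mod_eq_dvd_iff mult_dvd_mono)
    then have 2: "R dvd (A - 1) * P" using pP by simp
    obtain U V where UV: "U * P + V * ?D = 1" using co coprime_poly_iff_bezout by blast
    have "R dvd U * ((A - 1) * P) + V * ((A - 1) * ?D)" using 1 2 by simp
    also have "\<dots> = (A - 1) * (U * P + V * ?D)" by (simp add: algebra_simps)
    finally have "A mod R = 1 mod R" by (simp add: UV mod_eq_dvd_iff)
    then show False using A(3) chi0'(2) dirichlet_char_mod dirichlet_char_1 by metis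
  qed
  moreover have "R div ?D dvd R" using DR by (metis dvd_div_mult_self dvd_triv_left)
  ultimately obtain psi where psi: "psi \<in> chars_mod R (R div ?D)" "psi A \<noteq> 1"
    using chars_mod_separate[OF R0 _ A(1)] by blast
  have psiH: "psi \<notin> ?H" using psi(2) A unfolding chars_mod_def by blast
  \<comment> \<open>\<open>R div ?D\<close> divides every \<open>R div Q\<close> with
    \<open>Q\<close> in \<open>S\<close>, so twisting by \<open>psi\<close> respects the conditions
    sieved earlier.\<close>
  have psiS: "psi \<in> chars_mod R (R div Q)" if "Q \<in> S" for Q
  proof -
    have "Q dvd ?D" using that insert(1) by (intro dvd_prodI[of S Q "\<lambda>x. x", simplified])
    moreover from this obtain E where E: "?D = Q * E" by (elim dvdE)
    moreover obtain G where G: "R = ?D * G" using DR by (elim dvdE)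
    moreover have "?D \<noteq> 0" "Q \<noteq> 0" using R0 G E by auto
    ultimately have "R div ?D = G" "R div Q = E * G"
      by (metis nonzero_mult_div_cancel_left mult.assoc)+
    then show ?thesis using chars_mod_mono[of "R div ?D" "R div Q" R] psi(1) by auto
  qed
  have dc: "dirichlet_char R psi" using psi by (simp add: chars_mod_def)
  have half: "card ?Y \<le> 2 * card (?Y - ?H)"
  proof (rule card_le_twice_Diff[where f = "\<lambda>chi x. chi x * psi x"])
    show "finite ?Y" using finite_chars_mod[OF R0] by blast
    have canc: "(\<lambda>x. chi x * psi x * cnj (psi x)) = chi" if "chi \<in> ?Y" for chi
      using chars_mod_cancel[OF R0 _ dc] that by (simp add: chars_mod_self)
    show "inj_on (\<lambda>chi x. chi x * psi x) (?Y \<inter> ?H)"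
    proof (rule inj_onI)
      fix c1 c2 assume c: "c1 \<in> ?Y \<inter> ?H" "c2 \<in> ?Y \<inter> ?H" "(\<lambda>x. c1 x * psi x) = (\<lambda>x. c2 x * psi x)"
      have "(\<lambda>x. c1 x * psi x * cnj (psi x)) = (\<lambda>x. c2 x * psi x * cnj (psi x))"
      proof
        fix x show "c1 x * psi x * cnj (psi x) = c2 x * psi x * cnj (psi x)"
          using fun_cong[OF c(3), of x] by simp
      qed
      then show "c1 = c2" using canc c(1,2) by auto
    qed
    show "(\<lambda>chi x. chi x * psi x) ` (?Y \<inter> ?H) \<subseteq> ?Y - ?H"
    proof (rule image_subsetI)
      fix chi assume chi: "chi \<in> ?Y \<inter> ?H"
      have chid: "dirichlet_char R chi" using chi by (simp add: chars_mod_self)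
      have "(\<lambda>x. chi x * psi x) \<in> chars_mod R R"
        using dirichlet_char_times[OF chid dc] by (simp add: chars_mod_self)
      moreover have "(\<lambda>x. chi x * psi x) \<notin> chars_mod R (R div Q)" if "Q \<in> S" for Q
      proof
        assume "(\<lambda>x. chi x * psi x) \<in> chars_mod R (R div Q)"
        then have "(\<lambda>x. chi x * psi x * cnj (psi x)) \<in> chars_mod R (R div Q)"
          using chars_mod_times[OF _ chars_mod_cnj[OF psiS[OF that]]] by blast
        then show False using canc[of chi] chi that by auto
      qed
      moreover have "(\<lambda>x. chi x * psi x) \<notin> ?H"
      proof
        assume "(\<lambda>x. chi x * psi x) \<in> ?H"
        then have "(\<lambda>x. chi x * psi x * cnj (chi x)) \<in> ?H"
          using chars_mod_times[OF _ chars_mod_cnj[of chi R "R div P"]] chi by blast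
        moreover have "(\<lambda>x. chi x * psi x * cnj (chi x)) = psi"
          using chars_mod_cancel[OF R0 dc chid] by (simp add: mult.commute)
        ultimately show False using psiH by simp
      qed
      ultimately show "(\<lambda>x. chi x * psi x) \<in> ?Y - ?H" by blast
    qed
  qed
  have Z: "?Y - ?H = chars_mod R R - (\<Union>P\<in>insert P S. chars_mod R (R div P))" by blast
  have "card (unit_residues R) \<le> 2 ^ card S * card ?Y" using insert by auto
  also have "\<dots> \<le> 2 ^ card S * (2 * card (?Y - ?H))" using half by (rule mult_le_mono2)
  finally have "card (unit_residues R) \<le> 2 ^ card S * (2 * card (chars_mod R R - (\<Union>P\<in>insert P S. chars_mod R (R div P))))"
    unfolding Z .
  then show ?case using insert(1,2) by simp
qed

lemma card_small_polys_le_sieve: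
  fixes R :: "'a::{field,finite} poly"
  assumes R: "R \<noteq> 0" and "finite S" "S \<subseteq> prime_divisors R"
  shows "CARD('a) ^ degree R \<le> 2 ^ card S * card {a \<in> small_polys (degree R) :: 'a poly set. \<forall>P\<in>S. \<not> P dvd a}"
  using assms(2,3)
proof (induction S)
  case empty
  then show ?case by (simp add: card_small_polys)
next
  case (insert P S)
  let ?Y = "{a \<in> small_polys (degree R) :: 'a poly set. \<forall>P\<in>S. \<not> P dvd a}"
  let ?H = "{a. P dvd a}"
  let ?D = "\<Prod>S"
  have pP: "prime_poly P" "P dvd R" using insert by (auto simp: prime_divisors_def)
  have co: "coprime P ?D" using coprime_prime_prod[OF pP(1) insert(1) _ insert(2)] insert by (auto simp: prime_divisors_def)
  have "\<Prod>(insert P S) dvd R" using insert by (intro prod_prime_divisors_dvd) auto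
  then have PD: "P * ?D dvd R" using insert by simp
  then have D0: "?D \<noteq> 0" using R by auto
  have "degree P + degree ?D \<le> degree R"
    using dvd_imp_degree_le[OF PD R] D0 prime_poly_nonzero[OF pP(1)] by (simp add: degree_mult_eq)
  \<comment> \<open>The translation by \<open>?D\<close> must stay among the residues; its degree is
    strictly smaller because \<open>P * ?D\<close> still divides \<open>R\<close>.\<close>
  then have deg: "degree ?D < degree R" using prime_poly_degree_pos[OF pP(1)] by simp
  have half: "card ?Y \<le> 2 * card (?Y - ?H)"
  proof (rule card_le_twice_Diff[where f = "\<lambda>a. a + ?D"])
    show "finite ?Y" by (simp add: finite_small_polys)
    show "(\<lambda>a. a + ?D) ` (?Y \<inter> ?H) \<subseteq> ?Y - ?H"
    proof (rule image_subsetI)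
      fix a assume a: "a \<in> ?Y \<inter> ?H"
      have "a + ?D \<in> small_polys (degree R)"
        using a deg by (auto simp: small_polys_def coeff_eq_0)
      moreover have "\<not> Q dvd a + ?D" if "Q \<in> S" for Q
      proof -
        have "Q dvd ?D" using that insert(1) by (intro dvd_prodI[of S Q "\<lambda>x. x", simplified])
        then show ?thesis using a that dvd_add_left_iff by blast
      qed
      moreover have "\<not> P dvd a + ?D"
        using a co prime_poly_coprime_iff[OF pP(1)] dvd_add_right_iff by blast
      ultimately show "a + ?D \<in> ?Y - ?H" by blast
    qed
  qed (simp add: inj_on_def)
  have Z: "?Y - ?H = {a \<in> small_polys (degree R). \<forall>P\<in>insert P S. \<not> P dvd a}" by blast
  have "CARD('a) ^ degree R \<le> 2 ^ card S * card ?Y" using insert by auto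
  also have "\<dots> \<le> 2 ^ card S * (2 * card (?Y - ?H))" using half by (rule mult_le_mono2)
  finally have "CARD('a) ^ degree R \<le> 2 ^ card S * (2 * card {a \<in> small_polys (degree R). \<forall>P\<in>insert P S. \<not> P dvd a})"
    unfolding Z .
  then show ?case using insert(1,2) by simp
qed

text \<open>A factor 2 per prime divisor is lost twice: from residues to units, and from units to
  primitive characters.\<close>

lemma phi_star_lower_bound:
  fixes R :: "'a::{field,finite} poly"
  assumes R: "monic_poly R" and "phi_star R > 0"
  shows "CARD('a) ^ degree R \<le> 4 ^ card (prime_divisors R) * phi_star R"
proof -
  let ?w = "card (prime_divisors R)"
  have R0: "R \<noteq> 0" using monic_poly_nonzero[OF R] .
  note fin = finite_prime_divisors[OF R0]
  have "prim_chars R \<noteq> {}" using assms(2) by (auto simp: phi_star_def)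
  then have 1: "card (unit_residues R) \<le> 2 ^ ?w * phi_star R"
    using card_unit_residues_le_sieve[OF R _ fin] by (simp add: phi_star_def prim_chars_eq[OF R])
  have "CARD('a) ^ degree R \<le> 2 ^ ?w * card (unit_residues R)"
    using card_small_polys_le_sieve[OF R0 fin] coprime_poly_iff_no_prime[OF R0]
    by (simp add: unit_residues_def)
  also have "\<dots> \<le> 2 ^ ?w * (2 ^ ?w * phi_star R)" using 1 by simp
  also have "\<dots> = (2 * 2) ^ ?w * phi_star R" by (simp only: power_mult_distrib mult.assoc)
  finally show ?thesis by simp
qed

text \<open>Primes of degree below \<open>n\<close> number at most \<open>q ^ n\<close>; those of
  degree at least \<open>n\<close> that divide \<open>R\<close> number at most
  \<open>degree R / n\<close>. The free parameter \<open>n\<close> makes the second share as small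
  as desired.\<close>

lemma card_prime_divisors_le:
  fixes R :: "'a::{field,finite} poly"
  assumes "R \<noteq> 0"
  shows "n * card (prime_divisors R) \<le> n * CARD('a) ^ n + degree R"
proof -
  let ?S = "{P \<in> prime_divisors R. P \<in> small_polys n}" and ?L = "{P \<in> prime_divisors R. P \<notin> small_polys n}"
  note fin = finite_prime_divisors[OF assms]
  have "card (prime_divisors R) = card (?S \<union> ?L)" by (rule arg_cong[of _ _ card]) blast
  also have "\<dots> = card ?S + card ?L" using fin by (intro card_Un_disjoint) auto
  also have "card ?S \<le> card (small_polys n :: 'a poly set)"
    by (intro card_mono finite_small_polys) auto
  finally have *: "card (prime_divisors R) \<le> CARD('a) ^ n + card ?L" by (simp add: card_small_polys)
  have "n * card ?L = (\<Sum>P\<in>?L. n)" by simp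
  also have "\<dots> \<le> (\<Sum>P\<in>?L. degree P)"
    by (intro sum_mono) (auto simp: small_polys_iff not_less)
  also have "\<dots> = degree (\<Prod>?L)"
    by (rule degree_prod_eq_sum_degree [symmetric]) (auto simp: prime_divisors_def prime_poly_nonzero)
  also have "\<dots> \<le> degree R"
    using fin by (intro dvd_imp_degree_le prod_prime_divisors_dvd assms) auto
  finally have "n * card ?L \<le> degree R" .
  then show ?thesis using mult_le_mono2[OF *, of n] by (simp add: algebra_simps)
qed

text \<open>Half of the saving \<open>q ^ degree R\<close> pays for
  \<open>8 ^ card (prime_divisors R)\<close>, up to a constant depending on \<open>q\<close> alone;
  the fourth root of the remaining half is \<open>q ^ (degree R / 8)\<close>.\<close>

lemma norm_prim_char_average_le:
  fixes R A B :: "'a::{field,finite} poly"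
  assumes R: "monic_poly R" and phi: "phi_star R > 0" and AB: "A \<noteq> B" "A \<noteq> 0" "B \<noteq> 0"
  shows "norm ((\<Sum>chi\<in>prim_chars R. chi A * cnj (chi B)) / of_nat (phi_star R))
    \<le> 8 ^ (CARD('a) ^ 6) * real CARD('a) powr (- real (degree R) / 8) * (pabs A powr (1/4) * pabs B powr (1/4))"
proof -
  let ?q = "real CARD('a)" and ?w = "card (prime_divisors R)" and ?d = "degree R"
  let ?s = "\<Sum>chi\<in>prim_chars R. chi A * cnj (chi B)"
  define t where "t = norm (?s / of_nat (phi_star R))"
  have R0: "R \<noteq> 0" using monic_poly_nonzero[OF R] .
  have q: "?q \<ge> 2" using card_field_ge_2[where 'a='a] by simp
  have t0: "t \<ge> 0" by (simp add: t_def)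
  have "norm ?s \<le> (\<Sum>chi\<in>prim_chars R. 1)"
    using dirichlet_char_norm_le[OF R0]
    by (intro sum_norm_le) (auto simp: norm_mult prim_chars_def primitive_char_def intro!: mult_le_one)
  then have t1: "t \<le> 1" using phi by (simp add: t_def norm_divide phi_star_def)
  have "t \<le> 2 ^ ?w * ?q ^ max (degree A) (degree B) / real (phi_star R)"
    using norm_sum_prim_chars_le[OF R AB(1)] phi by (simp add: t_def norm_divide divide_right_mono)
  \<comment> \<open>The maximum of the degrees is replaced by their sum, because the later summation
    needs a bound that is a product of a function of \<open>A\<close> and a function of
    \<open>B\<close>.\<close>
  also have "\<dots> \<le> 2 ^ ?w * (pabs A * pabs B) / real (phi_star R)"
    using q by (intro divide_right_mono mult_left_mono) (auto simp: pabs_def power_add [symmetric] intro!: power_increasing)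
  also have "\<dots> = 2 ^ ?w / real (phi_star R) * (pabs A * pabs B)" by simp
  also have "2 ^ ?w / real (phi_star R) \<le> 8 ^ (CARD('a) ^ 6) * ?q powr (- real ?d / 2)"
  proof -
    have "real (CARD('a) ^ ?d) \<le> real (4 ^ ?w * phi_star R)"
      using phi_star_lower_bound[OF R phi] by (simp only: of_nat_le_iff)
    then have "?q ^ ?d \<le> 4 ^ ?w * real (phi_star R)" by simp
    moreover have "?q ^ ?d > 0" using q by simp
    ultimately have "1 / real (phi_star R) \<le> 4 ^ ?w / ?q ^ ?d" using phi by (simp add: field_simps)
    then have "2 ^ ?w / real (phi_star R) \<le> 2 ^ ?w * (4 ^ ?w / ?q ^ ?d)"
      using mult_left_mono[of _ _ "2 ^ ?w :: real"] by fastforce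
    also have "\<dots> = 8 ^ ?w / ?q ^ ?d" by (simp add: power_mult_distrib [symmetric])
    also have "(8::real) ^ ?w \<le> 8 ^ (CARD('a) ^ 6) * ?q powr (real ?d / 2)"
    proof -
      \<comment> \<open>The choice \<open>n = 6\<close> is made for
        \<open>8 ^ (degree R / 6) = 2 ^ (degree R / 2)\<close>, which is at most
        \<open>q ^ (degree R / 2)\<close>.\<close>
      have "6 * ?w \<le> 6 * CARD('a) ^ 6 + ?d" by (rule card_prime_divisors_le[OF R0])
      then have w: "real ?w \<le> real (CARD('a) ^ 6) + real ?d / 6" by linarith
      have "(8::real) ^ ?w = 8 powr real ?w" by (simp add: powr_realpow)
      also have "\<dots> \<le> 8 powr (real (CARD('a) ^ 6) + real ?d / 6)" using w by (intro powr_mono) auto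
      also have "\<dots> = 8 ^ (CARD('a) ^ 6) * 8 powr (real ?d / 6)"
        unfolding powr_add by (subst powr_realpow) auto
      also have "(8::real) powr (real ?d / 6) = (2 powr 3) powr (real ?d / 6)" by simp
      also have "\<dots> = 2 powr (real ?d / 2)" by (simp only: powr_powr) simp
      also have "\<dots> \<le> ?q powr (real ?d / 2)" using q by (intro powr_mono2) auto
      finally show ?thesis by simp
    qed
    also have "8 ^ (CARD('a) ^ 6) * ?q powr (real ?d / 2) / ?q ^ ?d = 8 ^ (CARD('a) ^ 6) * ?q powr (- real ?d / 2)"
    proof -
      have "?q powr (real ?d / 2) / ?q ^ ?d = ?q powr (real ?d / 2) / ?q powr real ?d"
        using q by (simp add: powr_realpow)
      also have "\<dots> = ?q powr (- real ?d / 2)" by (simp add: powr_diff [symmetric])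
      finally show ?thesis by (simp only: times_divide_eq_right [symmetric])
    qed
    finally show ?thesis by (simp add: divide_right_mono)
  qed
  finally have y: "t \<le> 8 ^ (CARD('a) ^ 6) * ?q powr (- real ?d / 2) * (pabs A * pabs B)"
    using pabs_pos[of A] pabs_pos[of B] by (simp add: mult_right_mono)
  have "t \<le> t powr (1/4)"
  proof (cases "t = 0")
    case False
    then show ?thesis using t0 t1 powr_mono'[of "1/4" 1 t] by simp
  qed simp
  also have "\<dots> \<le> (8 ^ (CARD('a) ^ 6) * ?q powr (- real ?d / 2) * (pabs A * pabs B)) powr (1/4)"
    using t0 y by (intro powr_mono2) auto
  also have "\<dots> = (8 ^ (CARD('a) ^ 6)) powr (1/4) * ?q powr (- real ?d / 8) * (pabs A powr (1/4) * pabs B powr (1/4))"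
    using pabs_pos[of A] pabs_pos[of B] by (simp add: powr_mult powr_powr)
  also have "\<dots> \<le> (8 ^ (CARD('a) ^ 6)) powr 1 * ?q powr (- real ?d / 8) * (pabs A powr (1/4) * pabs B powr (1/4))"
    by (intro mult_right_mono powr_mono) auto
  finally show ?thesis by (simp add: t_def)
qed

section \<open>Local factors and Mertens' theorem\<close>

text \<open>For positive \<open>k\<close>, the power series coefficients of
  \<open>(1 - x) ^ (- k)\<close>, equal to \<open>d_k\<close> at the \<open>j\<close>-th power of a
  prime.\<close>

definition mchoose :: "nat \<Rightarrow> nat \<Rightarrow> real" where
  "mchoose k j = real ((j + k - 1) choose j)"

text \<open>The power series coefficients of \<open>exp (k * (\<Sum>m=1..M. x ^ m / m))\<close>, obtained from its
  logarithmic derivative.\<close>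

fun trunc_coeff :: "nat \<Rightarrow> nat \<Rightarrow> nat \<Rightarrow> real" where
  "trunc_coeff k M 0 = 1"
| "trunc_coeff k M (Suc j) = real k / real (Suc j) * (\<Sum>i<min (Suc j) M. trunc_coeff k M (j - i))"

declare trunc_coeff.simps(2) [simp del]

lemma mchoose_0 [simp]: "mchoose k 0 = 1"
  by (simp add: mchoose_def)

lemma mchoose_nonneg [simp]: "mchoose k j \<ge> 0"
  by (simp add: mchoose_def)

lemma mchoose_1: "k > 0 \<Longrightarrow> mchoose k (Suc 0) = real k"
  by (simp add: mchoose_def)

lemma mchoose_one [simp]: "mchoose 1 j = 1"
  by (simp add: mchoose_def)

lemma mchoose_Suc_nat:
  assumes "k > 0"
  shows "Suc j * ((Suc j + k - 1) choose Suc j) = (j + k) * ((j + k - 1) choose j)"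
proof -
  obtain b where k: "k = Suc b" using assms gr0_conv_Suc by blast
  have "Suc j * (Suc (j + b) choose Suc j) = Suc (j + b) * ((j + b) choose j)"
    using Suc_times_binomial_eq[of "j + b" j] by (simp only: mult.commute)
  then show ?thesis by (simp add: k)
qed

lemma mchoose_Suc:
  assumes "k > 0"
  shows "real (Suc j) * mchoose k (Suc j) = real (j + k) * mchoose k j"
  using arg_cong[OF mchoose_Suc_nat[OF assms, of j], of real] unfolding mchoose_def of_nat_mult .

text \<open>The coefficient form of the differential equation of \<open>(1 - x) ^ (- k)\<close>. It
  is the recursion of \<open>trunc_coeff\<close> without the cutoff \<open>M\<close>, so the two
  sequences can be compared by induction.\<close>

lemma mchoose_recursion:
  assumes "k > 0"
  shows "mchoose k (Suc j) = real k / real (Suc j) * (\<Sum>i<Suc j. mchoose k (j - i))"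
proof -
  have "real (Suc j) * mchoose k (Suc j) = real k * (\<Sum>i<Suc j. mchoose k i)" for j
  proof (induction j)
    case 0
    then show ?case using assms by (simp add: mchoose_1)
  next
    case (Suc j)
    have "real (Suc (Suc j)) * mchoose k (Suc (Suc j)) = real (Suc j + k) * mchoose k (Suc j)"
      by (rule mchoose_Suc[OF assms])
    also have "\<dots> = real (Suc j) * mchoose k (Suc j) + real k * mchoose k (Suc j)"
      by (simp add: algebra_simps)
    finally show ?case using Suc.IH by (simp add: algebra_simps)
  qed
  moreover have "(\<Sum>i<Suc j. mchoose k (j - i)) = (\<Sum>i<Suc j. mchoose k i)"
    using sum.nat_diff_reindex[of "mchoose k" "Suc j"] by simp
  ultimately show ?thesis by (simp add: field_simps del: of_nat_Suc)
qed

lemma trunc_coeff_nonneg: "trunc_coeff k M j \<ge> 0"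
proof (induction j rule: less_induct)
  case (less j)
  then show ?case
    by (cases j) (auto simp: trunc_coeff.simps(2) intro!: divide_nonneg_nonneg mult_nonneg_nonneg sum_nonneg)
qed

lemma trunc_coeff_le:
  assumes "k > 0"
  shows "trunc_coeff k M j \<le> mchoose k j"
proof (induction j rule: less_induct)
  case (less j)
  show ?case
  proof (cases j)
    case (Suc i)
    have "(\<Sum>l<min (Suc i) M. trunc_coeff k M (i - l)) \<le> (\<Sum>l<min (Suc i) M. mchoose k (i - l))"
      by (intro sum_mono less) (simp add: Suc)
    also have "\<dots> \<le> (\<Sum>l<Suc i. mchoose k (i - l))"
      by (intro sum_mono2) auto
    finally show ?thesis
      unfolding Suc trunc_coeff.simps(2) mchoose_recursion[OF assms] by (intro mult_left_mono) auto
  qed simp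
qed

text \<open>Up to index \<open>M\<close> the recursion never meets its cutoff. With
  \<open>M = X div degree P\<close> this is the agreement of local factors in all prime powers of
  degree at most \<open>X\<close>.\<close>

lemma trunc_coeff_eq:
  assumes "k > 0" "j \<le> M"
  shows "trunc_coeff k M j = mchoose k j"
  using assms(2)
proof (induction j rule: less_induct)
  case (less j)
  show ?case
  proof (cases j)
    case (Suc i)
    have "min (Suc i) M = Suc i" using less(2) Suc by simp
    moreover have "(\<Sum>l<Suc i. trunc_coeff k M (i - l)) = (\<Sum>l<Suc i. mchoose k (i - l))"
      using less Suc by (intro sum.cong refl less(1)) auto
    ultimately show ?thesis
      unfolding Suc trunc_coeff.simps(2) mchoose_recursion[OF assms(1)] by simp
  qed simp
qed

lemma summable_mchoose_sq:
  assumes "k > 0" "0 \<le> y" "y < 1"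
  shows "summable (\<lambda>j. mchoose k j ^ 2 * y ^ j)"
proof -
  obtain c where c: "y < c" "c < 1" using assms dense by blast
  have "(\<lambda>j. ((real j + real k) / real (Suc j)) ^ 2 * y) \<longlonglongrightarrow> y" by real_asymp
  then have "\<forall>\<^sub>F j in sequentially. ((real j + real k) / real (Suc j)) ^ 2 * y < c"
    using c(1) by (rule order_tendstoD)
  then obtain N where N: "\<And>j. j \<ge> N \<Longrightarrow> ((real j + real k) / real (Suc j)) ^ 2 * y < c"
    unfolding eventually_sequentially by blast
  show ?thesis
  proof (rule summable_ratio_test[OF c(2)])
    fix j assume "j \<ge> N"
    have "mchoose k (Suc j) = (real j + real k) / real (Suc j) * mchoose k j"
      using mchoose_Suc[OF assms(1), of j] by (simp add: field_simps del: of_nat_Suc)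
    then have "mchoose k (Suc j) ^ 2 * y ^ Suc j
        = (((real j + real k) / real (Suc j)) ^ 2 * y) * (mchoose k j ^ 2 * y ^ j)"
      by (simp only: power_mult_distrib power_Suc mult_ac)
    also have "\<dots> \<le> c * (mchoose k j ^ 2 * y ^ j)"
      using N[OF \<open>j \<ge> N\<close>] assms by (intro mult_right_mono) auto
    finally show "norm (mchoose k (Suc j) ^ 2 * y ^ Suc j) \<le> c * norm (mchoose k j ^ 2 * y ^ j)"
      using assms by simp
  qed
qed

text \<open>With this comparison a single ratio test, for the squared coefficients, also covers the
  series with unsquared ones.\<close>

lemma mchoose_le_sq: "k > 0 \<Longrightarrow> mchoose k j \<le> mchoose k j ^ 2"
proof -
  assume "k > 0"
  then have "mchoose k j \<ge> 1" unfolding mchoose_def by (simp add: Suc_le_eq)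
  then show ?thesis by (intro self_le_power) auto
qed

lemma summable_trunc_coeff:
  fixes x :: "'a::{real_normed_field,banach}"
  assumes "k > 0" "norm x < 1"
  shows "summable (\<lambda>j. norm (of_real (trunc_coeff k M j) * x ^ j))"
proof (rule summable_comparison_test'[OF summable_mchoose_sq[OF assms(1) norm_ge_zero assms(2)]])
  fix j :: nat
  have "trunc_coeff k M j \<le> mchoose k j ^ 2"
    using trunc_coeff_le[OF assms(1)] mchoose_le_sq[OF assms(1)] order_trans by blast
  then show "norm (norm (of_real (trunc_coeff k M j) * x ^ j)) \<le> mchoose k j ^ 2 * norm x ^ j"
    by (simp add: norm_mult norm_power trunc_coeff_nonneg mult_right_mono)
qed

text \<open>On the unit ball both sides solve \<open>y' = p' * y\<close> with value 1 at 0, so the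
  series times \<open>exp (- p)\<close> is constant there. The field is left general because the
  identity is used at complex points for character values and at real points for the
  weights.\<close>

lemma trunc_coeff_sums_exp:
  fixes x :: "'a::{real_normed_field,banach}"
  assumes "k > 0" "norm x < 1"
  shows "(\<Sum>j. of_real (trunc_coeff k M j) * x ^ j) = exp (of_nat k * (\<Sum>m\<in>{1..M}. x ^ m / of_nat m))"
proof -
  define f where "f z = (\<Sum>j. of_real (trunc_coeff k M j) * z ^ j)" for z :: 'a
  define p where "p z = of_nat k * (\<Sum>m\<in>{1..M}. z ^ m / of_nat m)" for z :: 'a
  define p' where "p' z = of_nat k * (\<Sum>i<M. z ^ i)" for z :: 'a
  have p: "(p has_field_derivative p' z) (at z)" for z
  proof -
    have "(p has_field_derivative of_nat k * (\<Sum>m\<in>{1..M}. of_nat m * z ^ (m - 1) / of_nat m)) (at z)"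
      unfolding p_def by (auto intro!: derivative_eq_intros sum.cong simp: mult_ac)
    also have "(\<Sum>m\<in>{1..M}. of_nat m * z ^ (m - 1) / of_nat m) = (\<Sum>m\<in>{1..M}. z ^ (m - 1))"
      by (intro sum.cong refl) (auto simp del: of_nat_diff)
    also have "\<dots> = (\<Sum>i<M. z ^ i)"
      by (rule sum.reindex_bij_witness[where i = Suc and j = "\<lambda>m. m - 1"]) auto
    finally show ?thesis by (simp add: p'_def)
  qed
  have f: "(f has_field_derivative p' z * f z) (at z)" if z: "norm z < 1" for z
  proof -
    have "(f has_field_derivative (\<Sum>n. diffs (\<lambda>j. of_real (trunc_coeff k M j)) n * z ^ n)) (at z)"
      unfolding f_def
    proof (rule termdiffs_strong'[OF _ z])
      fix w :: 'a assume "norm w < 1"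
      then show "summable (\<lambda>j. of_real (trunc_coeff k M j) * w ^ j)"
        by (rule summable_norm_cancel[OF summable_trunc_coeff[OF assms(1)]])
    qed
    also have "(\<Sum>n. diffs (\<lambda>j. of_real (trunc_coeff k M j)) n * z ^ n) = p' z * f z"
    proof -
      \<comment> \<open>\<open>a\<close> is the finite geometric series in \<open>p'\<close>; its
        Cauchy product with the coefficients of \<open>f\<close> is the sum occurring in the
        recursion of \<open>trunc_coeff\<close>.\<close>
      define a where "a i = (if i < M then z ^ i else 0)" for i
      define b where "b j = of_real (trunc_coeff k M j) * z ^ j" for j
      have sa: "(\<lambda>i. norm (a i)) sums (\<Sum>i<M. norm (a i))"
        by (rule sums_finite) (auto simp: a_def)
      have "a sums (\<Sum>i<M. a i)" by (rule sums_finite) (auto simp: a_def)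
      then have "(\<Sum>i. a i) = (\<Sum>i<M. a i)" by (rule sums_unique [symmetric])
      then have suma: "(\<Sum>i. a i) = (\<Sum>i<M. z ^ i)" by (simp add: a_def)
      have "(\<lambda>n. \<Sum>i\<le>n. a i * b (n - i)) sums ((\<Sum>i. a i) * (\<Sum>j. b j))"
        using sa summable_trunc_coeff[OF assms(1) z] unfolding b_def
        by (intro Cauchy_product_sums) (auto simp: sums_iff)
      then have "(\<lambda>n. of_nat k * (\<Sum>i\<le>n. a i * b (n - i))) sums (of_nat k * ((\<Sum>i<M. z ^ i) * f z))"
        unfolding suma by (intro sums_mult) (simp add: b_def f_def)
      moreover have "of_nat k * (\<Sum>i\<le>n. a i * b (n - i)) = diffs (\<lambda>j. of_real (trunc_coeff k M j)) n * z ^ n" for n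
      proof -
        have "(\<Sum>i\<le>n. a i * b (n - i)) = (\<Sum>i\<in>{..n}. if i < M then of_real (trunc_coeff k M (n - i)) * z ^ n else 0)"
          by (intro sum.cong refl) (auto simp: a_def b_def mult_ac power_add [symmetric])
        also have "\<dots> = (\<Sum>i\<in>{i\<in>{..n}. i < M}. of_real (trunc_coeff k M (n - i)) * z ^ n)"
          by (rule sum.inter_filter [symmetric]) simp
        also have "{i\<in>{..n}. i < M} = {..<min (Suc n) M}" by auto
        finally have "(\<Sum>i\<le>n. a i * b (n - i)) = of_real (\<Sum>i<min (Suc n) M. trunc_coeff k M (n - i)) * z ^ n"
          by (simp add: sum_distrib_right)
        moreover have "real (Suc n) * trunc_coeff k M (Suc n) = real k * (\<Sum>i<min (Suc n) M. trunc_coeff k M (n - i))"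
          by (simp add: trunc_coeff.simps(2) del: of_nat_Suc)
        ultimately have "of_nat k * (\<Sum>i\<le>n. a i * b (n - i)) = of_real (real (Suc n) * trunc_coeff k M (Suc n)) * z ^ n"
          by simp
        then show ?thesis unfolding diffs_def by (simp only: of_real_mult of_real_of_nat_eq)
      qed
      ultimately have "(\<lambda>n. diffs (\<lambda>j. of_real (trunc_coeff k M j)) n * z ^ n) sums (p' z * f z)"
        by (simp add: p'_def mult.assoc)
      then show ?thesis by (rule sums_unique [symmetric])
    qed
    finally show ?thesis .
  qed
  have "\<exists>c. \<forall>z\<in>ball 0 1. f z * exp (- p z) = c"
  proof (rule has_field_derivative_zero_constant)
    fix z :: 'a assume "z \<in> ball 0 1"
    then have "norm z < 1" by simp
    have "((\<lambda>z. f z * exp (- p z)) has_field_derivative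
        (p' z * f z) * exp (- p z) + f z * (exp (- p z) * (- p' z))) (at z)"
      using f[OF \<open>norm z < 1\<close>] p[of z]
      by (auto intro!: derivative_eq_intros simp: algebra_simps)
    then show "((\<lambda>z. f z * exp (- p z)) has_field_derivative 0) (at z within ball 0 1)"
      using has_field_derivative_at_within by (simp add: algebra_simps)
  qed simp
  then obtain c where c: "\<And>z. z \<in> ball 0 1 \<Longrightarrow> f z * exp (- p z) = c" by blast
  have "f 0 = 1" using powser_zero[of "\<lambda>j. of_real (trunc_coeff k M j) :: 'a"] by (simp add: f_def)
  moreover have "p 0 = 0" by (simp add: p_def power_0_left)
  ultimately have "c = 1" using c[of 0] by simp
  then have "f x * exp (- p x) = 1" using c[of x] assms(2) by simp
  then have "f x = exp (p x)" by (simp add: exp_minus field_simps)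
  then show ?thesis by (simp add: f_def p_def)
qed

text \<open>Monic divisors of \<open>P ^ m\<close> are powers of \<open>P\<close>, so the
  factorisations correspond to lists of \<open>k\<close> exponents with sum \<open>m\<close>,
  counted by stars and bars.\<close>

lemma dk_prime_power:
  fixes P :: "'a::{field,finite} poly"
  assumes P: "prime_poly P" and k: "k > 0"
  shows "real (dk k (P ^ m)) = mchoose k m"
proof -
  have monic_dvd: "\<exists>i. D = P ^ i" if "monic_poly D" "D dvd P ^ n" for D n
    using that(2)
  proof (induction n)
    case 0
    then have "D dvd 1" by simp
    then have "D = 1" using monic_dvd_antisym[OF that(1) monic_poly_1] by simp
    then show ?case by (intro exI[of _ 0]) simp
  next
    case (Suc n)
    obtain E where E: "P ^ Suc n = D * E" using Suc.prems by (elim dvdE)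
    show ?case
    proof (cases "P dvd E")
      case True
      then obtain E' where "E = P * E'" by (elim dvdE)
      then have "P * P ^ n = P * (D * E')" using E by (simp add: mult_ac)
      then have "P ^ n = D * E'" using prime_poly_nonzero[OF P] mult_cancel_left by blast
      then show ?thesis using Suc.IH by simp
    next
      case False
      have "coprime (P ^ l) E" for l
        using False prime_poly_coprime_iff[OF P]
        by (induction l) (auto intro: coprime_poly_mult_left)
      then have "P ^ Suc n dvd D"
        using coprime_poly_dvd_mult[of "P ^ Suc n" E D] E by (metis dvd_refl mult.commute)
      moreover have "monic_poly (P ^ Suc n)" using P by (intro monic_poly_power) (simp add: prime_poly_def)
      ultimately show ?thesis using monic_dvd_antisym[OF that(1)] Suc.prems by blast
    qed
  qed
  have prod_powers: "prod_list (map (\<lambda>i. P ^ i) l) = P ^ sum_list l" for l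
    by (induction l) (auto simp: power_add)
  have inj: "inj (\<lambda>i. P ^ i)"
  proof (rule injI)
    fix i j assume "P ^ i = P ^ j"
    then have "i * degree P = j * degree P" using degree_power_eq prime_poly_nonzero[OF P] by metis
    then show "i = j" using prime_poly_degree_pos[OF P] by simp
  qed
  have "{xs. length xs = k \<and> (\<forall>x\<in>set xs. monic_poly x) \<and> prod_list xs = P ^ m}
      = map (\<lambda>i. P ^ i) ` {l. length l = k \<and> sum_list l = m}"
  proof (intro equalityI subsetI)
    fix xs assume xs: "xs \<in> {xs. length xs = k \<and> (\<forall>x\<in>set xs. monic_poly x) \<and> prod_list xs = P ^ m}"
    have "\<exists>i. x = P ^ i" if "x \<in> set xs" for x
    proof (rule monic_dvd)
      have "x dvd prod_list xs" using that by (induction xs) auto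
      then show "x dvd P ^ m" using xs by simp
    qed (use xs that in auto)
    then obtain e where e: "\<And>x. x \<in> set xs \<Longrightarrow> x = P ^ e x" by metis
    have xse: "xs = map (\<lambda>i. P ^ i) (map e xs)"
      using e by (auto simp: o_def intro!: map_idI [symmetric])
    then have "P ^ m = P ^ sum_list (map e xs)" using prod_powers[of "map e xs"] xs by simp
    then have "sum_list (map e xs) = m" using inj by (simp add: inj_eq)
    then show "xs \<in> map (\<lambda>i. P ^ i) ` {l. length l = k \<and> sum_list l = m}"
      using xse xs by (intro image_eqI[of _ _ "map e xs"]) auto
  next
    fix xs assume "xs \<in> map (\<lambda>i. P ^ i) ` {l. length l = k \<and> sum_list l = m}"
    then show "xs \<in> {xs. length xs = k \<and> (\<forall>x\<in>set xs. monic_poly x) \<and> prod_list xs = P ^ m}"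
      using P by (auto simp: prod_powers prime_poly_def intro: monic_poly_power)
  qed
  then have "dk k (P ^ m) = card {l :: nat list. length l = k \<and> sum_list l = m}"
    unfolding dk_def using card_image[OF inj_on_subset[OF inj_mapI[OF inj] subset_UNIV]] by simp
  also have "\<dots> = (m + k - 1) choose m" by (rule card_length_sum_list)
  finally show ?thesis by (simp add: mchoose_def)
qed

section \<open>Complete and truncated local factors\<close>

definition full_series :: "nat \<Rightarrow> real \<Rightarrow> real" where
  "full_series k y = (\<Sum>j. mchoose k j ^ 2 * y ^ j)"

text \<open>At \<open>y = 1 / |P|\<close> and \<open>M = X div degree P\<close>, the factor at
  \<open>P\<close> of the diagonal of the moment; \<open>full_series\<close> is the corresponding
  factor in the theorem.\<close>

definition trunc_series :: "nat \<Rightarrow> nat \<Rightarrow> real \<Rightarrow> real" where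
  "trunc_series k M y = (\<Sum>j. trunc_coeff k M j ^ 2 * y ^ j)"

lemma locfac_prime:
  fixes P :: "'a::{field,finite} poly"
  assumes "prime_poly P" "k > 0"
  shows "locfac k P = full_series k (1 / pabs P)"
  unfolding locfac_def full_series_def
  by (simp add: dk_prime_power[OF assms] power_one_over field_simps)

lemma summable_trunc_sq:
  assumes "k > 0" "0 \<le> y" "y < 1"
  shows "summable (\<lambda>j. trunc_coeff k M j ^ 2 * y ^ j)"
proof (rule summable_comparison_test'[OF summable_mchoose_sq[OF assms]])
  fix j :: nat
  show "norm (trunc_coeff k M j ^ 2 * y ^ j) \<le> mchoose k j ^ 2 * y ^ j"
    using assms by (simp add: mult_right_mono power_mono trunc_coeff_le trunc_coeff_nonneg)
qed

lemma trunc_series_ge_1: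
  assumes "k > 0" "0 \<le> y" "y < 1"
  shows "trunc_series k M y \<ge> 1"
  using sum_le_suminf[OF summable_trunc_sq[OF assms, of M], of "{0}"] assms
  by (simp add: trunc_series_def)

lemma trunc_series_le:
  assumes "k > 0" "0 \<le> y" "y < 1"
  shows "trunc_series k M y \<le> full_series k y"
  unfolding trunc_series_def full_series_def
  using assms by (intro suminf_le summable_trunc_sq summable_mchoose_sq)
    (auto intro!: mult_right_mono power_mono trunc_coeff_le trunc_coeff_nonneg)

lemma full_series_ge_1:
  assumes "k > 0" "0 \<le> y" "y < 1"
  shows "full_series k y \<ge> 1"
  using trunc_series_ge_1[OF assms] trunc_series_le[OF assms] order_trans by blast

definition tail_const :: "nat \<Rightarrow> real" where
  "tail_const k = full_series k (2 powr (-1/4))"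

lemma tail_const_pos: "k > 0 \<Longrightarrow> tail_const k \<ge> 1"
  unfolding tail_const_def by (intro full_series_ge_1) (auto simp: powr_less_one)

text \<open>In the tail the exponent \<open>j * degree P\<close> is at least \<open>X\<close>, at
  least \<open>2 * degree P\<close> (as \<open>j > M \<ge> 1\<close>) and at least \<open>j\<close>.
  Taking these with weights 1/8, 5/8 and 1/4, which add up to 1, splits off a factor vanishing with
  \<open>X\<close>, a factor \<open>|P| ^ (-5/4)\<close> that is summable over primes, and a factor
  that makes the series in \<open>j\<close> converge to \<open>tail_const k\<close>.\<close>

lemma tail_bound:
  fixes P :: "'a::{field,finite} poly"
  assumes k: "k > 0" and P: "prime_poly P" "degree P \<le> X" and M: "M = X div degree P"
  shows "summable (\<lambda>j. if j > M then mchoose k j ^ 2 / pabs P ^ j else 0)"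
    "(\<Sum>j. if j > M then mchoose k j ^ 2 / pabs P ^ j else 0)
      \<le> tail_const k * (real CARD('a) powr (- real X / 8) * pabs P powr (-5/4))"
proof -
  let ?q = "real CARD('a)" and ?n = "degree P"
  let ?f = "\<lambda>j. if j > M then mchoose k j ^ 2 / pabs P ^ j else 0"
  let ?c = "?q powr (- real X / 8) * pabs P powr (-5/4)"
  let ?g = "\<lambda>j. ?c * (mchoose k j ^ 2 * (2 powr (-1/4)) ^ j)"
  have q: "?q \<ge> 2" using card_field_ge_2[where 'a='a] by simp
  have n: "?n \<ge> 1" using prime_poly_degree_pos[OF P(1)] by simp
  have sg: "summable (\<lambda>j. mchoose k j ^ 2 * (2 powr (-1/4) :: real) ^ j)"
    by (rule summable_mchoose_sq[OF k]) (auto simp: powr_less_one)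
  have pw: "pabs P = ?q powr real ?n" using q by (simp add: pabs_def powr_realpow)
  have le: "?f j \<le> ?g j" for j
  proof (cases "j > M")
    case True
    have "X div ?n < j" using True M by simp
    then have "X < j * ?n" using n by (simp add: div_less_iff_less_mult)
    then have 1: "real X \<le> real j * real ?n" by (simp only: of_nat_mult [symmetric] of_nat_le_iff)
    have "M \<ge> 1" using M P(2) n by (simp add: Suc_le_eq div_greater_zero_iff)
    then have "2 * ?n \<le> j * ?n" using True by (intro mult_right_mono) auto
    then have 2: "2 * real ?n \<le> real j * real ?n"
      by (metis of_nat_le_iff of_nat_mult of_nat_numeral)
    have "real j * 1 \<le> real j * real ?n" using n by (intro mult_left_mono) auto
    then have ex: "- (real j * real ?n) \<le> - real X / 8 + real ?n * (-5/4) + (-1/4) * real j"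
      using 1 2 by linarith
    have "1 / pabs P ^ j = ?q powr (- (real j * real ?n))"
      unfolding pw using q by (simp add: powr_realpow [symmetric] powr_powr powr_minus_divide mult.commute)
    also have "\<dots> \<le> ?q powr (- real X / 8 + real ?n * (-5/4) + (-1/4) * real j)"
      using ex q by (intro powr_mono) auto
    also have "\<dots> = ?c * ?q powr ((-1/4) * real j)" unfolding pw powr_powr powr_add ..
    also have "?q powr ((-1/4) * real j) \<le> 2 powr ((-1/4) * real j)"
      using q by (intro powr_mono2') auto
    also have "2 powr ((-1/4) * real j) = (2 powr (-1/4)) ^ j"
      unfolding powr_powr [symmetric] by (rule powr_realpow) simp
    finally have "1 / pabs P ^ j \<le> ?c * (2 powr (-1/4)) ^ j" by (simp add: mult_left_mono)
    then have "mchoose k j ^ 2 * (1 / pabs P ^ j) \<le> mchoose k j ^ 2 * (?c * (2 powr (-1/4)) ^ j)"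
      by (intro mult_left_mono) auto
    then show ?thesis using True by (simp add: mult_ac)
  qed auto
  have f0: "?f j \<ge> 0" for j using pabs_pos[of P] by auto
  show sf: "summable ?f"
    by (rule summable_comparison_test'[OF summable_mult[OF sg, of ?c], of 0]) (use le f0 in auto)
  have "(\<Sum>j. ?f j) \<le> (\<Sum>j. ?g j)" using le sf summable_mult[OF sg] by (intro suminf_le)
  also have "\<dots> = ?c * tail_const k"
    unfolding tail_const_def full_series_def by (rule suminf_mult[OF sg])
  finally show "(\<Sum>j. ?f j) \<le> tail_const k * ?c" by (simp only: mult.commute)
qed

lemma one_div_pabs:
  fixes P :: "'a::{field,finite} poly"
  assumes "prime_poly P"
  shows "0 < 1 / pabs P" "1 / pabs P \<le> 1/2" "1 / pabs P < 1"
  using pabs_ge_2[OF assms] by (auto simp: field_simps)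

lemma full_minus_trunc_le:
  fixes P :: "'a::{field,finite} poly"
  assumes k: "k > 0" and P: "prime_poly P" "degree P \<le> X"
  shows "full_series k (1 / pabs P) - trunc_series k (X div degree P) (1 / pabs P)
    \<le> tail_const k * (real CARD('a) powr (- real X / 8) * pabs P powr (-5/4))"
proof -
  define M where "M = X div degree P"
  let ?y = "1 / pabs P"
  have y: "0 \<le> ?y" "?y < 1" using one_div_pabs[OF P(1)] by auto
  have "full_series k ?y - trunc_series k M ?y
      = (\<Sum>j. mchoose k j ^ 2 * ?y ^ j - trunc_coeff k M j ^ 2 * ?y ^ j)"
    unfolding full_series_def trunc_series_def
    by (rule suminf_diff[OF summable_mchoose_sq[OF k y] summable_trunc_sq[OF k y]])
  also have "\<dots> \<le> (\<Sum>j. if j > M then mchoose k j ^ 2 / pabs P ^ j else 0)"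
  proof (rule suminf_le)
    fix j
    show "mchoose k j ^ 2 * ?y ^ j - trunc_coeff k M j ^ 2 * ?y ^ j \<le> (if j > M then mchoose k j ^ 2 / pabs P ^ j else 0)"
      using trunc_coeff_eq[OF k, of j M] y by (auto simp: power_one_over)
  qed (use summable_mchoose_sq[OF k y] summable_trunc_sq[OF k y] tail_bound(1)[OF k P M_def] in \<open>auto intro: summable_diff\<close>)
  also have "\<dots> \<le> tail_const k * (real CARD('a) powr (- real X / 8) * pabs P powr (-5/4))"
    by (rule tail_bound(2)[OF k P M_def])
  finally show ?thesis by (simp add: M_def)
qed

text \<open>Counting all monic polynomials of degree \<open>n\<close> instead of primes is
  affordable, since the application is to \<open>|P| ^ (-5/4)\<close>.\<close>

lemma sum_primes_le:
  assumes "\<And>n. f n \<ge> 0"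
  shows "(\<Sum>P\<in>(primes_upto X :: 'a::{field,finite} poly set). f (degree P)) \<le> (\<Sum>n\<in>{1..X}. real CARD('a) ^ n * f n)"
proof -
  have "(\<Sum>P\<in>(primes_upto X :: 'a poly set). f (degree P))
      = (\<Sum>n\<in>{1..X}. \<Sum>P\<in>{P\<in>(primes_upto X :: 'a poly set). degree P = n}. f (degree P))"
    by (rule sum.group [symmetric, OF finite_primes_upto])
      (auto simp: primes_upto_def Suc_le_eq dest: prime_poly_degree_pos)
  also have "\<dots> \<le> (\<Sum>n\<in>{1..X}. real CARD('a) ^ n * f n)"
  proof (rule sum_mono)
    fix n
    have "(\<Sum>P\<in>{P\<in>(primes_upto X :: 'a poly set). degree P = n}. f (degree P))
        = real (card {P\<in>(primes_upto X :: 'a poly set). degree P = n}) * f n" by simp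
    also have "card {P\<in>(primes_upto X :: 'a poly set). degree P = n} \<le> card (monics n :: 'a poly set)"
      by (intro card_mono finite_monics) (auto simp: monics_def primes_upto_def prime_poly_def)
    then have "real (card {P\<in>(primes_upto X :: 'a poly set). degree P = n}) * f n \<le> real CARD('a) ^ n * f n"
      using assms by (intro mult_right_mono) (simp_all add: card_monics flip: of_nat_power)
    finally show "(\<Sum>P\<in>{P\<in>(primes_upto X :: 'a poly set). degree P = n}. f (degree P)) \<le> real CARD('a) ^ n * f n" .
  qed
  finally show ?thesis .
qed

lemma geometric_powr_sum_le:
  assumes "(q::real) \<ge> 2"
  shows "(\<Sum>n\<in>{1..X}. q powr (- real n / 4)) \<le> 1 / (1 - 2 powr (-1/4))"
proof -
  have "(\<Sum>n\<in>{1..X}. q powr (- real n / 4)) \<le> (\<Sum>n\<in>{1..X}. (2 powr (-1/4)) ^ n)"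
  proof (rule sum_mono)
    fix n
    have "q powr (- real n / 4) \<le> 2 powr (- real n / 4)" using assms by (intro powr_mono2') auto
    also have "\<dots> = (2 powr (-1/4)) powr real n" by (simp add: powr_powr)
    finally show "q powr (- real n / 4) \<le> (2 powr (-1/4)) ^ n" by (simp add: powr_realpow)
  qed
  also have "\<dots> \<le> (\<Sum>n. (2 powr (-1/4)) ^ n)"
    by (intro sum_le_suminf summable_geometric) (auto simp: powr_less_one)
  also have "\<dots> = 1 / (1 - 2 powr (-1/4))" by (intro suminf_geometric) (auto simp: powr_less_one)
  finally show ?thesis .
qed

definition tail_error :: "nat \<Rightarrow> nat \<Rightarrow> nat \<Rightarrow> real" where
  "tail_error q k X = tail_const k * (real q powr (- real X / 8) / (1 - 2 powr (-1/4)))"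

lemma tail_error_tendsto: "q \<ge> 2 \<Longrightarrow> tail_error q k \<longlonglongrightarrow> 0"
proof -
  assume "q \<ge> 2"
  then have "real q > 1" by simp
  then have "(\<lambda>X. real q powr (- real X / 8)) \<longlonglongrightarrow> 0" by real_asymp
  then have "(\<lambda>X. tail_const k * (real q powr (- real X / 8) / (1 - 2 powr (-1/4)))) \<longlonglongrightarrow> tail_const k * (0 / (1 - 2 powr (-1/4)))"
    by (intro tendsto_intros) (auto simp: powr_less_one less_imp_neq)
  then show ?thesis unfolding tail_error_def by simp
qed

lemma sum_tail_le:
  assumes "k > 0"
  shows "(\<Sum>P\<in>(primes_upto X :: 'a::{field,finite} poly set).
      tail_const k * (real CARD('a) powr (- real X / 8) * pabs P powr (-5/4))) \<le> tail_error CARD('a) k X"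
proof -
  let ?q = "real CARD('a)"
  have q: "?q \<ge> 2" using card_field_ge_2[where 'a='a] by simp
  have "(\<Sum>P\<in>(primes_upto X :: 'a poly set). pabs P powr (-5/4)) \<le> (\<Sum>n\<in>{1..X}. ?q ^ n * (?q ^ n) powr (-5/4))"
    unfolding pabs_def by (rule sum_primes_le) simp
  also have "\<dots> = (\<Sum>n\<in>{1..X}. ?q powr (- real n / 4))"
  proof (rule sum.cong[OF refl])
    fix n
    have "?q ^ n * (?q ^ n) powr (-5/4) = ?q powr real n * ?q powr (real n * (-5/4))"
      using q by (simp add: powr_realpow [symmetric] powr_powr)
    also have "\<dots> = ?q powr (- real n / 4)" by (simp add: powr_add [symmetric])
    finally show "?q ^ n * (?q ^ n) powr (-5/4) = ?q powr (- real n / 4)" .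
  qed
  also have "\<dots> \<le> 1 / (1 - 2 powr (-1/4))" by (rule geometric_powr_sum_le[OF q])
  finally have "(\<Sum>P\<in>(primes_upto X :: 'a poly set). pabs P powr (-5/4)) \<le> 1 / (1 - 2 powr (-1/4))" .
  then have "tail_const k * (?q powr (- real X / 8) * (\<Sum>P\<in>(primes_upto X :: 'a poly set). pabs P powr (-5/4)))
      \<le> tail_const k * (?q powr (- real X / 8) * (1 / (1 - 2 powr (-1/4))))"
    using tail_const_pos[OF assms] by (intro mult_left_mono) auto
  then show ?thesis by (simp add: tail_error_def sum_distrib_left)
qed

text \<open>The relative deficits of the factors are summable over primes, and a product of terms
  \<open>1 - e\<close> is at least 1 minus the sum of the \<open>e\<close>. The bound is uniform in
  \<open>S\<close>, as it must be: \<open>S\<close> will depend on \<open>R\<close>.\<close>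

lemma trunc_product_ratio:
  fixes S :: "'a::{field,finite} poly set"
  assumes k: "k > 0" and S: "S \<subseteq> primes_upto X"
  defines "Q \<equiv> (\<Prod>P\<in>S. trunc_series k (X div degree P) (1 / pabs P) / full_series k (1 / pabs P))"
  shows "1 - tail_error CARD('a) k X \<le> Q" "Q \<le> 1"
proof -
  let ?G = "\<lambda>P::'a poly. trunc_series k (X div degree P) (1 / pabs P)" and ?L = "\<lambda>P::'a poly. full_series k (1 / pabs P)"
  define e where "e P = 1 - ?G P / ?L P" for P
  let ?b = "\<lambda>P::'a poly. tail_const k * (real CARD('a) powr (- real X / 8) * pabs P powr (-5/4))"
  have e: "0 \<le> e P \<and> e P \<le> 1 \<and> e P \<le> ?b P" if "P \<in> S" for P
  proof -
    have P: "prime_poly P" "degree P \<le> X" using that S by (auto simp: primes_upto_def)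
    have y: "0 \<le> 1 / pabs P" "1 / pabs P < 1" using one_div_pabs[OF P(1)] by auto
    note 1 = trunc_series_ge_1[OF k y, of "X div degree P"] and 2 = trunc_series_le[OF k y, of "X div degree P"]
    have L: "?L P \<ge> 1" using 1 2 by linarith
    have "e P = (?L P - ?G P) / ?L P" using L by (simp add: e_def diff_divide_distrib)
    also have "\<dots> \<le> ?L P - ?G P" using L 2 by (simp add: divide_le_eq mult_le_cancel_left1)
    also have "\<dots> \<le> ?b P" by (rule full_minus_trunc_le[OF k P])
    finally have "e P \<le> ?b P" .
    moreover have "0 \<le> ?G P / ?L P" "?G P / ?L P \<le> 1" using 1 2 L by (auto simp: divide_le_eq_1)
    ultimately show ?thesis by (simp add: e_def)
  qed
  have Q: "Q = (\<Prod>P\<in>S. 1 - e P)" by (simp add: Q_def e_def)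
  have "(\<Sum>P\<in>S. e P) \<le> (\<Sum>P\<in>S. ?b P)" using e by (intro sum_mono) auto
  also have "\<dots> \<le> (\<Sum>P\<in>primes_upto X. ?b P)"
    using S tail_const_pos[OF k] by (intro sum_mono2 finite_primes_upto) auto
  also have "\<dots> \<le> tail_error CARD('a) k X" by (rule sum_tail_le[OF k])
  finally have "(\<Sum>P\<in>S. e P) \<le> tail_error CARD('a) k X" .
  moreover have "1 - (\<Sum>P\<in>S. e P) \<le> (\<Prod>P\<in>S. 1 - e P)"
    using e by (intro Weierstrass_prod_ineq) auto
  ultimately show "1 - tail_error CARD('a) k X \<le> Q" unfolding Q by linarith
  show "Q \<le> 1" unfolding Q using e by (intro prod_le_1) auto
qed

section \<open>Convergence of a(k) and Mertens' third theorem\<close>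

text \<open>The linear terms cancel, because \<open>mchoose k 1 = k\<close> makes the series start
  with \<open>1 + k ^ 2 * x\<close>. What remains is quadratic in \<open>1 / |P|\<close>, hence
  summable over primes.\<close>

lemma ln_euler_factor_bound:
  assumes k: "k > 0"
  shows "\<exists>E. \<forall>x. 0 < x \<and> x \<le> 1/2 \<longrightarrow> \<bar>real (k ^ 2) * ln (1 - x) + ln (full_series k x)\<bar> \<le> E * x ^ 2"
proof -
  \<comment> \<open>For \<open>x \<le> 1/2\<close> one has
    \<open>x ^ (j + 2) \<le> 4 * x ^ 2 * (1/2) ^ (j + 2)\<close>, so \<open>D * x ^ 2\<close>
    dominates the series beyond its linear term.\<close>
  define D where "D = 4 * full_series k (1/2)"
  define K where "K = real (k ^ 2)"
  have K0: "K \<ge> 0" by (simp add: K_def)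
  have "\<bar>K * ln (1 - x) + ln (full_series k x)\<bar> \<le> (D + 2 * K + K ^ 2) * x ^ 2"
    if x: "0 < x" "x \<le> 1/2" for x
  proof -
    have sm: "summable (\<lambda>j. mchoose k j ^ 2 * x ^ j)" "summable (\<lambda>j. mchoose k j ^ 2 * (1/2) ^ j)"
      using x by (auto intro!: summable_mchoose_sq[OF k])
    have split: "full_series k x = 1 + K * x + (\<Sum>j. mchoose k (j + 2) ^ 2 * x ^ (j + 2))"
      unfolding full_series_def using suminf_split_initial_segment[OF sm(1), of 2] mchoose_1[OF k]
      by (simp add: numeral_2_eq_2 K_def power2_eq_square)
    have rest0: "(\<Sum>j. mchoose k (j + 2) ^ 2 * x ^ (j + 2)) \<ge> 0"
      using x sm(1) by (intro suminf_nonneg) (simp_all only: summable_iff_shift[of "\<lambda>j. mchoose k j ^ 2 * x ^ j" 2], simp)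
    have sm2: "summable (\<lambda>j. mchoose k (j + 2) ^ 2 * (1/2) ^ (j + 2))"
      using sm(2) by (simp only: summable_iff_shift[of "\<lambda>j. mchoose k j ^ 2 * (1/2) ^ j" 2])
    have "(\<Sum>j. mchoose k (j + 2) ^ 2 * x ^ (j + 2)) \<le> (\<Sum>j. 4 * x ^ 2 * (mchoose k (j + 2) ^ 2 * (1/2) ^ (j + 2)))"
    proof (rule suminf_le)
      fix j
      have "x ^ (j + 2) = x ^ 2 * x ^ j" by (simp add: power_add power2_eq_square)
      also have "\<dots> \<le> x ^ 2 * (1/2) ^ j" using x by (intro mult_left_mono power_mono) auto
      finally have "x ^ (j + 2) \<le> x ^ 2 * (1/2) ^ j" .
      then have "mchoose k (j + 2) ^ 2 * x ^ (j + 2) \<le> mchoose k (j + 2) ^ 2 * (x ^ 2 * (1/2) ^ j)"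
        by (intro mult_left_mono) auto
      then show "mchoose k (j + 2) ^ 2 * x ^ (j + 2) \<le> 4 * x ^ 2 * (mchoose k (j + 2) ^ 2 * (1/2) ^ (j + 2))"
        by (simp add: power_add power2_eq_square mult_ac)
    qed (use sm(1) sm2 in \<open>auto simp only: summable_iff_shift[of "\<lambda>j. mchoose k j ^ 2 * x ^ j" 2] intro!: summable_mult\<close>)
    also have "\<dots> = 4 * x ^ 2 * (\<Sum>j. mchoose k (j + 2) ^ 2 * (1/2) ^ (j + 2))"
      by (rule suminf_mult[OF sm2])
    also have "(\<Sum>j. mchoose k (j + 2) ^ 2 * (1/2) ^ (j + 2)) \<le> full_series k (1/2)"
      unfolding full_series_def using suminf_split_initial_segment[OF sm(2), of 2]
      by (simp add: numeral_2_eq_2)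
    finally have rest: "(\<Sum>j. mchoose k (j + 2) ^ 2 * x ^ (j + 2)) \<le> D * x ^ 2"
      using mult_left_mono[of _ _ "4 * x ^ 2"] by (simp add: D_def mult_ac)
    have Kx: "K * x \<ge> 0" using K0 x by simp
    have Lpos: "full_series k x > 0" using split rest0 Kx by linarith
    have "ln (full_series k x) \<le> full_series k x - 1" using Lpos by (rule ln_le_minus_one)
    then have up1: "ln (full_series k x) \<le> K * x + D * x ^ 2" using split rest by linarith
    have "ln (1 - x) \<le> - x" using x by (intro ln_one_minus_pos_upper_bound) auto
    then have up2: "K * ln (1 - x) \<le> - (K * x)" using mult_left_mono[OF _ K0] by fastforce
    have "- x - 2 * x\<^sup>2 \<le> ln (1 - x)" using x by (intro ln_one_minus_pos_lower_bound) auto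
    then have lo2: "K * (- x - 2 * x\<^sup>2) \<le> K * ln (1 - x)" using K0 by (rule mult_left_mono)
    \<comment> \<open>Uses \<open>ln (1 + u) \<ge> u / (1 + u) \<ge> u - u ^ 2\<close> with
      \<open>u = K * x\<close>, after the nonnegative remainder of the series is dropped.\<close>
    have lo1: "K * x - K ^ 2 * x ^ 2 \<le> ln (full_series k x)"
    proof -
      have "ln (1 / (1 + K * x)) \<le> 1 / (1 + K * x) - 1" using Kx by (intro ln_le_minus_one) simp
      then have "1 - 1 / (1 + K * x) \<le> ln (1 + K * x)" using Kx by (simp add: ln_div)
      moreover have "K * x - K ^ 2 * x ^ 2 \<le> 1 - 1 / (1 + K * x)"
      proof -
        have "(K * x - (K * x) ^ 2) * (1 + K * x) \<le> K * x"
          using zero_le_power[OF Kx, of 3] by (simp add: algebra_simps power2_eq_square power3_eq_cube)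
        then have "K * x - (K * x) ^ 2 \<le> K * x / (1 + K * x)" using Kx by (simp add: pos_le_divide_eq)
        also have "\<dots> = 1 - 1 / (1 + K * x)" using Kx by (simp add: field_simps)
        finally show ?thesis by (simp add: power_mult_distrib)
      qed
      moreover have "ln (1 + K * x) \<le> ln (full_series k x)" using split rest0 Kx by (subst ln_le_cancel_iff) auto
      ultimately show ?thesis by linarith
    qed
    have D0: "0 \<le> D * x ^ 2" using rest rest0 by linarith
    have nn: "0 \<le> K * x ^ 2" "0 \<le> K ^ 2 * x ^ 2" using K0 by auto
    have ex: "(D + 2 * K + K ^ 2) * x ^ 2 = D * x ^ 2 + 2 * (K * x ^ 2) + K ^ 2 * x ^ 2"
      "K * (- x - 2 * x\<^sup>2) = - (K * x) - 2 * (K * x ^ 2)" by (simp_all add: algebra_simps)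
    show ?thesis unfolding ex abs_le_iff using up1 up2 lo1 lo2 D0 nn unfolding ex by linarith
  qed
  then show ?thesis unfolding K_def by blast
qed

text \<open>At most \<open>q ^ n\<close> primes of degree \<open>n\<close> contribute logarithms of
  size \<open>q ^ (- 2 n)\<close> each, so the logarithms, grouped by degree, form an absolutely
  convergent series. The limit is then an exponential, hence positive, and can serve as a
  denominator.\<close>

lemma a_const_limit:
  assumes k: "k > 0"
  shows "a_const TYPE('a::{field,finite}) k > 0"
    "(\<lambda>N. \<Prod>P\<in>(primes_upto N :: 'a poly set). (1 - 1 / pabs P) ^ (k ^ 2) * full_series k (1 / pabs P))
      \<longlonglongrightarrow> a_const TYPE('a) k"
proof -
  let ?q = "real CARD('a)"
  have q: "?q \<ge> 2" using card_field_ge_2[where 'a='a] by simp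
  define f where "f P = (1 - 1 / pabs P) ^ (k ^ 2) * full_series k (1 / pabs P)" for P :: "'a poly"
  define t where "t n = (\<Sum>P\<in>{P. prime_poly P \<and> degree P = n}. ln (f P))" for n
  obtain E where E: "\<And>x. 0 < x \<Longrightarrow> x \<le> 1/2 \<Longrightarrow> \<bar>real (k ^ 2) * ln (1 - x) + ln (full_series k x)\<bar> \<le> E * x ^ 2"
    using ln_euler_factor_bound[OF k] by blast
  have f: "f P > 0 \<and> \<bar>ln (f P)\<bar> \<le> E * (1 / pabs P) ^ 2" if P: "prime_poly P" for P
  proof -
    note x = one_div_pabs[OF P]
    have pos: "0 < 1 - 1 / pabs P" "0 < full_series k (1 / pabs P)"
      using x full_series_ge_1[OF k, of "1 / pabs P"] by auto
    then have "ln (f P) = real (k ^ 2) * ln (1 - 1 / pabs P) + ln (full_series k (1 / pabs P))"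
      unfolding f_def by (subst ln_mult_pos) (auto simp: ln_realpow)
    then show ?thesis using E[OF x(1,2)] pos by (simp add: f_def)
  qed
  have t: "norm (t n) \<le> \<bar>E\<bar> * (1/2) ^ n" for n
  proof -
    have sub: "{P. prime_poly P \<and> degree P = n} \<subseteq> (monics n :: 'a poly set)"
      by (auto simp: monics_def prime_poly_def)
    have "norm (t n) \<le> (\<Sum>P\<in>{P :: 'a poly. prime_poly P \<and> degree P = n}. \<bar>E\<bar> / ?q ^ (2 * n))"
      unfolding t_def
    proof (rule sum_norm_le)
      fix P :: "'a poly" assume "P \<in> {P. prime_poly P \<and> degree P = n}"
      then have P: "prime_poly P" "degree P = n" by auto
      have "\<bar>ln (f P)\<bar> \<le> E * (1 / pabs P) ^ 2" using f[OF P(1)] by simp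
      also have "\<dots> \<le> \<bar>E\<bar> * (1 / pabs P) ^ 2" by (intro mult_right_mono) auto
      also have "\<dots> = \<bar>E\<bar> / ?q ^ (2 * n)" by (simp add: pabs_def P(2) power_one_over power_mult mult.commute[of 2])
      finally show "norm (ln (f P)) \<le> \<bar>E\<bar> / ?q ^ (2 * n)" by simp
    qed
    also have "\<dots> = real (card {P :: 'a poly. prime_poly P \<and> degree P = n}) * (\<bar>E\<bar> / ?q ^ (2 * n))" by simp
    also have "\<dots> \<le> ?q ^ n * (\<bar>E\<bar> / ?q ^ (2 * n))"
    proof (rule mult_right_mono)
      have "card {P :: 'a poly. prime_poly P \<and> degree P = n} \<le> CARD('a) ^ n"
        using card_mono[OF finite_monics sub] by (simp add: card_monics)
      then show "real (card {P :: 'a poly. prime_poly P \<and> degree P = n}) \<le> ?q ^ n"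
        by (simp flip: of_nat_power)
    qed simp
    also have "\<dots> = \<bar>E\<bar> * (1 / ?q) ^ n"
      using q by (simp add: mult_2 power_add power_one_over)
    also have "\<dots> \<le> \<bar>E\<bar> * (1/2) ^ n"
      using q by (intro mult_left_mono power_mono) (auto simp: field_simps)
    finally show ?thesis .
  qed
  have "summable (\<lambda>n. \<bar>E\<bar> * (1/2) ^ n)" by (intro summable_mult summable_geometric) simp
  then have "summable t" by (rule summable_comparison_test') (use t in blast)
  then have lim: "(\<lambda>N. \<Sum>n<Suc N. t n) \<longlonglongrightarrow> suminf t"
    using LIMSEQ_Suc[OF summable_LIMSEQ] by blast
  have "(\<Prod>P\<in>(primes_upto N :: 'a poly set). f P) = exp (\<Sum>n<Suc N. t n)" for N
  proof -
    have "(\<Sum>n<Suc N. t n) = (\<Sum>n\<in>{..<Suc N}. \<Sum>P\<in>{P\<in>(primes_upto N :: 'a poly set). degree P = n}. ln (f P))"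
      unfolding t_def by (intro sum.cong refl) (auto simp: primes_upto_def)
    also have "\<dots> = (\<Sum>P\<in>(primes_upto N :: 'a poly set). ln (f P))"
      by (rule sum.group[OF finite_primes_upto]) (auto simp: primes_upto_def)
    finally have "exp (\<Sum>n<Suc N. t n) = (\<Prod>P\<in>(primes_upto N :: 'a poly set). exp (ln (f P)))"
      by (simp add: exp_sum finite_primes_upto)
    also have "\<dots> = (\<Prod>P\<in>(primes_upto N :: 'a poly set). f P)"
      using f by (intro prod.cong refl exp_ln) (auto simp: primes_upto_def)
    finally show ?thesis by simp
  qed
  then have L: "(\<lambda>N. \<Prod>P\<in>(primes_upto N :: 'a poly set). f P) \<longlonglongrightarrow> exp (suminf t)"
    using tendsto_exp[OF lim] by simp
  have "(\<Prod>P\<in>(primes_upto N :: 'a poly set). f P)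
      = (\<Prod>P\<in>{P::'a poly. prime_poly P \<and> degree P \<le> N}. (1 - 1 / pabs P) ^ (k ^ 2) * locfac k P)" for N
    unfolding f_def by (intro prod.cong) (auto simp: primes_upto_def locfac_prime k)
  then have "a_const TYPE('a) k = exp (suminf t)"
    using L unfolding a_const_def by (simp add: limI)
  then show "a_const TYPE('a) k > 0" "(\<lambda>N. \<Prod>P\<in>(primes_upto N :: 'a poly set). (1 - 1 / pabs P) ^ (k ^ 2) * full_series k (1 / pabs P))
      \<longlonglongrightarrow> a_const TYPE('a) k" using L unfolding f_def by simp_all
qed

text \<open>Cutting the logarithmic series of each prime at \<open>m * degree P \<le> X\<close>
  leaves exactly the harmonic number of \<open>X\<close>, by the prime polynomial theorem; the
  cut-off parts are at most \<open>tail_error\<close> for \<open>k = 1\<close>. The Euler-Mascheroni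
  constant enters as the limit of harmonic number minus logarithm.\<close>

lemma mertens_third:
  "(\<lambda>X. (\<Prod>P\<in>(primes_upto X :: 'a::{field,finite} poly set). inverse (1 - 1 / pabs P)) / (exp euler_mascheroni * real X))
    \<longlonglongrightarrow> 1"
proof -
  let ?q = "real CARD('a)"
  have q: "?q \<ge> 2" using card_field_ge_2[where 'a='a] by simp
  define s where "s X = (\<Sum>P\<in>(primes_upto X :: 'a poly set). - ln (1 - 1 / pabs P))" for X
  have bounds: "0 \<le> s X - harm X \<and> s X - harm X \<le> tail_error CARD('a) 1 X" for X
  proof -
    define h where "h P = (\<Sum>m\<in>{1..X div degree P}. (1 / pabs P) ^ m / real m)" for P :: "'a poly"
    have P: "0 \<le> - ln (1 - 1 / pabs P) - h P \<and> - ln (1 - 1 / pabs P) - h P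
        \<le> tail_const 1 * (?q powr (- real X / 8) * pabs P powr (-5/4))" if "P \<in> primes_upto X" for P
    proof -
      have P: "prime_poly P" "degree P \<le> X" using that by (auto simp: primes_upto_def)
      define y where "y = 1 / pabs P"
      define M where "M = X div degree P"
      have y: "0 < y" "y < 1" using one_div_pabs[OF P(1)] by (auto simp: y_def)
      have "(\<lambda>n. - ((- (- y)) ^ n) / real n) sums ln (1 + - y)" using y by (intro ln_series') auto
      then have ls: "(\<lambda>n. y ^ n / real n) sums (- ln (1 - y))" using sums_minus by fastforce
      have hs: "(\<lambda>n. if n \<in> {1..M} then y ^ n / real n else 0) sums h P"
        unfolding h_def y_def M_def by (rule sums_If_finite_set) simp
      have ds: "(\<lambda>n. y ^ n / real n - (if n \<in> {1..M} then y ^ n / real n else 0)) sums (- ln (1 - y) - h P)"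
        by (rule sums_diff[OF ls hs])
      have "0 \<le> - ln (1 - y) - h P"
        by (rule sums_le[OF _ sums_zero ds]) (use y in auto)
      moreover have "- ln (1 - y) - h P \<le> (\<Sum>j. if j > M then mchoose 1 j ^ 2 / pabs P ^ j else 0)"
      proof (rule sums_le[OF _ ds summable_sums[OF tail_bound(1)[OF zero_less_one P M_def]]])
        fix n
        \<comment> \<open>Dropping the denominator allows the reuse of \<open>tail_bound\<close>
          with \<open>k = 1\<close>, where all coefficients are 1. At \<open>n = 0\<close> the term
          is \<open>y ^ 0 / 0\<close>, which is 0.\<close>
        have "y ^ n / real n \<le> y ^ n" if "n \<ge> 1" using that y by (simp add: divide_le_eq mult_le_cancel_left1)
        then show "y ^ n / real n - (if n \<in> {1..M} then y ^ n / real n else 0) \<le> (if n > M then mchoose 1 n ^ 2 / pabs P ^ n else 0)"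
          by (cases "n = 0") (auto simp: y_def power_one_over mchoose_one[unfolded One_nat_def])
      qed
      ultimately show ?thesis using tail_bound(2)[OF zero_less_one P M_def] by (auto simp: y_def)
    qed
    have "(\<Sum>P\<in>(primes_upto X :: 'a poly set). h P)
        = (\<Sum>P\<in>(primes_upto X :: 'a poly set). \<Sum>m\<in>{1..X div degree P}. (1 / ?q ^ (m * degree P)) / real m)"
      unfolding h_def by (intro sum.cong refl) (simp add: pabs_def power_one_over power_mult [symmetric] mult.commute)
    also have "\<dots> = (\<Sum>n\<in>{1..X}. (1 / ?q ^ n) * ?q ^ n / real n)" by (rule sum_prime_powers_radial)
    also have "\<dots> = harm X" unfolding harm_def using q by (intro sum.cong refl) (simp add: inverse_eq_divide)
    finally have hh: "(\<Sum>P\<in>(primes_upto X :: 'a poly set). h P) = harm X" .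
    have "s X - harm X = (\<Sum>P\<in>(primes_upto X :: 'a poly set). - ln (1 - 1 / pabs P) - h P)"
      by (simp add: s_def hh [symmetric] sum_subtractf)
    moreover have "0 \<le> (\<Sum>P\<in>(primes_upto X :: 'a poly set). - ln (1 - 1 / pabs P) - h P)"
      using P by (intro sum_nonneg) blast
    moreover have "(\<Sum>P\<in>(primes_upto X :: 'a poly set). - ln (1 - 1 / pabs P) - h P)
        \<le> (\<Sum>P\<in>(primes_upto X :: 'a poly set). tail_const 1 * (?q powr (- real X / 8) * pabs P powr (-5/4)))"
      using P by (intro sum_mono) blast
    ultimately show ?thesis using sum_tail_le[OF zero_less_one, of X, where 'a='a] by linarith
  qed
  have "(\<lambda>X. s X - harm X) \<longlonglongrightarrow> 0"
  proof (rule tendsto_sandwich[OF _ _ tendsto_const tail_error_tendsto[OF card_field_ge_2[where 'a='a], of 1]])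
    show "\<forall>\<^sub>F X in sequentially. 0 \<le> s X - harm X" using bounds by (intro always_eventually) blast
    show "\<forall>\<^sub>F X in sequentially. s X - harm X \<le> tail_error CARD('a) 1 X" using bounds by (intro always_eventually) blast
  qed
  then have "(\<lambda>X. (s X - harm X) + (harm X - ln (real X)) - euler_mascheroni) \<longlonglongrightarrow> 0 + euler_mascheroni - euler_mascheroni"
    by (intro tendsto_intros euler_mascheroni_LIMSEQ)
  then have "(\<lambda>X. s X - ln (real X) - euler_mascheroni) \<longlonglongrightarrow> 0" by simp
  then have "(\<lambda>X. exp (s X - ln (real X) - euler_mascheroni)) \<longlonglongrightarrow> exp 0" by (rule tendsto_exp)
  moreover have "\<forall>\<^sub>F X in sequentially. exp (s X - ln (real X) - euler_mascheroni)
      = (\<Prod>P\<in>(primes_upto X :: 'a poly set). inverse (1 - 1 / pabs P)) / (exp euler_mascheroni * real X)"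
    using eventually_gt_at_top[of 0]
  proof eventually_elim
    fix X :: nat assume X: "X > 0"
    have "exp (s X) = (\<Prod>P\<in>(primes_upto X :: 'a poly set). exp (- ln (1 - 1 / pabs P)))"
      by (simp add: s_def exp_sum finite_primes_upto)
    also have "\<dots> = (\<Prod>P\<in>(primes_upto X :: 'a poly set). inverse (1 - 1 / pabs P))"
    proof (intro prod.cong refl)
      fix P :: "'a poly" assume "P \<in> primes_upto X"
      then have "0 < 1 - 1 / pabs P" using one_div_pabs(3)[of P] by (auto simp: primes_upto_def)
      then show "exp (- ln (1 - 1 / pabs P)) = inverse (1 - 1 / pabs P)" by (simp only: exp_minus exp_ln)
    qed
    finally show "exp (s X - ln (real X) - euler_mascheroni)
      = (\<Prod>P\<in>(primes_upto X :: 'a poly set). inverse (1 - 1 / pabs P)) / (exp euler_mascheroni * real X)"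
      using X by (simp add: exp_diff mult.commute)
  qed
  ultimately show ?thesis using Lim_transform_eventually by fastforce
qed

section \<open>The moment as diagonal plus error\<close>

lemma has_sum_prod_PiE_nonneg:
  fixes f :: "'i \<Rightarrow> nat \<Rightarrow> real"
  assumes "finite S" "\<And>P j. P \<in> S \<Longrightarrow> f P j \<ge> 0" "\<And>P. P \<in> S \<Longrightarrow> summable (f P)"
    "\<And>P. P \<in> S \<Longrightarrow> suminf (f P) > 0"
  shows "((\<lambda>g. \<Prod>P\<in>S. f P (g P)) has_sum (\<Prod>P\<in>S. suminf (f P))) (PiE S (\<lambda>_. UNIV))"
proof -
  have hs: "(f P has_sum suminf (f P)) UNIV" if "P \<in> S" for P
    using assms(2,3)[OF that] by (intro norm_summable_imp_has_sum summable_sums) auto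
  have "(\<lambda>j. norm (f P j)) summable_on UNIV" if "P \<in> S" for P
    using hs[OF that] assms(2)[OF that] by (auto simp: summable_on_def)
  then have "infsum (\<lambda>g. \<Prod>P\<in>S. f P (g P)) (PiE S (\<lambda>_. UNIV)) = (\<Prod>P\<in>S. infsum (f P) UNIV)"
    by (rule infsum_prod_PiE_abs[OF assms(1)])
  also have "\<dots> = (\<Prod>P\<in>S. suminf (f P))" by (intro prod.cong refl infsumI hs)
  finally have eq: "infsum (\<lambda>g. \<Prod>P\<in>S. f P (g P)) (PiE S (\<lambda>_. UNIV)) = (\<Prod>P\<in>S. suminf (f P))" .
  \<comment> \<open>Summability follows from the value itself: a family that is not summable would
    have \<open>infsum\<close> equal to 0.\<close>
  also have "\<dots> > 0" using assms(4) by (rule prod_pos)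
  finally have "(\<lambda>g. \<Prod>P\<in>S. f P (g P)) summable_on (PiE S (\<lambda>_. UNIV))"
    using infsum_not_exists by fastforce
  then show ?thesis using has_sum_infsum eq by metis
qed

text \<open>Absolute summability is the nonnegative case applied to the norms;
  \<open>f P 0 = 1\<close> provides the positivity of their sums.\<close>

lemma has_sum_prod_PiE_complex:
  fixes f :: "'i \<Rightarrow> nat \<Rightarrow> complex"
  assumes "finite S" "\<And>P. P \<in> S \<Longrightarrow> summable (\<lambda>j. norm (f P j))" "\<And>P. P \<in> S \<Longrightarrow> f P 0 = 1"
  shows "((\<lambda>g. \<Prod>P\<in>S. f P (g P)) has_sum (\<Prod>P\<in>S. suminf (f P))) (PiE S (\<lambda>_. UNIV))"
proof -
  have "((\<lambda>g. \<Prod>P\<in>S. norm (f P (g P))) has_sum (\<Prod>P\<in>S. \<Sum>j. norm (f P j))) (PiE S (\<lambda>_. UNIV))"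
  proof (rule has_sum_prod_PiE_nonneg[OF assms(1) _ assms(2)])
    fix P assume "P \<in> S"
    then show "(\<Sum>j. norm (f P j)) > 0"
      using assms(2,3) by (intro suminf_pos2[of _ 0]) auto
  qed auto
  then have "(\<lambda>g. norm (\<Prod>P\<in>S. f P (g P))) summable_on (PiE S (\<lambda>_. UNIV))"
    by (auto simp: prod_norm summable_on_def)
  then have sm: "(\<lambda>g. \<Prod>P\<in>S. f P (g P)) summable_on (PiE S (\<lambda>_. UNIV))" by (rule abs_summable_summable)
  have "(\<lambda>j. norm (f P j)) summable_on UNIV" if "P \<in> S" for P
    using assms(2)[OF that] by (intro norm_summable_imp_summable_on) simp
  then have "infsum (\<lambda>g. \<Prod>P\<in>S. f P (g P)) (PiE S (\<lambda>_. UNIV)) = (\<Prod>P\<in>S. infsum (f P) UNIV)"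
    by (rule infsum_prod_PiE_abs[OF assms(1)])
  also have "\<dots> = (\<Prod>P\<in>S. suminf (f P))"
  proof (intro prod.cong refl infsumI)
    fix P assume "P \<in> S"
    note sm = assms(2)[OF this]
    show "(f P has_sum suminf (f P)) UNIV"
      by (rule norm_summable_imp_has_sum[OF sm summable_sums[OF summable_norm_cancel[OF sm]]])
  qed
  finally show ?thesis using has_sum_infsum[OF sm] by simp
qed

lemma has_sum_finite_sum:
  fixes f :: "'x \<Rightarrow> 'i \<Rightarrow> complex"
  assumes "finite Y" "\<And>x. x \<in> Y \<Longrightarrow> (f x has_sum s x) I"
  shows "((\<lambda>i. \<Sum>x\<in>Y. f x i) has_sum (\<Sum>x\<in>Y. s x)) I"
  using assms by (induction Y) (auto intro!: has_sum_add)

lemma has_sum_difference: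
  fixes f g :: "'i \<Rightarrow> complex"
  assumes "(f has_sum a) I" "(g has_sum b) I"
  shows "((\<lambda>i. f i - g i) has_sum (a - b)) I"
  using has_sum_add[OF assms(1), of "\<lambda>i. - g i" "- b"] assms(2) by (simp add: has_sum_uminus)

text \<open>The square of the norm is expanded one factor at a time, so that only sums over the
  single index set \<open>I\<close> occur and no double series has to be rearranged. With one factor
  expanded, \<open>T g\<close> differs from its diagonal term by at most \<open>K * v g * W\<close>;
  summing these errors with weights \<open>c g\<close> produces the second \<open>W\<close>.\<close>

lemma second_moment_approx:
  fixes e :: "'x \<Rightarrow> 'i \<Rightarrow> complex" and c v dg :: "'i \<Rightarrow> real"
  defines "\<Phi> \<equiv> \<lambda>Y N g h. (\<Sum>x\<in>Y. e x g * cnj (e x h)) / of_nat N"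
  assumes Y: "finite Y" and N: "N > (0::nat)"
    and F: "\<And>x. x \<in> Y \<Longrightarrow> ((\<lambda>g. of_real (c g) * e x g) has_sum F x) I"
    and c: "\<And>g. g \<in> I \<Longrightarrow> c g \<ge> 0" and v: "\<And>g. g \<in> I \<Longrightarrow> v g \<ge> 0" and K: "K \<ge> 0"
    and W: "((\<lambda>g. c g * v g) has_sum W) I"
    and diag: "\<And>g. g \<in> I \<Longrightarrow> \<Phi> Y N g g = of_real (dg g)"
    and off: "\<And>g h. g \<in> I \<Longrightarrow> h \<in> I \<Longrightarrow> g \<noteq> h \<Longrightarrow> norm (\<Phi> Y N g h) \<le> K * (v g * v h)"
    and D: "((\<lambda>g. c g ^ 2 * dg g) has_sum D) I"
  shows "\<bar>(\<Sum>x\<in>Y. norm (F x) ^ 2) / real N - D\<bar> \<le> K * W ^ 2"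
proof -
  define T where "T g = (\<Sum>x\<in>Y. e x g * cnj (F x)) / of_nat N" for g
  have T: "((\<lambda>h. of_real (c h) * \<Phi> Y N g h) has_sum T g) I" for g
  proof -
    have "((\<lambda>h. e x g * cnj (of_real (c h) * e x h)) has_sum (e x g * cnj (F x))) I" if "x \<in> Y" for x
      using F[OF that] by (intro has_sum_cmult_right) (simp only: has_sum_cnj_iff)
    then have "((\<lambda>h. \<Sum>x\<in>Y. e x g * cnj (of_real (c h) * e x h)) has_sum (\<Sum>x\<in>Y. e x g * cnj (F x))) I"
      by (rule has_sum_finite_sum[OF Y])
    from has_sum_cmult_left[OF this, of "1 / of_nat N"] show ?thesis
      by (simp add: T_def \<Phi>_def sum_distrib_left sum_divide_distrib mult_ac)
  qed
  have T_near: "norm (T g - of_real (c g * dg g)) \<le> K * v g * W" if g: "g \<in> I" for g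
  proof (rule norm_infsum_le)
    \<comment> \<open>The diagonal term is treated as a family supported at \<open>g\<close>;
      subtracting it leaves exactly the terms controlled by \<open>off\<close>.\<close>
    have "((\<lambda>h. if h = g then of_real (c g) * \<Phi> Y N g g else 0) has_sum (of_real (c g) * \<Phi> Y N g g)) {g}"
      using has_sum_finite[of "{g}" "\<lambda>h. if h = g then of_real (c g) * \<Phi> Y N g g else 0"] by simp
    then have "((\<lambda>h. if h = g then of_real (c g) * \<Phi> Y N g g else 0) has_sum (of_real (c g) * \<Phi> Y N g g)) I"
      by (rule has_sum_cong_neutral[THEN iffD1, rotated 3]) (use g in auto)
    then have "((\<lambda>h. of_real (c h) * \<Phi> Y N g h - (if h = g then of_real (c g) * \<Phi> Y N g g else 0)) has_sum
        (T g - of_real (c g) * \<Phi> Y N g g)) I"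
      by (intro has_sum_difference T)
    then show "((\<lambda>h. of_real (c h) * \<Phi> Y N g h - (if h = g then of_real (c g) * \<Phi> Y N g g else 0)) has_sum
        (T g - of_real (c g * dg g))) I"
      by (simp add: diag[OF g])
    show "((\<lambda>h. K * v g * (c h * v h)) has_sum (K * v g * W)) I" by (rule has_sum_cmult_right[OF W])
    fix h assume h: "h \<in> I"
    show "norm (of_real (c h) * \<Phi> Y N g h - (if h = g then of_real (c g) * \<Phi> Y N g g else 0)) \<le> K * v g * (c h * v h)"
    proof (cases "h = g")
      case True
      then show ?thesis using K v[OF g] c[OF g] by simp
    next
      case False
      have "c h * norm (\<Phi> Y N g h) \<le> c h * (K * (v g * v h))"
        using off[OF g h] False c[OF h] by (intro mult_left_mono) auto
      then show ?thesis using False c[OF h] by (simp add: norm_mult mult_ac)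
    qed
  qed
  have "((\<lambda>g. of_real (c g) * e x g * cnj (F x)) has_sum (F x * cnj (F x))) I" if "x \<in> Y" for x
    by (rule has_sum_cmult_left[OF F[OF that]])
  then have "((\<lambda>g. \<Sum>x\<in>Y. of_real (c g) * e x g * cnj (F x)) has_sum (\<Sum>x\<in>Y. F x * cnj (F x))) I"
    by (rule has_sum_finite_sum[OF Y])
  from has_sum_cmult_left[OF this, of "1 / of_nat N"]
  have avg: "((\<lambda>g. of_real (c g) * T g) has_sum ((\<Sum>x\<in>Y. F x * cnj (F x)) / of_nat N)) I"
    by (simp add: T_def sum_distrib_left sum_divide_distrib mult_ac)
  have "((\<lambda>g. complex_of_real (c g ^ 2 * dg g)) has_sum of_real D) I"
    using D by (simp only: has_sum_of_real_iff)
  from has_sum_difference[OF avg this]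
  have diff: "((\<lambda>g. of_real (c g) * (T g - of_real (c g * dg g))) has_sum ((\<Sum>x\<in>Y. F x * cnj (F x)) / of_nat N - of_real D)) I"
    by (simp add: algebra_simps power2_eq_square)
  have "norm ((\<Sum>x\<in>Y. F x * cnj (F x)) / of_nat N - of_real D) \<le> K * W * W"
  proof (rule norm_infsum_le[OF diff has_sum_cmult_right[OF W]])
    fix g assume g: "g \<in> I"
    have "c g * norm (T g - of_real (c g * dg g)) \<le> c g * (K * v g * W)"
      using T_near[OF g] c[OF g] by (intro mult_left_mono) auto
    then show "norm (of_real (c g) * (T g - of_real (c g * dg g))) \<le> K * W * (c g * v g)"
      using c[OF g] by (simp add: norm_mult mult_ac)
  qed
  also have "(\<Sum>x\<in>Y. F x * cnj (F x)) / of_nat N - of_real D = of_real ((\<Sum>x\<in>Y. norm (F x) ^ 2) / real N - D)"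
    by (simp add: complex_norm_square [symmetric])
  finally show ?thesis by (simp only: norm_of_real power2_eq_square mult.assoc)
qed

section \<open>The moment expanded over smooth polynomials\<close>

definition smooth_poly :: "nat \<Rightarrow> ('a::field poly \<Rightarrow> nat) \<Rightarrow> 'a poly" where
  "smooth_poly X g = (\<Prod>P\<in>primes_upto X. P ^ g P)"

text \<open>This is \<open>w A / |A| ^ (1/2)\<close> of the overview for
  \<open>A = smooth_poly X g\<close>. Indexing by exponent vectors instead of polynomials makes the
  expansion a plain product of series.\<close>

definition smooth_coeff :: "nat \<Rightarrow> nat \<Rightarrow> ('a::{field,finite} poly \<Rightarrow> nat) \<Rightarrow> real" where
  "smooth_coeff k X g =
     (\<Prod>P\<in>primes_upto X. trunc_coeff k (X div degree P) (g P) * (pabs P powr (-1/2)) ^ g P)"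

text \<open>Extensional functions, so that an exponent vector is fixed by its values on the primes
  and represents its polynomial only once.\<close>

abbreviation exponents :: "nat \<Rightarrow> ('a::{field,finite} poly \<Rightarrow> nat) set" where
  "exponents X \<equiv> PiE (primes_upto X) (\<lambda>_. UNIV)"

lemma prime_powr_less_1:
  fixes P :: "'a::{field,finite} poly"
  assumes "P \<in> primes_upto X" "s < 0"
  shows "pabs P powr s < 1"
proof -
  have "pabs P \<ge> 2" using assms pabs_ge_2 by (auto simp: primes_upto_def)
  then show ?thesis using assms(2) by (intro powr_less_one) auto
qed

text \<open>Written over prime powers, the exponent splits into one polynomial in
  \<open>z P = chi P / |P| ^ (1/2)\<close> for each prime. Each exponential is a series in
  \<open>z P\<close>, and the finite product of these absolutely convergent series is multiplied
  out.\<close>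

lemma PX_power_has_sum:
  fixes R :: "'a::{field,finite} poly"
  assumes R: "R \<noteq> 0" and chi: "dirichlet_char R chi" and k: "k > 0"
  shows "((\<lambda>g. of_real (smooth_coeff k X g) * chi (smooth_poly X g)) has_sum (PX X (1/2) chi ^ k)) (exponents X)"
proof -
  define z where "z P = chi P * of_real (pabs P powr (-1/2))" for P
  have nz: "norm (z P) < 1" if "P \<in> primes_upto X" for P
  proof -
    have "norm (z P) \<le> 1 * pabs P powr (-1/2)"
      using mult_right_mono[OF dirichlet_char_norm_le[OF R chi, of P], of "pabs P powr (-1/2)"]
      by (simp add: z_def norm_mult)
    also have "\<dots> < 1" using prime_powr_less_1[OF that] by simp
    finally show ?thesis .
  qed
  have zpow: "chi (P ^ m) * of_real (pabs (P ^ m) powr (-1/2)) = z P ^ m" if "P \<in> primes_upto X" for P m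
  proof -
    have "P \<noteq> 0" using that prime_poly_nonzero by (auto simp: primes_upto_def)
    then have "pabs (P ^ m) powr (-1/2) = (pabs P powr (-1/2)) ^ m"
      using pabs_pos[of P] by (simp add: pabs_power powr_realpow [symmetric] powr_powr mult.commute)
    then show ?thesis by (simp add: z_def dirichlet_char_power[OF chi] power_mult_distrib)
  qed
  have "(\<Sum>A\<in>{A. monic_poly A \<and> degree A \<le> X}. chi A * of_real (vMangoldt A) / ((of_real (pabs A) powr (1/2)) * of_real (ln (pabs A))))
      = (\<Sum>A\<in>{A. monic_poly A \<and> degree A \<le> X}. (chi A * of_real (pabs A powr (-1/2))) * of_real (vMangoldt A / ln (pabs A)))"
  proof (intro sum.cong refl)
    fix A :: "'a poly"
    have "(of_real (pabs A) :: complex) powr (1/2) = of_real (pabs A powr (1/2))"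
      using powr_of_real[of "pabs A" "1/2"] pabs_pos[of A] by simp
    moreover have "pabs A powr (-1/2) = 1 / pabs A powr (1/2)" using powr_minus_divide[of "pabs A" "1/2"] by simp
    ultimately show "chi A * of_real (vMangoldt A) / ((of_real (pabs A) powr (1/2)) * of_real (ln (pabs A)))
        = (chi A * of_real (pabs A powr (-1/2))) * of_real (vMangoldt A / ln (pabs A))"
      by (simp add: field_simps)
  qed
  also have "\<dots> = (\<Sum>P\<in>primes_upto X. \<Sum>m\<in>{1..X div degree P}. (chi (P ^ m) * of_real (pabs (P ^ m) powr (-1/2))) / of_nat m)"
    by (rule sum_vMangoldt)
  also have "\<dots> = (\<Sum>P\<in>primes_upto X. \<Sum>m\<in>{1..X div degree P}. z P ^ m / of_nat m)"
    by (intro sum.cong refl) (simp only: zpow)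
  finally have "PX X (1/2) chi ^ k = exp (\<Sum>P\<in>primes_upto X. of_nat k * (\<Sum>m\<in>{1..X div degree P}. z P ^ m / of_nat m))"
    unfolding PX_def by (simp only: exp_of_nat_mult [symmetric] sum_distrib_left)
  also have "\<dots> = (\<Prod>P\<in>primes_upto X. exp (of_nat k * (\<Sum>m\<in>{1..X div degree P}. z P ^ m / of_nat m)))"
    by (rule exp_sum[OF finite_primes_upto])
  also have "\<dots> = (\<Prod>P\<in>primes_upto X. \<Sum>j. of_real (trunc_coeff k (X div degree P) j) * z P ^ j)"
    by (intro prod.cong refl trunc_coeff_sums_exp [symmetric] k nz)
  finally have PX: "PX X (1/2) chi ^ k = (\<Prod>P\<in>primes_upto X. \<Sum>j. of_real (trunc_coeff k (X div degree P) j) * z P ^ j)" .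
  have "((\<lambda>g. \<Prod>P\<in>primes_upto X. of_real (trunc_coeff k (X div degree P) (g P)) * z P ^ g P) has_sum (PX X (1/2) chi ^ k)) (exponents X)"
    unfolding PX by (rule has_sum_prod_PiE_complex[OF finite_primes_upto]) (use summable_trunc_coeff[OF k nz] in auto)
  also have "(\<lambda>g. \<Prod>P\<in>primes_upto X. of_real (trunc_coeff k (X div degree P) (g P)) * z P ^ g P)
      = (\<lambda>g. of_real (smooth_coeff k X g) * chi (smooth_poly X g))"
    unfolding smooth_coeff_def smooth_poly_def dirichlet_char_prod[OF chi] of_real_prod prod.distrib [symmetric]
    by (intro ext prod.cong refl) (simp add: z_def dirichlet_char_power[OF chi] power_mult_distrib)
  finally show ?thesis .
qed

lemma smooth_coeff_nonneg: "smooth_coeff k X g \<ge> 0"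
  unfolding smooth_coeff_def by (intro prod_nonneg mult_nonneg_nonneg trunc_coeff_nonneg) auto

lemma pabs_smooth_poly_powr:
  fixes g :: "'a::{field,finite} poly \<Rightarrow> nat"
  shows "pabs (smooth_poly X g) powr s = (\<Prod>P\<in>primes_upto X. (pabs P powr s) ^ g P)"
proof -
  have nz: "P \<noteq> 0" if "P \<in> primes_upto X" for P :: "'a poly"
    using that prime_poly_nonzero by (auto simp: primes_upto_def)
  have "pabs (\<Prod>P\<in>T. P ^ g P) powr s = (\<Prod>P\<in>T. (pabs P powr s) ^ g P)" if "T \<subseteq> primes_upto X" for T
    using finite_subset[OF that finite_primes_upto] that
  proof (induction T)
    case empty
    then show ?case by (simp add: pabs_def)
  next
    case (insert P T)
    have "(\<Prod>P\<in>T. P ^ g P) \<noteq> 0" "P \<noteq> 0"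
      using insert nz by (auto simp: prod_zero_iff)
    then have "pabs (\<Prod>P\<in>insert P T. P ^ g P) = pabs P ^ g P * pabs (\<Prod>P\<in>T. P ^ g P)"
      using insert by (simp add: pabs_mult pabs_power)
    moreover have "(pabs P ^ g P) powr s = (pabs P powr s) ^ g P"
      using pabs_pos[of P] by (simp add: powr_realpow [symmetric] powr_powr mult.commute)
    ultimately show ?case using insert pabs_pos by (simp add: powr_mult less_imp_le)
  qed
  then show ?thesis unfolding smooth_poly_def by simp
qed

text \<open>The weight turns \<open>|A| ^ (-1/2)\<close> into \<open>|A| ^ (-1/4)\<close>, so the
  sum is an Euler product with factors from \<open>trunc_coeff_sums_exp\<close> at the real points
  \<open>|P| ^ (-1/4)\<close>. Its logarithm is \<open>k\<close> times the sum of
  \<open>q ^ (3 n / 4) / n\<close> over \<open>n\<close> up to \<open>X\<close>.\<close>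

lemma smooth_weight_has_sum:
  assumes k: "k > 0"
  shows "\<exists>W. ((\<lambda>g. smooth_coeff k X g * pabs (smooth_poly X g) powr (1/4)) has_sum W) (exponents X :: ('a::{field,finite} poly \<Rightarrow> nat) set)
    \<and> 0 \<le> W \<and> W \<le> exp (real k * (real X * real CARD('a) powr (3/4 * real X)))"
proof -
  let ?q = "real CARD('a)"
  have q: "?q \<ge> 2" using card_field_ge_2[where 'a='a] by simp
  let ?S = "primes_upto X :: 'a poly set"
  let ?y = "\<lambda>P :: 'a poly. pabs P powr (-1/4)"
  let ?f = "\<lambda>P j. trunc_coeff k (X div degree P) j * ?y P ^ j"
  define W where "W = (\<Prod>P\<in>?S. suminf (?f P))"
  have sf: "suminf (?f P) = exp (real k * (\<Sum>m\<in>{1..X div degree P}. ?y P ^ m / real m))" if "P \<in> ?S" for P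
    using trunc_coeff_sums_exp[OF k, of "?y P" "X div degree P"] prime_powr_less_1[OF that] by simp
  have "((\<lambda>g. \<Prod>P\<in>?S. ?f P (g P)) has_sum W) (exponents X)"
    unfolding W_def
  proof (rule has_sum_prod_PiE_nonneg[OF finite_primes_upto])
    fix P assume P: "P \<in> ?S"
    show "?f P j \<ge> 0" for j by (simp add: trunc_coeff_nonneg)
    have "norm (?y P) < 1" using prime_powr_less_1[OF P, of "-1/4"] by simp
    from summable_norm_cancel[OF summable_trunc_coeff[OF k this, of "X div degree P"]]
    show "summable (?f P)" by simp
    show "suminf (?f P) > 0" by (simp only: sf[OF P] exp_gt_zero)
  qed
  moreover have "(\<Prod>P\<in>?S. ?f P (g P)) = smooth_coeff k X g * pabs (smooth_poly X g) powr (1/4)" for g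
  proof -
    have "pabs P powr (-1/2) * pabs P powr (1/4) = ?y P" for P :: "'a poly"
      by (simp add: powr_add [symmetric])
    then show ?thesis
      unfolding smooth_coeff_def pabs_smooth_poly_powr prod.distrib [symmetric]
      by (intro prod.cong refl) (simp only: mult.assoc power_mult_distrib [symmetric])
  qed
  ultimately have 1: "((\<lambda>g :: 'a poly \<Rightarrow> nat. smooth_coeff k X g * pabs (smooth_poly X g) powr (1/4)) has_sum W) (exponents X)" by simp
  have "W = (\<Prod>P\<in>?S. exp (real k * (\<Sum>m\<in>{1..X div degree P}. ?y P ^ m / real m)))"
    unfolding W_def by (intro prod.cong refl sf)
  also have "\<dots> = exp (real k * (\<Sum>P\<in>?S. \<Sum>m\<in>{1..X div degree P}. ?y P ^ m / real m))"
    by (simp only: exp_sum[OF finite_primes_upto] sum_distrib_left)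
  also have "(\<Sum>P\<in>?S. \<Sum>m\<in>{1..X div degree P}. ?y P ^ m / real m)
      = (\<Sum>P\<in>?S. \<Sum>m\<in>{1..X div degree P}. ?q powr (-1/4 * real (m * degree P)) / real m)"
    using q by (intro sum.cong refl) (simp add: pabs_def powr_realpow [symmetric] powr_powr mult_ac)
  also have "\<dots> = (\<Sum>n\<in>{1..X}. ?q powr (-1/4 * real n) * ?q ^ n / real n)"
    by (rule sum_prime_powers_radial)
  also have "\<dots> \<le> (\<Sum>n\<in>{1..X}. ?q powr (3/4 * real X))"
  proof (rule sum_mono)
    fix n assume n: "n \<in> {1..X}"
    have "?q powr (-1/4 * real n) * ?q ^ n / real n \<le> ?q powr (-1/4 * real n) * ?q ^ n"
      using n frac_le[of "?q powr (-1/4 * real n) * ?q ^ n" "?q powr (-1/4 * real n) * ?q ^ n" 1 "real n"] by simp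
    also have "\<dots> = ?q powr (3/4 * real n)"
      using q by (simp add: powr_realpow [symmetric] powr_add [symmetric])
    also have "\<dots> \<le> ?q powr (3/4 * real X)" using n q by (intro powr_mono) auto
    finally show "?q powr (-1/4 * real n) * ?q ^ n / real n \<le> ?q powr (3/4 * real X)" .
  qed
  also have "\<dots> = real X * ?q powr (3/4 * real X)" by simp
  finally have 2: "W \<le> exp (real k * (real X * ?q powr (3/4 * real X)))" by (simp add: mult_left_mono)
  have "W \<ge> 0" unfolding W_def by (intro prod_nonneg) (simp only: sf exp_ge_zero)
  then show ?thesis using 1 2 by blast
qed

text \<open>Coprimality to \<open>R\<close> means that the exponents vanish at all primes dividing
  \<open>R\<close>. The indicator thus factors over primes, and the local factor at such a prime
  shrinks to 1.\<close>

lemma smooth_diagonal_has_sum: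
  fixes R :: "'a::{field,finite} poly"
  assumes R: "R \<noteq> 0" and k: "k > 0"
  shows "((\<lambda>g. smooth_coeff k X g ^ 2 * (if coprime (smooth_poly X g) R then 1 else 0)) has_sum
    (\<Prod>P\<in>{P\<in>primes_upto X. \<not> P dvd R}. trunc_series k (X div degree P) (1 / pabs P))) (exponents X)"
proof -
  let ?S = "primes_upto X :: 'a poly set"
  let ?f = "\<lambda>P j. if P dvd R \<and> j > 0 then 0 else trunc_coeff k (X div degree P) j ^ 2 * (1 / pabs P) ^ j"
  have sums: "?f P sums (if P dvd R then 1 else trunc_series k (X div degree P) (1 / pabs P))" if P: "P \<in> ?S" for P
  proof (cases "P dvd R")
    case True
    have "(\<lambda>j. if j = 0 then 1 else 0 :: real) sums 1" using sums_single[of 0 "\<lambda>_. 1::real"] by simp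
    moreover have "?f P = (\<lambda>j. if j = 0 then 1 else 0)" using True by auto
    ultimately show ?thesis using True by simp
  next
    case False
    have "prime_poly P" using P by (simp add: primes_upto_def)
    from summable_trunc_sq[OF k _ one_div_pabs(3)[OF this], of "X div degree P"]
    have "summable (\<lambda>j. trunc_coeff k (X div degree P) j ^ 2 * (1 / pabs P) ^ j)"
      using pabs_pos[of P] by simp
    then show ?thesis using False by (simp add: trunc_series_def summable_sums)
  qed
  have G: "trunc_series k (X div degree P) (1 / pabs P) > 0" if P: "P \<in> ?S" for P
  proof -
    have "prime_poly P" using P by (simp add: primes_upto_def)
    from trunc_series_ge_1[OF k _ one_div_pabs(3)[OF this], of "X div degree P"]
    show ?thesis using pabs_pos[of P] by simp
  qed
  have "((\<lambda>g. \<Prod>P\<in>?S. ?f P (g P)) has_sum (\<Prod>P\<in>?S. suminf (?f P))) (exponents X)"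
  proof (rule has_sum_prod_PiE_nonneg[OF finite_primes_upto])
    fix P assume P: "P \<in> ?S"
    show "?f P j \<ge> 0" for j using pabs_pos[of P] by simp
    show "summable (?f P)" using sums[OF P] by (rule sums_summable)
    show "suminf (?f P) > 0" unfolding sums_unique[OF sums[OF P], symmetric] using G[OF P] by simp
  qed
  moreover have "(\<Prod>P\<in>?S. suminf (?f P)) = (\<Prod>P\<in>?S. if \<not> P dvd R then trunc_series k (X div degree P) (1 / pabs P) else 1)"
    by (intro prod.cong refl) (simp add: sums_unique[OF sums, symmetric])
  moreover have "\<dots> = (\<Prod>P\<in>{P\<in>?S. \<not> P dvd R}. trunc_series k (X div degree P) (1 / pabs P))"
    by (rule prod.inter_filter [symmetric, OF finite_primes_upto])
  moreover have "(\<Prod>P\<in>?S. ?f P (g P)) = smooth_coeff k X g ^ 2 * (if coprime (smooth_poly X g) R then 1 else 0)" for g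
  proof (cases "coprime (smooth_poly X g) R")
    case True
    have "g P = 0" if "P \<in> ?S" "P dvd R" for P
    proof (rule ccontr)
      assume "g P \<noteq> 0"
      then have "P dvd P ^ g P" by (simp add: dvd_power)
      also have "\<dots> dvd smooth_poly X g" unfolding smooth_poly_def by (rule dvd_prodI[OF finite_primes_upto that(1)])
      finally have "\<not> coprime (smooth_poly X g) R"
        using coprime_poly_iff_no_prime[OF R] that by (auto simp: prime_divisors_def primes_upto_def)
      then show False using True by simp
    qed
    moreover have "((pabs P powr (-1/2)) ^ j)\<^sup>2 = (1 / pabs P) ^ j" for P :: "'a poly" and j
    proof -
      have "(pabs P powr (-1/2))\<^sup>2 = 1 / pabs P"
        using pabs_pos[of P] by (simp add: power2_eq_square powr_add [symmetric] powr_minus_divide)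
      then show ?thesis by (metis power_mult mult.commute)
    qed
    ultimately have "(\<Prod>P\<in>?S. ?f P (g P))
        = (\<Prod>P\<in>?S. (trunc_coeff k (X div degree P) (g P) * (pabs P powr (-1/2)) ^ g P)\<^sup>2)"
      by (intro prod.cong refl) (auto simp only: power_mult_distrib split: if_split)
    then show ?thesis
      using True by (simp add: smooth_coeff_def prod_power_distrib)
  next
    case False
    then obtain P where P: "prime_poly P" "P dvd R" "P dvd smooth_poly X g"
      using coprime_poly_iff_no_prime[OF R] by (auto simp: prime_divisors_def)
    then obtain Q where Q: "Q \<in> ?S" "P dvd Q ^ g Q"
      using prime_poly_dvd_prod[OF P(1) finite_primes_upto] unfolding smooth_poly_def by blast
    have "P dvd Q" using prime_poly_dvd_power[OF P(1) Q(2)] .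
    then have "P = Q" using Q(1) P(1) prime_poly_dvd_prime_poly by (auto simp: primes_upto_def)
    moreover have "g Q \<noteq> 0" using Q(2) prime_poly_not_unit[OF P(1)] by (intro notI) simp
    ultimately have "?f Q (g Q) = 0" using P(2) by simp
    then have "(\<Prod>P\<in>?S. ?f P (g P)) = 0" using Q(1) by (intro prod_zero[OF finite_primes_upto]) blast
    then show ?thesis using False by simp
  qed
  ultimately show ?thesis by simp
qed

text \<open>An instance of \<open>second_moment_approx\<close> with \<open>v\<close> the fourth root
  of the absolute value; on the diagonal the average is the indicator of coprimality to
  \<open>R\<close>.\<close>

lemma moment_approx:
  fixes R :: "'a::{field,finite} poly"
  assumes R: "monic_poly R" and phi: "phi_star R > 0" and k: "k > 0"
  shows "\<bar>(1 / real (phi_star R)) * (\<Sum>chi\<in>prim_chars R. cmod (PX X (1/2) chi) ^ (2 * k))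
      - (\<Prod>P\<in>{P\<in>primes_upto X. \<not> P dvd R}. trunc_series k (X div degree P) (1 / pabs P))\<bar>
    \<le> 8 ^ (CARD('a) ^ 6) * real CARD('a) powr (- real (degree R) / 8)
        * exp (real k * (real X * real CARD('a) powr (3/4 * real X))) ^ 2"
proof -
  have R0: "R \<noteq> 0" using monic_poly_nonzero[OF R] .
  let ?K = "8 ^ (CARD('a) ^ 6) * real CARD('a) powr (- real (degree R) / 8)"
  let ?D = "\<Prod>P\<in>{P\<in>primes_upto X. \<not> P dvd R}. trunc_series k (X div degree P) (1 / pabs P)"
  have dc: "dirichlet_char R chi" if "chi \<in> prim_chars R" for chi
    using that by (simp add: prim_chars_def primitive_char_def)
  obtain W where W: "((\<lambda>g. smooth_coeff k X g * pabs (smooth_poly X g) powr (1/4)) has_sum W) (exponents X :: ('a poly \<Rightarrow> nat) set)"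
    "0 \<le> W" "W \<le> exp (real k * (real X * real CARD('a) powr (3/4 * real X)))"
    using smooth_weight_has_sum[OF k] by blast
  have nz: "smooth_poly X g \<noteq> (0 :: 'a poly)" for g
    unfolding smooth_poly_def prod_zero_iff[OF finite_primes_upto] using prime_poly_nonzero by (auto simp: primes_upto_def)
  have "\<bar>(\<Sum>chi\<in>prim_chars R. norm (PX X (1/2) chi ^ k) ^ 2) / real (phi_star R) - ?D\<bar> \<le> ?K * W ^ 2"
  proof (rule second_moment_approx[OF _ phi PX_power_has_sum[OF R0 dc k] _ _ _ W(1) _ _ smooth_diagonal_has_sum[OF R0 k]])
    show "finite (prim_chars R)" using phi by (intro card_ge_0_finite) (simp add: phi_star_def)
    fix g :: "'a poly \<Rightarrow> nat"
    have "chi A * cnj (chi A) = (if coprime A R then 1 else 0)" if "chi \<in> prim_chars R" for chi A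
      using dirichlet_char_mult_cnj[OF R0 dc[OF that], of A] dirichlet_char_eq_0[OF dc[OF that], of A] by auto
    then show "(\<Sum>chi\<in>prim_chars R. chi (smooth_poly X g) * cnj (chi (smooth_poly X g))) / of_nat (phi_star R)
        = of_real (if coprime (smooth_poly X g) R then 1 else 0)"
      using phi by (simp add: phi_star_def)
    fix h :: "'a poly \<Rightarrow> nat" assume gh: "g \<in> exponents X" "h \<in> exponents X" "g \<noteq> h"
    have "inj_on (\<lambda>g. \<Prod>P\<in>(primes_upto X :: 'a poly set). P ^ g P) (exponents X)"
      by (rule prod_prime_powers_inj[OF finite_primes_upto]) (simp add: primes_upto_def)
    then have "smooth_poly X g \<noteq> smooth_poly X h"
      using gh unfolding smooth_poly_def inj_on_def by blast
    then show "norm ((\<Sum>chi\<in>prim_chars R. chi (smooth_poly X g) * cnj (chi (smooth_poly X h))) / of_nat (phi_star R))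
        \<le> ?K * (pabs (smooth_poly X g) powr (1/4) * pabs (smooth_poly X h) powr (1/4))"
      by (rule norm_prim_char_average_le[OF R phi _ nz nz])
  qed (auto simp: smooth_coeff_nonneg)
  also have "\<dots> \<le> ?K * exp (real k * (real X * real CARD('a) powr (3/4 * real X))) ^ 2"
    using W(2,3) by (intro mult_left_mono power_mono) auto
  finally show ?thesis by (simp add: norm_power power_mult [symmetric] mult.commute[of k])
qed

section \<open>The asymptotic formula\<close>

text \<open>The bound of \<open>moment_approx\<close> with \<open>degree R\<close> lowered to
  \<open>q ^ X\<close>, so that it depends on \<open>X\<close> alone.\<close>

definition moment_error :: "nat \<Rightarrow> nat \<Rightarrow> nat \<Rightarrow> real" where
  "moment_error q k X = 8 ^ (q ^ 6) * real q powr (- (real q ^ X) / 8)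
     * exp (real k * (real X * real q powr (3/4 * real X))) ^ 2"

lemma moment_error_tendsto:
  assumes "q \<ge> 2"
  shows "moment_error q k \<longlonglongrightarrow> 0"
proof -
  define b where "b = real q powr (1/4)"
  define L where "L = ln (real q)"
  have b: "b > 1" using assms by (simp add: b_def gr_one_powr)
  have L: "L > 0" using assms by (simp add: L_def)
  \<comment> \<open>In terms of \<open>b = q ^ (1/4)\<close> all powers are integral:
    \<open>q ^ (3 X / 4) = b ^ (3 X)\<close> and \<open>q ^ X = b ^ (4 X)\<close>. Factoring out
    \<open>b ^ (3 X)\<close> leaves a bracket that tends to minus infinity.\<close>
  have eq: "moment_error q k X = 8 ^ (q ^ 6) * exp (b ^ (3 * X) * (2 * real k * real X - L / 8 * b ^ X))" for X
  proof -
    have "real q powr (3/4 * real X) = (real q powr (1/4)) powr real (3 * X)"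
      unfolding powr_powr by simp
    then have 1: "real q powr (3/4 * real X) = b ^ (3 * X)"
      using b by (simp only: b_def [symmetric] powr_realpow)
    have "real q ^ X = (real q powr (1/4)) powr real (4 * X)"
      unfolding powr_powr using assms by (simp add: powr_realpow)
    then have "real q ^ X = b ^ (4 * X)" using b by (simp only: b_def [symmetric] powr_realpow)
    also have "4 * X = 3 * X + X" by simp
    finally have 2: "real q ^ X = b ^ (3 * X) * b ^ X" by (simp only: power_add)
    show ?thesis
      unfolding moment_error_def 1 2 using assms
      by (simp add: powr_def L_def exp_add [symmetric] exp_of_nat_mult [symmetric] power2_eq_square algebra_simps)
  qed
  have "(\<lambda>X. 8 ^ (q ^ 6) * exp (b ^ (3 * X) * (2 * real k * real X - L / 8 * b ^ X))) \<longlonglongrightarrow> 8 ^ (q ^ 6) * 0"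
  proof (intro tendsto_mult tendsto_const)
    have "\<forall>\<^sub>F X in sequentially. 2 * real k * real X - L / 8 * b ^ X \<le> -1" using b L by real_asymp
    then have "\<forall>\<^sub>F X in sequentially. exp (b ^ (3 * X) * (2 * real k * real X - L / 8 * b ^ X)) \<le> exp (- (b ^ (3 * X)))"
    proof eventually_elim
      fix X :: nat assume "2 * real k * real X - L / 8 * b ^ X \<le> -1"
      then have "b ^ (3 * X) * (2 * real k * real X - L / 8 * b ^ X) \<le> b ^ (3 * X) * (-1)"
        using b by (intro mult_left_mono) auto
      then show "exp (b ^ (3 * X) * (2 * real k * real X - L / 8 * b ^ X)) \<le> exp (- (b ^ (3 * X)))" by simp
    qed
    moreover have "(\<lambda>X. exp (- (b ^ (3 * X)))) \<longlonglongrightarrow> 0" using b by real_asymp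
    ultimately show "(\<lambda>X. exp (b ^ (3 * X) * (2 * real k * real X - L / 8 * b ^ X))) \<longlonglongrightarrow> 0"
      by (rule tendsto_sandwich[OF always_eventually _ tendsto_const, rotated 1]) simp
  qed
  then show ?thesis unfolding eq [symmetric] by simp
qed

text \<open>The part of the comparison that is independent of \<open>R\<close>: a partial product of
  a(k) against its limit, times the Mertens product against its asymptotic value, raised to
  \<open>k ^ 2\<close>.\<close>

definition euler_ratio :: "'a::{field,finite} itself \<Rightarrow> nat \<Rightarrow> nat \<Rightarrow> real" where
  "euler_ratio TYPE('a) k X =
     (\<Prod>P\<in>(primes_upto X :: 'a poly set). (1 - 1 / pabs P) ^ (k ^ 2) * full_series k (1 / pabs P)) / a_const TYPE('a) k
     * ((\<Prod>P\<in>(primes_upto X :: 'a poly set). inverse (1 - 1 / pabs P)) / (exp euler_mascheroni * real X)) ^ (k ^ 2)"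

lemma euler_ratio_tendsto:
  assumes "k > 0"
  shows "euler_ratio TYPE('a::{field,finite}) k \<longlonglongrightarrow> 1"
proof -
  have "euler_ratio TYPE('a) k \<longlonglongrightarrow> a_const TYPE('a) k / a_const TYPE('a) k * 1 ^ (k ^ 2)"
    unfolding euler_ratio_def
    by (intro tendsto_intros a_const_limit(2)[OF assms] mertens_third) (use a_const_limit(1)[OF assms, where 'a='a] in simp)
  then show ?thesis using a_const_limit(1)[OF assms, where 'a='a] by simp
qed

text \<open>The product of \<open>full_series\<close> over all primes up to \<open>X\<close> is
  split by divisibility of \<open>R\<close>: the primes dividing \<open>R\<close> cancel the inverse
  local factors in \<open>T\<close>, the others normalise the diagonal. The convergence factors of
  a(k) cancel against the Mertens product.\<close>

lemma diagonal_ratio: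
  fixes R :: "'a::{field,finite} poly" and X :: nat
  assumes k: "k > 0"
  defines "D \<equiv> (\<Prod>P\<in>{P\<in>primes_upto X. \<not> P dvd R}. trunc_series k (X div degree P) (1 / pabs P))"
    and "T \<equiv> a_const TYPE('a) k * (\<Prod>P\<in>{P\<in>primes_upto X. P dvd R}. inverse (locfac k P))
      * (exp euler_mascheroni * real X) ^ (k ^ 2)"
  shows "D / T = (\<Prod>P\<in>{P\<in>primes_upto X. \<not> P dvd R}. trunc_series k (X div degree P) (1 / pabs P) / full_series k (1 / pabs P))
    * euler_ratio TYPE('a) k X"
proof -
  let ?S = "primes_upto X :: 'a poly set"
  let ?N = "{P\<in>?S. \<not> P dvd R}" and ?V = "{P\<in>?S. P dvd R}"
  let ?L = "\<lambda>P::'a poly. full_series k (1 / pabs P)"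
  have L: "?L P \<ge> 1" and x: "1 - 1 / pabs P > 0" if "P \<in> ?S" for P
    using that full_series_ge_1[OF k, of "1 / pabs P"] one_div_pabs[of P] by (auto simp: primes_upto_def)
  have nz: "prod ?L U \<noteq> 0" if "U \<subseteq> ?S" for U
    using L that finite_subset[OF that finite_primes_upto] by (force simp: prod_zero_iff)
  have V: "(\<Prod>P\<in>?V. inverse (locfac k P)) = inverse (prod ?L ?V)"
    unfolding prod_inversef [symmetric] by (intro prod.cong refl) (simp add: locfac_prime k primes_upto_def)
  have "prod ?L ?S = prod ?L ?V * prod ?L (?S - ?V)"
    by (subst mult.commute, rule prod.subset_diff) (auto simp: finite_primes_upto)
  also have "?S - ?V = ?N" by blast
  finally have split: "prod ?L ?S = prod ?L ?V * prod ?L ?N" .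
  have ratio: "(\<Prod>P\<in>?N. trunc_series k (X div degree P) (1 / pabs P) / ?L P) = D / prod ?L ?N"
    unfolding D_def by (rule prod_dividef)
  have cancel: "(\<Prod>P\<in>?S. (1 - 1 / pabs P) ^ (k ^ 2)) * (\<Prod>P\<in>?S. inverse (1 - 1 / pabs P)) ^ (k ^ 2) = 1"
    unfolding prod_power_distrib prod.distrib [symmetric]
  proof (rule prod.neutral, rule ballI)
    fix P assume "P \<in> ?S"
    then have "1 - 1 / pabs P \<noteq> 0" using x by fastforce
    then show "(1 - 1 / pabs P) ^ (k ^ 2) * inverse (1 - 1 / pabs P) ^ (k ^ 2) = 1"
      unfolding power_mult_distrib [symmetric] by simp
  qed
  have "euler_ratio TYPE('a) k X = ((\<Prod>P\<in>?S. (1 - 1 / pabs P) ^ (k ^ 2)) * (\<Prod>P\<in>?S. inverse (1 - 1 / pabs P)) ^ (k ^ 2))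
      * prod ?L ?S / (a_const TYPE('a) k * (exp euler_mascheroni * real X) ^ (k ^ 2))"
    unfolding euler_ratio_def prod.distrib power_divide by (simp only: times_divide_eq_left times_divide_eq_right divide_divide_eq_left mult_ac)
  then have er: "euler_ratio TYPE('a) k X = prod ?L ?V * prod ?L ?N / (a_const TYPE('a) k * (exp euler_mascheroni * real X) ^ (k ^ 2))"
    by (simp only: cancel split mult_1_left)
  show ?thesis
    unfolding ratio er T_def V using nz[of ?N] by (simp add: divide_simps)
qed

theorem theorem1p5:
  fixes k :: nat
  assumes "k > 0"
  shows "\<forall>\<epsilon>>0. \<exists>N. \<forall>(X::nat) (R::'a::{field,finite} poly).
     monic_poly R \<and> N \<le> X \<and> N \<le> degree R \<and>
     real X \<le> log (real CARD('a)) (real (degree R)) \<and> phi_star R > 0 \<longrightarrow>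
     \<bar> ((1 / real (phi_star R)) * (\<Sum>chi\<in>prim_chars R. cmod (PX X (1/2) chi) ^ (2 * k)))
       / (a_const TYPE('a) k
          * (\<Prod>P\<in>{P. prime_poly P \<and> degree P \<le> X \<and> P dvd R}. inverse (locfac k P))
          * (exp euler_mascheroni * real X) ^ (k ^ 2)) - 1 \<bar> < \<epsilon>"
proof (intro allI impI)
  fix \<epsilon> :: real assume "\<epsilon> > 0"
  let ?q = "CARD('a)"
  have q: "?q \<ge> 2" by (rule card_field_ge_2)
  let ?r = "euler_ratio TYPE('a) k"
  \<comment> \<open>The three summands come from the off-diagonal terms, from the truncation of the
    local factors, and from the Euler product being finite.\<close>
  define err where "err X = moment_error ?q k X * \<bar>?r X\<bar> + (tail_error ?q k X * \<bar>?r X\<bar> + \<bar>?r X - 1\<bar>)" for X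
  have "err \<longlonglongrightarrow> 0 * \<bar>1\<bar> + (0 * \<bar>1\<bar> + \<bar>1 - 1\<bar>)"
    unfolding err_def
    by (intro tendsto_intros moment_error_tendsto tail_error_tendsto euler_ratio_tendsto q assms)
  then have "\<forall>\<^sub>F X in sequentially. err X < \<epsilon>" using \<open>\<epsilon> > 0\<close> by (intro order_tendstoD(2)[of err 0]) simp_all
  then obtain N where N: "\<And>X. X \<ge> N \<Longrightarrow> err X < \<epsilon>" unfolding eventually_sequentially by blast
  show "\<exists>N. \<forall>(X::nat) (R::'a poly).
     monic_poly R \<and> N \<le> X \<and> N \<le> degree R \<and>
     real X \<le> log (real CARD('a)) (real (degree R)) \<and> phi_star R > 0 \<longrightarrow>
     \<bar> ((1 / real (phi_star R)) * (\<Sum>chi\<in>prim_chars R. cmod (PX X (1/2) chi) ^ (2 * k)))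
       / (a_const TYPE('a) k
          * (\<Prod>P\<in>{P. prime_poly P \<and> degree P \<le> X \<and> P dvd R}. inverse (locfac k P))
          * (exp euler_mascheroni * real X) ^ (k ^ 2)) - 1 \<bar> < \<epsilon>"
  \<comment> \<open>The 1 makes \<open>degree R\<close> positive, so that the logarithmic condition
    can be exponentiated.\<close>
  proof (intro exI[of _ "max N 1"] allI impI)
    fix X :: nat and R :: "'a poly"
    assume *: "monic_poly R \<and> max N 1 \<le> X \<and> max N 1 \<le> degree R \<and>
     real X \<le> log (real CARD('a)) (real (degree R)) \<and> phi_star R > 0"
    define M where "M = (1 / real (phi_star R)) * (\<Sum>chi\<in>prim_chars R. cmod (PX X (1/2) chi) ^ (2 * k))"
    define D where "D = (\<Prod>P\<in>{P\<in>primes_upto X. \<not> P dvd R}. trunc_series k (X div degree P) (1 / pabs P))"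
    define T where "T = a_const TYPE('a) k * (\<Prod>P\<in>{P\<in>primes_upto X. P dvd R}. inverse (locfac k P))
      * (exp euler_mascheroni * real X) ^ (k ^ 2)"
    define Q where "Q = (\<Prod>P\<in>{P\<in>primes_upto X. \<not> P dvd R}.
      trunc_series k (X div degree P) (1 / pabs P) / full_series k (1 / pabs P))"
    have DT: "D / T = Q * ?r X" unfolding D_def T_def Q_def by (rule diagonal_ratio[OF assms])
    have sub: "{P\<in>primes_upto X. \<not> P dvd R} \<subseteq> primes_upto X" by blast
    have Q: "1 - tail_error ?q k X \<le> Q" "Q \<le> 1"
      unfolding Q_def by (rule trunc_product_ratio[OF assms sub])+
    \<comment> \<open>A diagonal of size at least 1 turns the absolute error of
      \<open>moment_approx\<close> into a relative one.\<close>
    have D1: "D \<ge> 1" unfolding D_def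
    proof (rule prod_ge_1)
      fix P assume "P \<in> {P\<in>primes_upto X. \<not> P dvd R}"
      then have "prime_poly P" by (simp add: primes_upto_def)
      then show "trunc_series k (X div degree P) (1 / pabs P) \<ge> 1"
        using one_div_pabs[of P] by (intro trunc_series_ge_1 assms) auto
    qed
    have Q0: "Q \<ge> 0" unfolding Q_def
    proof (rule prod_nonneg)
      fix P assume "P \<in> {P\<in>primes_upto X. \<not> P dvd R}"
      then have "prime_poly P" by (simp add: primes_upto_def)
      then have y: "0 \<le> 1 / pabs P" "1 / pabs P < 1" using one_div_pabs[of P] by auto
      show "0 \<le> trunc_series k (X div degree P) (1 / pabs P) / full_series k (1 / pabs P)"
        using trunc_series_ge_1[OF assms y, of "X div degree P"] full_series_ge_1[OF assms y] by simp
    qed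
    \<comment> \<open>Here the condition relating \<open>X\<close> to \<open>degree R\<close>
      enters; it makes the error estimate uniform in \<open>R\<close>.\<close>
    have "real ?q ^ X \<le> real (degree R)"
    proof -
      have "real ?q powr real X \<le> real (degree R)"
        using * q by (subst le_log_iff [symmetric]) auto
      then show ?thesis using q by (simp add: powr_realpow)
    qed
    then have "real ?q powr (- real (degree R) / 8) \<le> real ?q powr (- (real ?q ^ X) / 8)"
      using q by (intro powr_mono) auto
    then have "8 ^ (?q ^ 6) * real ?q powr (- real (degree R) / 8) * exp (real k * (real X * real ?q powr (3/4 * real X))) ^ 2
        \<le> moment_error ?q k X"
      unfolding moment_error_def by (intro mult_right_mono mult_left_mono) auto
    then have MD: "\<bar>M - D\<bar> \<le> moment_error ?q k X"
      using moment_approx[of R k X] * assms unfolding M_def D_def by linarith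
    have "M / T - 1 = (M - D) / D * (Q * ?r X) + ((Q - 1) * ?r X + (?r X - 1))"
    proof -
      have "M / T = M / D * (D / T)" using D1 by simp
      also have "M / D = 1 + (M - D) / D" using D1 by (simp add: diff_divide_distrib)
      finally show ?thesis unfolding DT by (simp add: algebra_simps)
    qed
    also have "\<bar>\<dots>\<bar> \<le> \<bar>(M - D) / D * (Q * ?r X)\<bar> + (\<bar>(Q - 1) * ?r X\<bar> + \<bar>?r X - 1\<bar>)" by linarith
    also have "\<dots> \<le> err X"
      unfolding err_def
    proof (intro add_mono order_refl)
      have "\<bar>(M - D) / D\<bar> \<le> \<bar>M - D\<bar>" using D1 by (simp add: abs_divide divide_le_eq mult_le_cancel_left1)
      then have "\<bar>(M - D) / D\<bar> \<le> moment_error ?q k X" using MD by linarith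
      moreover have "\<bar>Q * ?r X\<bar> \<le> \<bar>?r X\<bar>" using Q Q0 by (simp add: abs_mult mult_left_le_one_le)
      ultimately show "\<bar>(M - D) / D * (Q * ?r X)\<bar> \<le> moment_error ?q k X * \<bar>?r X\<bar>"
        unfolding abs_mult[of "(M - D) / D"] using MD by (intro mult_mono) auto
      show "\<bar>(Q - 1) * ?r X\<bar> \<le> tail_error ?q k X * \<bar>?r X\<bar>"
        unfolding abs_mult using Q by (intro mult_right_mono) auto
    qed
    also have "\<dots> < \<epsilon>" using N * by simp
    finally have "\<bar>M / T - 1\<bar> < \<epsilon>" .
    moreover have "{P. prime_poly P \<and> degree P \<le> X \<and> P dvd R} = {P\<in>primes_upto X. P dvd R}"
      by (auto simp: primes_upto_def)
    ultimately show "\<bar> ((1 / real (phi_star R)) * (\<Sum>chi\<in>prim_chars R. cmod (PX X (1/2) chi) ^ (2 * k)))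
       / (a_const TYPE('a) k
          * (\<Prod>P\<in>{P. prime_poly P \<and> degree P \<le> X \<and> P dvd R}. inverse (locfac k P))
          * (exp euler_mascheroni * real X) ^ (k ^ 2)) - 1 \<bar> < \<epsilon>"
      unfolding M_def T_def by simp
  qed
qed

end
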